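(* Let $n=2$, so that the ambient space is $\mathbb P^3=\mathbb P(V)$, and let $m\ge2$ and $d\ge m$ be integers. If $(m,d)\ne(2,2)$, the incidence projection $$\widetilde\rho_m:\mathbb P(\widetilde{\mathcal F}^m_d)\longrightarrow\mathbb B^m_d$$ is birational.
   Context: We work over $\mathbb C$; $(V,\omega)$ is a complex symplectic vector space of dimension $2n$ and $\mathbb P^{2n-1}=\mathbb P(V)$ (here $n=2$). For a hyperplane $H=V(\ell)$, the polar point is $\sigma(H)=[v_\ell]\in H$, where $\ell(u)=\omega(v_\ell,u)$ for all $u\in V$. For a vector bundle $E$ on a base $B$, $\pi:\mathbb P(E)\to B$ parametrizes one-dimensional subspaces of the fibers, with tautological line subbundle $\mathcal O_{\mathbb P(E)}(-1)=\mathcal O_E(-1)\subset\pi^*E$; $\operatorname{Sym}^kE=0$ for $k<0$; pullbacks of bundles are not written. Let $\check{\mathbb P}^{2n-1}$ be the space of hyperplanes of $\mathbb P(V)$ and $\mathcal F=V^\vee\otimes\mathcal O_{\check{\mathbb P}^{2n-1}}$. The tautological sequence $0\to\mathcal O_{\check{\mathbb P}^{2n-1}}(-1)\to\mathcal F\to\mathcal Q\to0$ defines $\mathcal Q$ (its fiber at $H$ is the space of linear forms on $H$). The bundle $\mathbb P(\mathcal Q^\vee)$ parametrizes pairs $(H,p)$ with $p\in H$; on it $0\to\mathcal G\to\mathcal Q\to\mathcal O_{\mathcal Q^\vee}(1)\to0$ defines $\mathcal G$, whose fiber at $(H,p)$ is the space of linear forms on $H$ vanishing at $p$. Let $s_\sigma:\check{\mathbb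 P}^{2n-1}\to\mathbb P(\mathcal Q^\vee)$, $H\mapsto(H,\sigma(H))$, and $\mathcal G_\sigma=s_\sigma^*\mathcal G$. Set $\mathbb Y_m=\mathbb P(\operatorname{Sym}^m\mathcal G_\sigma)$: its points are pairs $(H,[q])$ with $H$ a hyperplane and $q\ne0$ a degree-$m$ form on $H$ that is a polynomial in the linear forms on $H$ vanishing at $\sigma(H)$ (the equation of a possibly nonreduced cone in $H$ whose vertex contains $\sigma(H)$). Over $\mathbb Y_m$, multiplication gives an inclusion $\mathcal O_{\operatorname{Sym}^m\mathcal G_\sigma}(-1)\otimes\operatorname{Sym}^{d-m}\mathcal Q\hookrightarrow\operatorname{Sym}^d\mathcal Q$, and $\widetilde{\mathcal F}^m_d\subset\operatorname{Sym}^d\mathcal F$ is the inverse image of this subbundle under $\operatorname{Sym}^d\mathcal F\to\operatorname{Sym}^d\mathcal Q$. Thus the fiber of $\widetilde{\mathcal F}^m_d$ over $(H,[q])$ consists of the degree-$d$ forms on $V$ whose restriction to $H$ is a multiple of $q$. The involutive cone incidence $\widetilde\rho_m:\mathbb P(\widetilde{\mathcal F}^m_d)\to\mathbb P(\operatorname{Sym}^dV^\vee)$ is the map induced by $\widetilde{\mathcal F}^m_d\subset\operatorname{Sym}^dV^\vee\otimes\mathcal O$, and $\mathbb B^m_d$ is its image. *)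

theory Defs
  imports "HOL-Analysis.Analysis" "HOL-Library.Function_Algebras"
begin

section \<open>Complex spaces with functions\<close>

text \<open>
  A complex variety is treated as a set of points with its Zariski topology and, for each open
  set \<open>U\<close>, the collection of functions that are regular on \<open>U\<close>.  Functions are total; membership
  in \<open>reg X U\<close> only depends on the values on \<open>U\<close>.
\<close>

record 'a funspace =
  topo :: "'a topology"
  reg :: "'a set \<Rightarrow> ('a \<Rightarrow> complex) set"

abbreviation points :: "'a funspace \<Rightarrow> 'a set" where
  "points X \<equiv> topspace (topo X)"

text \<open>
  Polynomial functions on a complex vector space with scalar multiplication \<open>s\<close>: the algebra
  generated by the constants and the linear functionals.
\<close>

inductive_set poly_funs :: "(complex \<Rightarrow> 'e \<Rightarrow> 'e::ab_group_add) \<Rightarrow> ('e \<Rightarrow> complex) set"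
  for s :: "complex \<Rightarrow> 'e \<Rightarrow> 'e" where
  const: "(\<lambda>_. c) \<in> poly_funs s"
| linear: "Vector_Spaces.linear s (*) \<phi> \<Longrightarrow> \<phi> \<in> poly_funs s"
| add: "p \<in> poly_funs s \<Longrightarrow> q \<in> poly_funs s \<Longrightarrow> (\<lambda>x. p x + q x) \<in> poly_funs s"
| mult: "p \<in> poly_funs s \<Longrightarrow> q \<in> poly_funs s \<Longrightarrow> (\<lambda>x. p x * q x) \<in> poly_funs s"

text \<open>
  The structure induced on a subset \<open>Z\<close> of a vector space: Zariski topology, and functions that are
  locally quotients of polynomials.  \<open>Z\<close> is meant to be a locally closed subset of a
  finite-dimensional subspace \<open>E\<close>; every linear functional on \<open>E\<close> extends to the ambient space, so
  the ambient space itself may be infinite-dimensional.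
\<close>

definition affine_funspace ::
  "(complex \<Rightarrow> 'e \<Rightarrow> 'e::ab_group_add) \<Rightarrow> 'e set \<Rightarrow> 'e funspace" where
  "affine_funspace s Z =
    \<lparr> topo = topology_generated_by {{x \<in> Z. p x \<noteq> 0} | p. p \<in> poly_funs s},
      reg = (\<lambda>U. {f. \<forall>x\<in>U. \<exists>p\<in>poly_funs s. \<exists>q\<in>poly_funs s.
                q x \<noteq> 0 \<and> (\<forall>y\<in>U. q y \<noteq> 0 \<longrightarrow> f y = p y / q y)}) \<rparr>"

definition sub_funspace :: "'a funspace \<Rightarrow> 'a set \<Rightarrow> 'a funspace" where
  "sub_funspace X A =
    \<lparr> topo = subtopology (topo X) A,
      reg = (\<lambda>U. {f. \<forall>x\<in>U. \<exists>W g. openin (topo X) W \<and> x \<in> W \<and> W \<inter> A \<subseteq> U \<and> g \<in> reg X W \<and>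
                (\<forall>y \<in> W \<inter> A. f y = g y)}) \<rparr>"

definition quotient_funspace :: "'a funspace \<Rightarrow> ('a \<Rightarrow> 'b) \<Rightarrow> 'b funspace" where
  "quotient_funspace X \<pi> =
    \<lparr> topo = topology (\<lambda>U. U \<subseteq> \<pi> ` points X \<and> openin (topo X) {x \<in> points X. \<pi> x \<in> U}),
      reg = (\<lambda>U. {f. f \<circ> \<pi> \<in> reg X {x \<in> points X. \<pi> x \<in> U}}) \<rparr>"

definition morphism :: "'a funspace \<Rightarrow> 'b funspace \<Rightarrow> ('a \<Rightarrow> 'b) \<Rightarrow> bool" where
  "morphism X Y f \<longleftrightarrow>
    continuous_map (topo X) (topo Y) f \<and>
    (\<forall>U g. openin (topo Y) U \<and> g \<in> reg Y U \<longrightarrow> g \<circ> f \<in> reg X {x \<in> points X. f x \<in> U})"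

definition isomorphism :: "'a funspace \<Rightarrow> 'b funspace \<Rightarrow> ('a \<Rightarrow> 'b) \<Rightarrow> bool" where
  "isomorphism X Y f \<longleftrightarrow>
    morphism X Y f \<and>
    (\<exists>g. morphism Y X g \<and> (\<forall>x \<in> points X. g (f x) = x) \<and> (\<forall>y \<in> points Y. f (g y) = y))"

definition dense_open :: "'a funspace \<Rightarrow> 'a set \<Rightarrow> bool" where
  "dense_open X U \<longleftrightarrow> openin (topo X) U \<and> topo X closure_of U = points X"

definition birational_morphism :: "'a funspace \<Rightarrow> 'b funspace \<Rightarrow> ('a \<Rightarrow> 'b) \<Rightarrow> bool" where
  "birational_morphism X Y f \<longleftrightarrow>
    morphism X Y f \<and>
    (\<exists>U W. dense_open X U \<and> dense_open Y W \<and>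
           isomorphism (sub_funspace X U) (sub_funspace Y W) f)"

section \<open>Symplectic spaces and forms\<close>

locale symplectic_space = vector_space smul
  for smul :: "complex \<Rightarrow> 'v \<Rightarrow> 'v::ab_group_add" +
  fixes \<omega> :: "'v \<Rightarrow> 'v \<Rightarrow> complex"
  assumes linear_left: "Vector_Spaces.linear smul (*) (\<lambda>u. \<omega> u v)"
    and linear_right: "Vector_Spaces.linear smul (*) (\<omega> v)"
    and alternating: "\<omega> v v = 0"
    and nondegenerate: "(\<forall>u. \<omega> v u = 0) \<Longrightarrow> v = 0"

definition fscale :: "complex \<Rightarrow> ('v \<Rightarrow> complex) \<Rightarrow> 'v \<Rightarrow> complex" where
  "fscale c f = (\<lambda>x. c * f x)"

text \<open>One-dimensional subspaces of a subspace \<open>W\<close>.\<close>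

definition lines :: "(complex \<Rightarrow> 'e \<Rightarrow> 'e::ab_group_add) \<Rightarrow> 'e set \<Rightarrow> 'e set set" where
  "lines s W = {module.span s {w} | w. w \<in> W \<and> w \<noteq> 0}"

definition projective_funspace ::
  "(complex \<Rightarrow> 'e \<Rightarrow> 'e::ab_group_add) \<Rightarrow> 'e set \<Rightarrow> 'e set funspace" where
  "projective_funspace s W = quotient_funspace (affine_funspace s (W - {0})) (\<lambda>w. module.span s {w})"

definition dual_space :: "(complex \<Rightarrow> 'v \<Rightarrow> 'v::ab_group_add) \<Rightarrow> ('v \<Rightarrow> complex) set" where
  "dual_space smul = {f. Vector_Spaces.linear smul (*) f}"

text \<open>
  Forms on a subspace \<open>A\<close> are functions on the whole space that vanish outside \<open>A\<close>.  Symmetric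
  powers are realised as spaces of homogeneous polynomial functions, which is faithful
  because the base field is infinite: for a space \<open>W\<close> of linear forms on \<open>A\<close>, the space
  \<open>sym_forms A k W\<close> is spanned by the products of \<open>k\<close> elements of \<open>W\<close>.
\<close>

definition restrict_form :: "'v set \<Rightarrow> ('v \<Rightarrow> complex) \<Rightarrow> 'v \<Rightarrow> complex" where
  "restrict_form A f = (\<lambda>x. if x \<in> A then f x else 0)"

definition sym_forms :: "'v set \<Rightarrow> nat \<Rightarrow> ('v \<Rightarrow> complex) set \<Rightarrow> ('v \<Rightarrow> complex) set" where
  "sym_forms A k W =
    module.span fscale {restrict_form A (\<lambda>x. \<Prod>i<k. w i x) | w. \<forall>i<k. w i \<in> W}"

text \<open>Hyperplanes of the projective space, as linear hyperplanes.\<close>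

definition hyperplanes :: "(complex \<Rightarrow> 'v \<Rightarrow> 'v::ab_group_add) \<Rightarrow> 'v set set" where
  "hyperplanes smul = {{u. l u = 0} | l. l \<in> dual_space smul \<and> l \<noteq> 0}"

text \<open>The line in the vector space spanned by the vectors \<open>v\<^sub>l\<close>, for the equations \<open>l\<close> of \<open>H\<close>.\<close>

definition polar_point ::
  "(complex \<Rightarrow> 'v \<Rightarrow> 'v::ab_group_add) \<Rightarrow> ('v \<Rightarrow> 'v \<Rightarrow> complex) \<Rightarrow> 'v set \<Rightarrow> 'v set" where
  "polar_point smul \<omega> H =
    module.span smul {v. \<exists>l\<in>dual_space smul. H = {u. l u = 0} \<and> (\<forall>u. l u = \<omega> v u)}"

text \<open>Fibres at \<open>H\<close> of the bundles of linear forms on \<open>H\<close>, and of those vanishing at \<open>\<sigma>(H)\<close>.\<close>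

definition Q_fiber :: "(complex \<Rightarrow> 'v \<Rightarrow> 'v::ab_group_add) \<Rightarrow> 'v set \<Rightarrow> ('v \<Rightarrow> complex) set" where
  "Q_fiber smul H = restrict_form H ` dual_space smul"

definition G\<sigma>_fiber ::
  "(complex \<Rightarrow> 'v \<Rightarrow> 'v::ab_group_add) \<Rightarrow> ('v \<Rightarrow> 'v \<Rightarrow> complex) \<Rightarrow> 'v set \<Rightarrow> ('v \<Rightarrow> complex) set" where
  "G\<sigma>_fiber smul \<omega> H = {g \<in> Q_fiber smul H. \<forall>v \<in> polar_point smul \<omega> H. g v = 0}"

definition Y_points ::
  "(complex \<Rightarrow> 'v \<Rightarrow> 'v::ab_group_add) \<Rightarrow> ('v \<Rightarrow> 'v \<Rightarrow> complex) \<Rightarrow> nat \<Rightarrow>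
   ('v set \<times> ('v \<Rightarrow> complex) set) set" where
  "Y_points smul \<omega> m =
    (SIGMA H : hyperplanes smul. lines fscale (sym_forms H m (G\<sigma>_fiber smul \<omega> H)))"

section \<open>The involutive cone incidence\<close>

text \<open>
  \<open>F_fiber\<close> is the inverse image of \<open>L \<otimes> Sym\<^bsup>d-m\<^esup> Q\<close> (a subspace of \<open>Sym\<^sup>d Q\<close>, via
  multiplication) under restriction to \<open>H\<close>.  Since \<open>L\<close> is a line, its products with forms of
  degree \<open>d - m\<close> already form a subspace.  The natural number subtraction is only meaningful
  for \<open>m \<le> d\<close>.
\<close>

definition F_fiber ::
  "(complex \<Rightarrow> 'v \<Rightarrow> 'v::ab_group_add) \<Rightarrow> nat \<Rightarrow> nat \<Rightarrow> 'v set \<times> ('v \<Rightarrow> complex) set \<Rightarrow>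
   ('v \<Rightarrow> complex) set" where
  "F_fiber smul m d = (\<lambda>(H, L).
    {F \<in> sym_forms UNIV d (dual_space smul).
      \<exists>q \<in> L. \<exists>g \<in> sym_forms H (d - m) (Q_fiber smul H). restrict_form H F = (\<lambda>x. q x * g x)})"

type_synonym 'v incidence_point =
  "('v set \<times> ('v \<Rightarrow> complex) set) \<times> ('v \<Rightarrow> complex) set"

definition incidence_points ::
  "(complex \<Rightarrow> 'v \<Rightarrow> 'v::ab_group_add) \<Rightarrow> ('v \<Rightarrow> 'v \<Rightarrow> complex) \<Rightarrow> nat \<Rightarrow> nat \<Rightarrow>
   'v incidence_point set" where
  "incidence_points smul \<omega> m d =
    (SIGMA y : Y_points smul \<omega> m. lines fscale (F_fiber smul m d y))"

text \<open>
  The iterated projective bundle gets its variety structure from homogeneous coordinates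
  \<open>(l, q, F)\<close>: an equation of the hyperplane, a form on the whole space restricting to the cone
  equation, and a form of degree \<open>d\<close>.  The admissible triples form a locally closed subset of
  \<open>V\<^sup>\<or> \<times> Sym\<^sup>m V\<^sup>\<or> \<times> Sym\<^sup>d V\<^sup>\<or>\<close>, and the map from it to the bundle has regular sections locally on
  the bundle, so that the variety structure of the bundle is the quotient structure.
\<close>

definition tscale ::
  "complex \<Rightarrow> ('v \<Rightarrow> complex) \<times> ('v \<Rightarrow> complex) \<times> ('v \<Rightarrow> complex) \<Rightarrow>
   ('v \<Rightarrow> complex) \<times> ('v \<Rightarrow> complex) \<times> ('v \<Rightarrow> complex)" where
  "tscale c = (\<lambda>(l, q, F). (fscale c l, fscale c q, fscale c F))"

definition incidence_of ::
  "('v \<Rightarrow> complex) \<times> ('v \<Rightarrow> complex) \<times> ('v \<Rightarrow> complex) \<Rightarrow> 'v incidence_point" where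
  "incidence_of = (\<lambda>(l, q, F).
    (({u. l u = 0}, module.span fscale {restrict_form {u. l u = 0} q}), module.span fscale {F}))"

definition incidence_coords ::
  "(complex \<Rightarrow> 'v \<Rightarrow> 'v::ab_group_add) \<Rightarrow> ('v \<Rightarrow> 'v \<Rightarrow> complex) \<Rightarrow> nat \<Rightarrow> nat \<Rightarrow>
   (('v \<Rightarrow> complex) \<times> ('v \<Rightarrow> complex) \<times> ('v \<Rightarrow> complex)) set" where
  "incidence_coords smul \<omega> m d =
    {z \<in> dual_space smul \<times> sym_forms UNIV m (dual_space smul) \<times> sym_forms UNIV d (dual_space smul).
      incidence_of z \<in> incidence_points smul \<omega> m d}"

definition incidence_variety ::
  "(complex \<Rightarrow> 'v \<Rightarrow> 'v::ab_group_add) \<Rightarrow> ('v \<Rightarrow> 'v \<Rightarrow> complex) \<Rightarrow> nat \<Rightarrow> nat \<Rightarrow>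
   'v incidence_point funspace" where
  "incidence_variety smul \<omega> m d =
    quotient_funspace (affine_funspace tscale (incidence_coords smul \<omega> m d)) incidence_of"

definition incidence_map :: "'v incidence_point \<Rightarrow> ('v \<Rightarrow> complex) set" where
  "incidence_map = snd"

definition involutive_cone_locus ::
  "(complex \<Rightarrow> 'v \<Rightarrow> 'v::ab_group_add) \<Rightarrow> ('v \<Rightarrow> 'v \<Rightarrow> complex) \<Rightarrow> nat \<Rightarrow> nat \<Rightarrow>
   ('v \<Rightarrow> complex) set funspace" where
  "involutive_cone_locus smul \<omega> m d =
    sub_funspace (projective_funspace fscale (sym_forms UNIV d (dual_space smul)))
      (incidence_map ` incidence_points smul \<omega> m d)"

section \<open>Well-formedness of the constructions\<close>

lemma vector_space_fscale: "vector_space (fscale :: complex \<Rightarrow> ('v \<Rightarrow> complex) \<Rightarrow> _)"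
  by unfold_locales (auto simp: fscale_def fun_eq_iff algebra_simps)

lemma vector_space_tscale: "vector_space (tscale :: complex \<Rightarrow> ('v \<Rightarrow> complex) \<times> _ \<times> _ \<Rightarrow> _)"
  by unfold_locales
    (auto simp: tscale_def fscale_def fun_eq_iff prod_eq_iff case_prod_unfold algebra_simps)

lemma points_affine: "points (affine_funspace s Z) = Z"
proof -
  have "\<exists>p \<in> poly_funs s. Z = {x \<in> Z. p x \<noteq> 0}"
    by (rule bexI[of _ "\<lambda>_. 1"]) (auto intro: poly_funs.const)
  then show ?thesis
    unfolding affine_funspace_def by (auto simp: topology_generated_by_topspace)
qed

lemma istopology_quotient:
  "istopology (\<lambda>U. U \<subseteq> \<pi> ` points X \<and> openin (topo X) {x \<in> points X. \<pi> x \<in> U})"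
  unfolding istopology_def
proof (intro conjI allI impI)
  fix S T
  assume *: "S \<subseteq> \<pi> ` points X \<and> openin (topo X) {x \<in> points X. \<pi> x \<in> S}"
    "T \<subseteq> \<pi> ` points X \<and> openin (topo X) {x \<in> points X. \<pi> x \<in> T}"
  show "S \<inter> T \<subseteq> \<pi> ` points X" using * by blast
  have "{x \<in> points X. \<pi> x \<in> S \<inter> T} = {x \<in> points X. \<pi> x \<in> S} \<inter> {x \<in> points X. \<pi> x \<in> T}" by blast
  then show "openin (topo X) {x \<in> points X. \<pi> x \<in> S \<inter> T}" using * by auto
next
  fix K
  assume *: "\<forall>S\<in>K. S \<subseteq> \<pi> ` points X \<and> openin (topo X) {x \<in> points X. \<pi> x \<in> S}"
  show "\<Union>K \<subseteq> \<pi> ` points X" using * by blast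
  have "{x \<in> points X. \<pi> x \<in> \<Union>K} = (\<Union>S\<in>K. {x \<in> points X. \<pi> x \<in> S})" by blast
  then show "openin (topo X) {x \<in> points X. \<pi> x \<in> \<Union>K}" using * by auto
qed

lemma openin_quotient:
  "openin (topo (quotient_funspace X \<pi>)) U \<longleftrightarrow>
    U \<subseteq> \<pi> ` points X \<and> openin (topo X) {x \<in> points X. \<pi> x \<in> U}"
  unfolding quotient_funspace_def by (simp add: topology_inverse'[OF istopology_quotient])

lemma points_quotient: "points (quotient_funspace X \<pi>) = \<pi> ` points X"
proof
  show "points (quotient_funspace X \<pi>) \<subseteq> \<pi> ` points X"
    using openin_topspace[of "topo (quotient_funspace X \<pi>)"] by (simp only: openin_quotient)
  have "{x \<in> points X. \<pi> x \<in> \<pi> ` points X} = points X" by blast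
  then have "openin (topo (quotient_funspace X \<pi>)) (\<pi> ` points X)"
    by (simp add: openin_quotient)
  then show "\<pi> ` points X \<subseteq> points (quotient_funspace X \<pi>)" by (rule openin_subset)
qed

lemma restrict_prod_lift:
  assumes "\<forall>i<k. w i \<in> Q_fiber smul H"
  shows "\<exists>w'. (\<forall>i<k. w' i \<in> dual_space smul) \<and>
    restrict_form H (\<lambda>x. \<Prod>i<k. w i x) = restrict_form H (\<lambda>x. \<Prod>i<k. w' i x)"
proof -
  have "\<forall>i. \<exists>f. i < k \<longrightarrow> f \<in> dual_space smul \<and> w i = restrict_form H f"
    using assms unfolding Q_fiber_def by blast
  then obtain w' where w': "\<And>i. i < k \<Longrightarrow> w' i \<in> dual_space smul \<and> w i = restrict_form H (w' i)"
    by metis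
  have "restrict_form H (\<lambda>x. \<Prod>i<k. w i x) = restrict_form H (\<lambda>x. \<Prod>i<k. w' i x)"
    unfolding restrict_form_def using w' by (auto simp: fun_eq_iff restrict_form_def intro!: prod.cong)
  then show ?thesis using w' by blast
qed

lemma sym_forms_lift:
  assumes "W \<subseteq> Q_fiber smul H" "q \<in> sym_forms H k W"
  shows "\<exists>f \<in> sym_forms UNIV k (dual_space smul). q = restrict_form H f"
proof -
  interpret vector_space "fscale :: complex \<Rightarrow> ('a \<Rightarrow> complex) \<Rightarrow> _" by (rule vector_space_fscale)
  let ?S = "sym_forms UNIV k (dual_space smul)"
  have sub: "subspace ?S" unfolding sym_forms_def by (rule subspace_span)
  have "subspace (restrict_form H ` ?S)"
  proof (rule subspaceI)
    have "(0::'a \<Rightarrow> complex) = restrict_form H 0" by (auto simp: restrict_form_def fun_eq_iff)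
    then show "0 \<in> restrict_form H ` ?S" using subspace_0[OF sub] by blast
  next
    fix x y assume "x \<in> restrict_form H ` ?S" "y \<in> restrict_form H ` ?S"
    then obtain a b where ab: "a \<in> ?S" "b \<in> ?S" "x = restrict_form H a" "y = restrict_form H b" by blast
    then have "x + y = restrict_form H (a + b)" by (auto simp: restrict_form_def fun_eq_iff)
    then show "x + y \<in> restrict_form H ` ?S" using subspace_add[OF sub ab(1,2)] by blast
  next
    fix c x assume "x \<in> restrict_form H ` ?S"
    then obtain a where a: "a \<in> ?S" "x = restrict_form H a" by blast
    then have "fscale c x = restrict_form H (fscale c a)"
      by (auto simp: restrict_form_def fscale_def fun_eq_iff)
    then show "fscale c x \<in> restrict_form H ` ?S" using subspace_scale[OF sub a(1)] by blast
  qed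
  moreover have "{restrict_form H (\<lambda>x. \<Prod>i<k. w i x) | w. \<forall>i<k. w i \<in> W} \<subseteq> restrict_form H ` ?S"
  proof
    fix p assume "p \<in> {restrict_form H (\<lambda>x. \<Prod>i<k. w i x) | w. \<forall>i<k. w i \<in> W}"
    then obtain w where w: "p = restrict_form H (\<lambda>x. \<Prod>i<k. w i x)" "\<forall>i<k. w i \<in> W" by blast
    obtain w' where w': "\<forall>i<k. w' i \<in> dual_space smul" "p = restrict_form H (\<lambda>x. \<Prod>i<k. w' i x)"
      using restrict_prod_lift[of k w smul H] w assms(1) by (metis subsetD)
    have "restrict_form UNIV (\<lambda>x. \<Prod>i<k. w' i x) \<in> ?S"
      unfolding sym_forms_def by (rule span_base) (use w'(1) in blast)
    then show "p \<in> restrict_form H ` ?S" using w'(2) by (simp add: restrict_form_def)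
  qed
  ultimately show ?thesis
    using span_minimal assms(2) unfolding sym_forms_def by blast
qed

lemma points_incidence_variety:
  "points (incidence_variety smul \<omega> m d) = incidence_points smul \<omega> m d"
proof -
  have "x \<in> incidence_of ` incidence_coords smul \<omega> m d"
    if x: "x \<in> incidence_points smul \<omega> m d" for x
  proof -
    obtain l q F where l: "l \<in> dual_space smul"
      and q: "q \<in> sym_forms {u. l u = 0} m (G\<sigma>_fiber smul \<omega> {u. l u = 0})"
      and F: "F \<in> sym_forms UNIV d (dual_space smul)"
      and eq: "x = (({u. l u = 0}, module.span fscale {q}), module.span fscale {F})"
      using x by (auto simp: incidence_points_def Y_points_def hyperplanes_def lines_def F_fiber_def)
    have "G\<sigma>_fiber smul \<omega> {u. l u = 0} \<subseteq> Q_fiber smul {u. l u = 0}"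
      by (auto simp: G\<sigma>_fiber_def)
    from sym_forms_lift[OF this q] obtain f where
      f: "f \<in> sym_forms UNIV m (dual_space smul)" "q = restrict_form {u. l u = 0} f" by blast
    have "x = incidence_of (l, f, F)" using eq f(2) by (simp add: incidence_of_def)
    then show ?thesis using l f(1) F x by (auto simp: incidence_coords_def)
  qed
  then show ?thesis
    unfolding incidence_variety_def points_quotient points_affine
    by (auto simp: incidence_coords_def)
qed

lemma points_involutive_cone_locus:
  "points (involutive_cone_locus smul \<omega> m d) = incidence_map ` incidence_points smul \<omega> m d"
proof -
  have "points (projective_funspace fscale W) = lines fscale W" for W :: "('a \<Rightarrow> complex) set"
    unfolding projective_funspace_def points_quotient points_affine lines_def by blast
  moreover have "incidence_map ` incidence_points smul \<omega> m d
      \<subseteq> lines fscale (sym_forms UNIV d (dual_space smul))"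
    by (auto simp: incidence_map_def incidence_points_def lines_def F_fiber_def)
  ultimately show ?thesis
    unfolding involutive_cone_locus_def sub_funspace_def by auto
qed

end

theory Submission
  imports Defs "Jordan_Normal_Form.Determinant"
begin

text \<open>
  If \<open>F\<close> restricts to \<open>q g\<close> on the hyperplane \<open>H\<close> polar to \<open>v\<close>, with \<open>q\<close> a cone form of degree \<open>m\<close>, then
  the coefficient of \<open>s\<^sup>d\<^sup>-\<^sup>m\<close> in \<open>F (x + s v)\<close> is \<open>g v\<close> times \<open>q\<close>.  Hence, where \<open>g v \<noteq> 0\<close>, the cone is
  determined polynomially by \<open>F\<close> and \<open>v\<close>, and it remains to recover \<open>v\<close> from a generic \<open>F\<close>.

  The pairs \<open>(v, F)\<close> satisfy polynomial equations: \<open>dF\<close> at \<open>v\<close> vanishes on \<open>H\<close>, and the coefficients of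
  \<open>s\<^sup>0\<close> and \<open>s\<^sup>1\<close> in \<open>F (s v + e + u f)\<close>, for \<open>e, f \<in> H\<close>, are polynomials in \<open>u\<close> with a common factor of
  degree \<open>m \<ge> 2\<close>, which makes a determinant vanish.  For a suitable form \<open>F\<^sub>0\<close> these equations generate
  all monomials of some degree \<open>k\<close> in \<open>v\<close> except \<open>x\<^sub>1\<^sup>k\<close>.  By Cramer's rule the ratios of
  the monomials of degree \<open>k\<close>, and with them the point \<open>v\<close>, are rational functions of \<open>F\<close> near \<open>F\<^sub>0\<close>.
  Since the bundle is irreducible, the open conditions met along the way hold generically.
\<close>

section \<open>Function spaces\<close>

text \<open>Birationality asks for an inverse by regular functions on open sets, so it is not enough
  that a generic \<open>F\<close> determines its polar point: the point has to be a simple solution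
  of its equations. This is why an ideal at one form is studied instead of a solution set.

  Neither family of equations suffices alone. Tangency has a simple solution at
  \<open>e\<^sub>1\<close>, but it also holds at every singular point of the surface, such as
  \<open>f\<^sub>2\<close>. The determinants exclude that point, but they yield only high powers of
  the coordinates.

  The case \<open>m = d = 2\<close> is a genuine exception: there \<open>F\<close> is a quadratic
  form with symmetric matrix \<open>A\<close>, and tangency says that \<open>v\<close> is an
  eigenvector of \<open>J^-1 A\<close>, with \<open>J\<close> the matrix of \<omega>. A general
  \<open>A\<close> has four such points, and each carries a cone. In the argument the exclusion
  appears as \<open>d \<ge> 3\<close>, which makes the terms left over in the tangency equations at
  \<open>e\<^sub>1\<close> of order at least two.\<close>

definition poly_of_coeffs :: "nat \<Rightarrow> (nat \<Rightarrow> complex) \<Rightarrow> complex poly" where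
  "poly_of_coeffs n a = (\<Sum>j\<le>n. monom (a j) j)"

lemma poly_poly_of_coeffs: "poly (poly_of_coeffs n a) c = (\<Sum>j\<le>n. c ^ j * a j)"
  by (simp add: poly_of_coeffs_def poly_sum poly_monom mult.commute)

lemma coeff_poly_of_coeffs: "coeff (poly_of_coeffs n a) j = (if j \<le> n then a j else 0)"
  by (simp add: poly_of_coeffs_def coeff_sum)

lemma degree_poly_of_coeffs: "degree (poly_of_coeffs n a) \<le> n"
  by (rule degree_le) (simp add: coeff_poly_of_coeffs)

lemma poly_eq_0_if_nonzero:
  assumes "\<And>c. c \<noteq> 0 \<Longrightarrow> poly p c = (0::complex)" shows "p = 0"
proof (rule ccontr)
  assume "p \<noteq> 0"
  then have "finite {c. poly p c = 0}" by (rule poly_roots_finite)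
  moreover have "UNIV - {0} \<subseteq> {c. poly p c = 0}" using assms by auto
  ultimately have "finite (UNIV - {0::complex})" by (rule rev_finite_subset)
  then show False using infinite_UNIV_char_0[where 'a=complex] by simp
qed

text \<open>Only nonzero scalars act on a punctured cone, so homogeneous components have to be
  separated without the value at \<open>c = 0\<close>; infinitely many roots still force the
  polynomial to vanish.\<close>

lemma sum_powers_eq_0:
  assumes "\<And>c. c \<noteq> 0 \<Longrightarrow> (\<Sum>j\<le>n. c ^ j * a j) = (0::complex)" and "j \<le> n" shows "a j = 0"
proof -
  have "poly_of_coeffs n a = 0" by (rule poly_eq_0_if_nonzero) (simp add: poly_poly_of_coeffs assms)
  then have "coeff (poly_of_coeffs n a) j = 0" by simp
  then show ?thesis using assms(2) by (simp add: coeff_poly_of_coeffs)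
qed

lemma sum_powers_eqD:
  assumes "\<And>c. c \<noteq> 0 \<Longrightarrow> (\<Sum>j\<le>n. c ^ j * a j) = (\<Sum>j\<le>n. c ^ j * b j :: complex)" and "j \<le> n"
  shows "a j = b j"
  using sum_powers_eq_0[where n=n and a="\<lambda>j. a j - b j" and j=j] assms
  by (simp add: right_diff_distrib sum_subtractf)

section \<open>Polynomial functions, Zariski topologies and regular functions\<close>

lemma linear_functional_scale:
  "Vector_Spaces.linear s (*) \<phi> \<Longrightarrow> \<phi> (s c x) = c * (\<phi> x :: complex)"
proof -
  assume "Vector_Spaces.linear s (*) \<phi>"
  then interpret Vector_Spaces.linear s "(*)" \<phi> .
  show ?thesis by (rule scale)
qed

lemma linear_functional_add:
  "Vector_Spaces.linear s (*) \<phi> \<Longrightarrow> \<phi> (x + y) = \<phi> x + (\<phi> y :: complex)"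
proof -
  assume "Vector_Spaces.linear s (*) \<phi>"
  then interpret Vector_Spaces.linear s "(*)" \<phi> .
  show ?thesis by (rule add)
qed

lemma poly_funs_sum:
  assumes "finite I" "\<And>i. i \<in> I \<Longrightarrow> p i \<in> poly_funs s"
  shows "(\<lambda>x. \<Sum>i\<in>I. p i x) \<in> poly_funs s"
  using assms
proof (induction rule: finite_induct)
  case empty
  show ?case using poly_funs.const[of 0 s] by simp
next
  case (insert i I)
  have "(\<lambda>x. p i x + (\<Sum>i\<in>I. p i x)) \<in> poly_funs s"
    by (rule poly_funs.add) (use insert in auto)
  then show ?case using insert by simp
qed

text \<open>Products of polynomials make the sets \<open>p x \<noteq> 0\<close> closed under
  intersection, so they are a basis and not merely a subbasis of the generated topology.\<close>

lemma openin_affine: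
  "openin (topo (affine_funspace s Z)) U \<longleftrightarrow>
    U \<subseteq> Z \<and> (\<forall>x\<in>U. \<exists>p\<in>poly_funs s. p x \<noteq> 0 \<and> (\<forall>y\<in>Z. p y \<noteq> 0 \<longrightarrow> y \<in> U))"
proof
  assume "openin (topo (affine_funspace s Z)) U"
  then have "generate_topology_on {{x \<in> Z. p x \<noteq> 0} | p. p \<in> poly_funs s} U"
    by (simp add: affine_funspace_def openin_topology_generated_by_iff)
  then show "U \<subseteq> Z \<and> (\<forall>x\<in>U. \<exists>p\<in>poly_funs s. p x \<noteq> 0 \<and> (\<forall>y\<in>Z. p y \<noteq> 0 \<longrightarrow> y \<in> U))"
  proof (induction rule: generate_topology_on.induct)
    case Empty then show ?case by simp
  next
    case (Int a b)
    show ?case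
    proof (intro conjI ballI)
      show "a \<inter> b \<subseteq> Z" using Int by blast
      fix x assume x: "x \<in> a \<inter> b"
      obtain p where "p \<in> poly_funs s" "p x \<noteq> 0" "\<forall>y\<in>Z. p y \<noteq> 0 \<longrightarrow> y \<in> a" using Int x by blast
      moreover obtain q where "q \<in> poly_funs s" "q x \<noteq> 0" "\<forall>y\<in>Z. q y \<noteq> 0 \<longrightarrow> y \<in> b" using Int x by blast
      ultimately show "\<exists>p\<in>poly_funs s. p x \<noteq> 0 \<and> (\<forall>y\<in>Z. p y \<noteq> 0 \<longrightarrow> y \<in> a \<inter> b)"
        by (intro bexI[of _ "\<lambda>x. p x * q x"]) (auto simp: poly_funs.mult)
    qed
  next
    case (UN K)
    show ?case
    proof (intro conjI ballI)
      show "\<Union> K \<subseteq> Z" using UN by blast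
      fix x assume "x \<in> \<Union> K"
      then obtain k where k: "k \<in> K" "x \<in> k" by blast
      then obtain p where "p \<in> poly_funs s" "p x \<noteq> 0" "\<forall>y\<in>Z. p y \<noteq> 0 \<longrightarrow> y \<in> k" using UN.IH[OF k(1)] by blast
      then show "\<exists>p\<in>poly_funs s. p x \<noteq> 0 \<and> (\<forall>y\<in>Z. p y \<noteq> 0 \<longrightarrow> y \<in> \<Union> K)" using k by blast
    qed
  next
    case (Basis u) then show ?case by blast
  qed
next
  assume *: "U \<subseteq> Z \<and> (\<forall>x\<in>U. \<exists>p\<in>poly_funs s. p x \<noteq> 0 \<and> (\<forall>y\<in>Z. p y \<noteq> 0 \<longrightarrow> y \<in> U))"
  show "openin (topo (affine_funspace s Z)) U"
  proof (subst openin_subopen, intro ballI)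
    fix x assume "x \<in> U"
    then obtain p where p: "p \<in> poly_funs s" "p x \<noteq> 0" "\<forall>y\<in>Z. p y \<noteq> 0 \<longrightarrow> y \<in> U" using * by blast
    have "openin (topo (affine_funspace s Z)) {x \<in> Z. p x \<noteq> 0}"
      unfolding affine_funspace_def using p(1) by (auto intro!: topology_generated_by_Basis)
    then show "\<exists>T. openin (topo (affine_funspace s Z)) T \<and> x \<in> T \<and> T \<subseteq> U"
      using p * \<open>x \<in> U\<close> by (intro exI[of _ "{x \<in> Z. p x \<noteq> 0}"]) auto
  qed
qed

lemma reg_affine:
  "f \<in> reg (affine_funspace s Z) U \<longleftrightarrow>
    (\<forall>x\<in>U. \<exists>p\<in>poly_funs s. \<exists>q\<in>poly_funs s. q x \<noteq> 0 \<and> (\<forall>y\<in>U. q y \<noteq> 0 \<longrightarrow> f y = p y / q y))"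
  by (simp add: affine_funspace_def)

lemma reg_quotient:
  "f \<in> reg (quotient_funspace X \<pi>) U \<longleftrightarrow> f \<circ> \<pi> \<in> reg X {x \<in> points X. \<pi> x \<in> U}"
  by (simp add: quotient_funspace_def)

lemma reg_sub:
  "f \<in> reg (sub_funspace X A) U \<longleftrightarrow>
    (\<forall>x\<in>U. \<exists>W g. openin (topo X) W \<and> x \<in> W \<and> W \<inter> A \<subseteq> U \<and> g \<in> reg X W \<and>
                (\<forall>y \<in> W \<inter> A. f y = g y))"
  by (simp add: sub_funspace_def)

lemma topo_sub: "topo (sub_funspace X A) = subtopology (topo X) A"
  by (simp add: sub_funspace_def)

text \<open>Restriction to open subsets and locality, two properties that the record itself does not
  impose. They allow regularity to be checked after shrinking neighbourhoods, and they pass from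
  affine pieces to quotients and subspaces.\<close>

definition sheafy :: "'a funspace \<Rightarrow> bool" where
  "sheafy X \<longleftrightarrow>
    (\<forall>U U' f. f \<in> reg X U \<longrightarrow> U' \<subseteq> U \<longrightarrow> f \<in> reg X U' \<or> \<not> openin (topo X) U') \<and>
    (\<forall>U f. openin (topo X) U \<longrightarrow>
      (\<forall>x\<in>U. \<exists>W g. openin (topo X) W \<and> x \<in> W \<and> g \<in> reg X W \<and> (\<forall>y\<in>W \<inter> U. f y = g y)) \<longrightarrow>
      f \<in> reg X U)"

lemma sheafy_restrict:
  "sheafy X \<Longrightarrow> f \<in> reg X U \<Longrightarrow> U' \<subseteq> U \<Longrightarrow> openin (topo X) U' \<Longrightarrow> f \<in> reg X U'"
  unfolding sheafy_def by blast

lemma sheafy_glue: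
  assumes "sheafy X" "openin (topo X) U"
    and "\<And>x. x \<in> U \<Longrightarrow> \<exists>W g. openin (topo X) W \<and> x \<in> W \<and> g \<in> reg X W \<and> (\<forall>y\<in>W \<inter> U. f y = g y)"
  shows "f \<in> reg X U"
  using assms unfolding sheafy_def by blast

lemma sheafy_affine: "sheafy (affine_funspace s Z)"
  unfolding sheafy_def
proof (intro conjI allI impI)
  fix U U' f assume "f \<in> reg (affine_funspace s Z) U" "U' \<subseteq> U"
  then show "f \<in> reg (affine_funspace s Z) U' \<or> \<not> openin (topo (affine_funspace s Z)) U'"
    unfolding reg_affine by blast
next
  fix U f
  assume U: "openin (topo (affine_funspace s Z)) U" and
    loc: "\<forall>x\<in>U. \<exists>W g. openin (topo (affine_funspace s Z)) W \<and> x \<in> W \<and>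
      g \<in> reg (affine_funspace s Z) W \<and> (\<forall>y\<in>W \<inter> U. f y = g y)"
  show "f \<in> reg (affine_funspace s Z) U"
    unfolding reg_affine
  proof
    fix x assume x: "x \<in> U"
    then obtain W g where W: "openin (topo (affine_funspace s Z)) W" "x \<in> W"
      "g \<in> reg (affine_funspace s Z) W" "\<forall>y\<in>W \<inter> U. f y = g y" using loc by blast
    obtain p q where pq: "p \<in> poly_funs s" "q \<in> poly_funs s" "q x \<noteq> 0"
      "\<And>y. y \<in> W \<Longrightarrow> q y \<noteq> 0 \<Longrightarrow> g y = p y / q y"
      using W(2,3) unfolding reg_affine by blast
    obtain r where r: "r \<in> poly_funs s" "r x \<noteq> 0" "\<And>y. y \<in> Z \<Longrightarrow> r y \<noteq> 0 \<Longrightarrow> y \<in> W"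
      using W(1,2) unfolding openin_affine by blast
    have UZ: "U \<subseteq> Z" using U unfolding openin_affine by blast
    show "\<exists>p\<in>poly_funs s. \<exists>q\<in>poly_funs s. q x \<noteq> 0 \<and> (\<forall>y\<in>U. q y \<noteq> 0 \<longrightarrow> f y = p y / q y)"
    proof (rule bexI[of _ "\<lambda>y. p y * r y"], rule bexI[of _ "\<lambda>y. q y * r y"], intro conjI ballI impI)
      show "(\<lambda>y. p y * r y) \<in> poly_funs s" "(\<lambda>y. q y * r y) \<in> poly_funs s"
        using pq r by (simp_all add: poly_funs.mult)
      show "q x * r x \<noteq> 0" using pq r by simp
      fix y assume y: "y \<in> U" "q y * r y \<noteq> 0"
      then have "y \<in> W" using r UZ by auto
      then show "f y = p y * r y / (q y * r y)" using W(4) pq(4)[of y] y by simp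
    qed
  qed
qed

lemma sheafy_quotient:
  assumes X: "sheafy X" shows "sheafy (quotient_funspace X \<pi>)"
  unfolding sheafy_def
proof (intro conjI allI impI)
  fix U U' f assume f: "f \<in> reg (quotient_funspace X \<pi>) U" "U' \<subseteq> U"
  have "f \<in> reg (quotient_funspace X \<pi>) U'" if "openin (topo (quotient_funspace X \<pi>)) U'"
    using that f unfolding reg_quotient openin_quotient
    by (auto elim!: sheafy_restrict[OF X])
  then show "f \<in> reg (quotient_funspace X \<pi>) U' \<or> \<not> openin (topo (quotient_funspace X \<pi>)) U'"
    by blast
next
  fix U f
  assume U: "openin (topo (quotient_funspace X \<pi>)) U" and
    loc: "\<forall>x\<in>U. \<exists>W g. openin (topo (quotient_funspace X \<pi>)) W \<and> x \<in> W \<and>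
      g \<in> reg (quotient_funspace X \<pi>) W \<and> (\<forall>y\<in>W \<inter> U. f y = g y)"
  show "f \<in> reg (quotient_funspace X \<pi>) U"
    unfolding reg_quotient
  proof (rule sheafy_glue[OF X])
    show "openin (topo X) {x \<in> points X. \<pi> x \<in> U}" using U by (simp add: openin_quotient)
    fix x assume x: "x \<in> {x \<in> points X. \<pi> x \<in> U}"
    then obtain W g where W: "openin (topo (quotient_funspace X \<pi>)) W" "\<pi> x \<in> W"
      "g \<in> reg (quotient_funspace X \<pi>) W" "\<forall>y\<in>W \<inter> U. f y = g y" using loc by blast
    then show "\<exists>W g. openin (topo X) W \<and> x \<in> W \<and> g \<in> reg X W \<and>
      (\<forall>y\<in>W \<inter> {x \<in> points X. \<pi> x \<in> U}. (f \<circ> \<pi>) y = g y)"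
      using x by (intro exI[of _ "{x \<in> points X. \<pi> x \<in> W}"] exI[of _ "g \<circ> \<pi>"])
        (auto simp: openin_quotient reg_quotient)
  qed
qed

lemma sheafy_sub:
  assumes X: "sheafy X" shows "sheafy (sub_funspace X A)"
  unfolding sheafy_def topo_sub
proof (intro conjI allI impI)
  fix U U' f assume f: "f \<in> reg (sub_funspace X A) U" "U' \<subseteq> U"
  have "f \<in> reg (sub_funspace X A) U'" if U': "openin (subtopology (topo X) A) U'"
    unfolding reg_sub
  proof
    fix x assume x: "x \<in> U'"
    obtain O' where O': "openin (topo X) O'" "U' = O' \<inter> A" using U' unfolding openin_subtopology by blast
    obtain W g where W: "openin (topo X) W" "x \<in> W" "W \<inter> A \<subseteq> U" "g \<in> reg X W" "\<forall>y\<in>W \<inter> A. f y = g y"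
      using bspec[OF f(1)[unfolded reg_sub], of x] x f(2) by blast
    then show "\<exists>W g. openin (topo X) W \<and> x \<in> W \<and> W \<inter> A \<subseteq> U' \<and> g \<in> reg X W \<and> (\<forall>y\<in>W \<inter> A. f y = g y)"
      using x O' by (intro exI[of _ "W \<inter> O'"] exI[of _ g]) (auto elim!: sheafy_restrict[OF X])
  qed
  then show "f \<in> reg (sub_funspace X A) U' \<or> \<not> openin (subtopology (topo X) A) U'" by blast
next
  fix U f
  assume U: "openin (subtopology (topo X) A) U" and
    loc: "\<forall>x\<in>U. \<exists>W g. openin (subtopology (topo X) A) W \<and> x \<in> W \<and>
      g \<in> reg (sub_funspace X A) W \<and> (\<forall>y\<in>W \<inter> U. f y = g y)"
  obtain O' where O': "openin (topo X) O'" "U = O' \<inter> A" using U unfolding openin_subtopology by blast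
  show "f \<in> reg (sub_funspace X A) U"
    unfolding reg_sub
  proof
    fix x assume x: "x \<in> U"
    then obtain W g where W: "openin (subtopology (topo X) A) W" "x \<in> W"
      "g \<in> reg (sub_funspace X A) W" "\<forall>y\<in>W \<inter> U. f y = g y" using loc by blast
    obtain V h where V: "openin (topo X) V" "x \<in> V" "V \<inter> A \<subseteq> W" "h \<in> reg X V" "\<forall>y\<in>V \<inter> A. g y = h y"
      using bspec[OF W(3)[unfolded reg_sub], of x] W(2) by blast
    show "\<exists>W g. openin (topo X) W \<and> x \<in> W \<and> W \<inter> A \<subseteq> U \<and> g \<in> reg X W \<and> (\<forall>y\<in>W \<inter> A. f y = g y)"
    proof (intro exI conjI)
      show op: "openin (topo X) (V \<inter> O')" using V O' by blast
      show "h \<in> reg X (V \<inter> O')" by (rule sheafy_restrict[OF X V(4) _ op]) blast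
      show "x \<in> V \<inter> O'" "V \<inter> O' \<inter> A \<subseteq> U" using x V O' by auto
      show "\<forall>y\<in>V \<inter> O' \<inter> A. f y = h y" using V(3,5) W(4) O'(2) by (metis (no_types, lifting) IntD1 IntD2 IntI subsetD)
    qed
  qed
qed

section \<open>Morphisms between subspaces and quotients\<close>

lemma morphism_sub_dom:
  assumes "morphism X Y f" shows "morphism (sub_funspace X A) Y f"
  unfolding morphism_def
proof (intro conjI allI impI)
  show "continuous_map (topo (sub_funspace X A)) (topo Y) f"
    using assms unfolding morphism_def topo_sub by (blast intro: continuous_map_from_subtopology)
  fix U g assume Ug: "openin (topo Y) U \<and> g \<in> reg Y U"
  then have "openin (topo X) {x \<in> points X. f x \<in> U}"
    using assms unfolding morphism_def by (blast intro: openin_continuous_map_preimage)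
  moreover have "g \<circ> f \<in> reg X {x \<in> points X. f x \<in> U}" using assms Ug unfolding morphism_def by blast
  ultimately show "g \<circ> f \<in> reg (sub_funspace X A) {x \<in> points (sub_funspace X A). f x \<in> U}"
    unfolding reg_sub topo_sub
    by (auto intro!: exI[of _ "{x \<in> points X. f x \<in> U}"] exI[of _ "g \<circ> f"])
qed

lemma morphism_sub_codom:
  assumes "morphism X Y f" "sheafy X" "f ` points X \<subseteq> A"
  shows "morphism X (sub_funspace Y A) f"
  unfolding morphism_def
proof (intro conjI allI impI)
  show cont: "continuous_map (topo X) (topo (sub_funspace Y A)) f"
    using assms unfolding morphism_def topo_sub by (simp add: continuous_map_in_subtopology image_subset_iff_funcset)
  fix U g assume Ug: "openin (topo (sub_funspace Y A)) U \<and> g \<in> reg (sub_funspace Y A) U"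
  show "g \<circ> f \<in> reg X {x \<in> points X. f x \<in> U}"
  proof (rule sheafy_glue[OF assms(2)])
    show "openin (topo X) {x \<in> points X. f x \<in> U}"
      using cont Ug by (blast intro: openin_continuous_map_preimage)
    fix x assume x: "x \<in> {x \<in> points X. f x \<in> U}"
    then obtain W h where W: "openin (topo Y) W" "f x \<in> W" "h \<in> reg Y W" "\<forall>y\<in>W \<inter> A. g y = h y"
      using Ug unfolding reg_sub by blast
    have "openin (topo X) {x \<in> points X. f x \<in> W}"
      using assms(1) W unfolding morphism_def by (blast intro: openin_continuous_map_preimage)
    moreover have "h \<circ> f \<in> reg X {x \<in> points X. f x \<in> W}" using assms(1) W unfolding morphism_def by blast
    ultimately show "\<exists>W ga. openin (topo X) W \<and> x \<in> W \<and> ga \<in> reg X W \<and>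
      (\<forall>y\<in>W \<inter> {x \<in> points X. f x \<in> U}. (g \<circ> f) y = ga y)"
      using x W assms(3) by (intro exI[of _ "{x \<in> points X. f x \<in> W}"] exI[of _ "h \<circ> f"]) auto
  qed
qed

text \<open>The inverse will be constructed on a subset of projective space, whereas its domain is
  an open part of the cone locus, hence a subspace of a subspace. A local extension to the big space
  restricts to \<open>A\<close> first.\<close>

lemma morphism_sub_sub_dom:
  assumes "morphism (sub_funspace X (A \<inter> T)) Y f"
  shows "morphism (sub_funspace (sub_funspace X A) T) Y f"
  unfolding morphism_def
proof (intro conjI allI impI)
  have top: "topo (sub_funspace (sub_funspace X A) T) = topo (sub_funspace X (A \<inter> T))"
    by (simp add: topo_sub subtopology_subtopology)
  then show "continuous_map (topo (sub_funspace (sub_funspace X A) T)) (topo Y) f"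
    using assms unfolding morphism_def by simp
  fix U g assume "openin (topo Y) U \<and> g \<in> reg Y U"
  then have *: "g \<circ> f \<in> reg (sub_funspace X (A \<inter> T)) {x \<in> points (sub_funspace X (A \<inter> T)). f x \<in> U}"
    using assms unfolding morphism_def by blast
  have "k \<in> reg (sub_funspace (sub_funspace X A) T) N" if k: "k \<in> reg (sub_funspace X (A \<inter> T)) N"
    and NA: "N \<subseteq> A" for k N
    unfolding reg_sub[of k "sub_funspace X A"]
  proof
    fix x assume x: "x \<in> N"
    then obtain W h where W: "openin (topo X) W" "x \<in> W" "W \<inter> (A \<inter> T) \<subseteq> N" "h \<in> reg X W"
      "\<forall>y\<in>W \<inter> (A \<inter> T). k y = h y" using k unfolding reg_sub by blast
    have "h \<in> reg (sub_funspace X A) (W \<inter> A)" unfolding reg_sub using W by blast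
    then show "\<exists>W g. openin (topo (sub_funspace X A)) W \<and> x \<in> W \<and> W \<inter> T \<subseteq> N \<and>
        g \<in> reg (sub_funspace X A) W \<and> (\<forall>y\<in>W \<inter> T. k y = g y)"
      using W x NA unfolding topo_sub
      by (intro exI[of _ "W \<inter> A"] exI[of _ h]) (auto simp: openin_subtopology)
  qed
  moreover have "{x \<in> points (sub_funspace X (A \<inter> T)). f x \<in> U} \<subseteq> A" by (auto simp: topo_sub)
  ultimately show "g \<circ> f \<in> reg (sub_funspace (sub_funspace X A) T)
      {x \<in> points (sub_funspace (sub_funspace X A) T). f x \<in> U}"
    using * unfolding top by blast
qed

text \<open>A single polynomial lift \<open>h\<close> to the homogeneous coordinates suffices,
  because openness and regularity on a quotient are defined upstairs and polynomials pull back along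
  \<open>h\<close>.\<close>

lemma morphism_quotient_lift:
  assumes h: "\<And>z. z \<in> Z \<Longrightarrow> h z \<in> Z' \<and> \<pi>' (h z) = f (\<pi> z)"
    and poly: "\<And>p. p \<in> poly_funs s' \<Longrightarrow> p \<circ> h \<in> poly_funs s"
  shows "morphism (quotient_funspace (affine_funspace s Z) \<pi>) (quotient_funspace (affine_funspace s' Z') \<pi>') f"
  unfolding morphism_def
proof (intro conjI allI impI)
  let ?X = "quotient_funspace (affine_funspace s Z) \<pi>" and ?Y = "quotient_funspace (affine_funspace s' Z') \<pi>'"
  have "openin (topo ?X) {x \<in> points ?X. f x \<in> U}" if U: "openin (topo ?Y) U" for U
  proof -
    have N: "openin (topo (affine_funspace s' Z')) {z \<in> Z'. \<pi>' z \<in> U}"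
      using U unfolding openin_quotient points_affine by blast
    have "{x \<in> Z. \<pi> x \<in> {x \<in> \<pi> ` Z. f x \<in> U}} = {x \<in> Z. f (\<pi> x) \<in> U}" by auto
    moreover have "openin (topo (affine_funspace s Z)) {x \<in> Z. f (\<pi> x) \<in> U}"
      unfolding openin_affine
    proof (intro conjI ballI)
      fix x assume x: "x \<in> {x \<in> Z. f (\<pi> x) \<in> U}"
      then have "h x \<in> {z \<in> Z'. \<pi>' z \<in> U}" using h by simp
      then obtain p where p: "p \<in> poly_funs s'" "p (h x) \<noteq> 0" "\<And>y. y \<in> Z' \<Longrightarrow> p y \<noteq> 0 \<Longrightarrow> \<pi>' y \<in> U"
        using N unfolding openin_affine by blast
      show "\<exists>p\<in>poly_funs s. p x \<noteq> 0 \<and> (\<forall>y\<in>Z. p y \<noteq> 0 \<longrightarrow> y \<in> {x \<in> Z. f (\<pi> x) \<in> U})"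
      proof (intro bexI[of _ "p \<circ> h"] conjI ballI impI)
        show "p \<circ> h \<in> poly_funs s" using p poly by blast
        show "(p \<circ> h) x \<noteq> 0" using p by simp
        fix y assume "y \<in> Z" "(p \<circ> h) y \<noteq> 0"
        then show "y \<in> {x \<in> Z. f (\<pi> x) \<in> U}" using p(3)[of "h y"] h[of y] by simp
      qed
    qed blast
    ultimately show ?thesis unfolding openin_quotient points_quotient points_affine by auto
  qed
  then show "continuous_map (topo ?X) (topo ?Y) f"
    unfolding continuous_map_def points_quotient points_affine using h by force
  fix U g assume Ug: "openin (topo ?Y) U \<and> g \<in> reg ?Y U"
  have g: "g \<circ> \<pi>' \<in> reg (affine_funspace s' Z') {z \<in> Z'. \<pi>' z \<in> U}"
    using Ug unfolding reg_quotient points_affine by blast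
  have eq: "{x \<in> Z. \<pi> x \<in> {x \<in> \<pi> ` Z. f x \<in> U}} = {x \<in> Z. f (\<pi> x) \<in> U}" by auto
  show "g \<circ> f \<in> reg ?X {x \<in> points ?X. f x \<in> U}"
    unfolding reg_quotient points_quotient points_affine eq reg_affine
  proof
    fix x assume x: "x \<in> {x \<in> Z. f (\<pi> x) \<in> U}"
    then have "h x \<in> {z \<in> Z'. \<pi>' z \<in> U}" using h by simp
    then obtain p q where pq: "p \<in> poly_funs s'" "q \<in> poly_funs s'" "q (h x) \<noteq> 0"
      "\<And>y. y \<in> Z' \<Longrightarrow> \<pi>' y \<in> U \<Longrightarrow> q y \<noteq> 0 \<Longrightarrow> g (\<pi>' y) = p y / q y"
      using g unfolding reg_affine by fastforce
    show "\<exists>p\<in>poly_funs s. \<exists>q\<in>poly_funs s. q x \<noteq> 0 \<and>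
       (\<forall>y\<in>{x \<in> Z. f (\<pi> x) \<in> U}. q y \<noteq> 0 \<longrightarrow> (g \<circ> f \<circ> \<pi>) y = p y / q y)"
    proof (rule bexI[of _ "p \<circ> h"], rule bexI[of _ "q \<circ> h"], intro conjI ballI impI)
      show "p \<circ> h \<in> poly_funs s" "q \<circ> h \<in> poly_funs s" using pq poly by blast+
      show "(q \<circ> h) x \<noteq> 0" using pq by simp
      fix y assume "y \<in> {x \<in> Z. f (\<pi> x) \<in> U}" "(q \<circ> h) y \<noteq> 0"
      then show "(g \<circ> f \<circ> \<pi>) y = (p \<circ> h) y / (q \<circ> h) y" using pq(4)[of "h y"] h[of y] by simp
    qed
  qed
qed

text \<open>The decomposition is built along the generation of \<open>poly_funs\<close>, with
  convolution for products. Homogeneity of the components is then forced: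
  \<open>p (s (t * c) y)\<close> has two expansions in powers of \<open>t\<close>, whose
  coefficients must agree.\<close>

lemma poly_funs_homogeneous_components:
  assumes s: "vector_space s" and p: "p \<in> poly_funs s"
  obtains n P where "\<And>j. P j \<in> poly_funs s" "\<And>j y. j > n \<Longrightarrow> P j y = 0"
    "\<And>c y. p (s c y) = (\<Sum>j\<le>n. c ^ j * P j y)" "\<And>j c y. P j (s c y) = c ^ j * P j y"
proof -
  have "\<exists>n P. (\<forall>j. P j \<in> poly_funs s) \<and> (\<forall>j>n. \<forall>y. P j y = 0) \<and>
    (\<forall>c y. p (s c y) = (\<Sum>j\<le>n. c ^ j * P j y))"
    using p
  proof (induction rule: poly_funs.induct)
    case (const c)
    show ?case
      by (rule exI[of _ 0], rule exI[of _ "\<lambda>j _. if j = 0 then c else 0"]) (auto intro: poly_funs.const)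
  next
    case (linear \<phi>)
    have "\<phi> (s c y) = c * \<phi> y" for c y using linear by (rule linear_functional_scale)
    then show ?case using linear
      by (intro exI[of _ 1] exI[of _ "\<lambda>j. if j = 1 then \<phi> else (\<lambda>_. 0)"])
        (auto intro: poly_funs.const poly_funs.linear)
  next
    case (add p q)
    obtain n P where P: "\<And>j. P j \<in> poly_funs s" "\<And>j y. j > n \<Longrightarrow> P j y = 0"
       "\<And>c y. p (s c y) = (\<Sum>j\<le>n. c ^ j * P j y)" using add.IH(1) by blast
    obtain n' Q where Q: "\<And>j. Q j \<in> poly_funs s" "\<And>j y. j > n' \<Longrightarrow> Q j y = 0"
       "\<And>c y. q (s c y) = (\<Sum>j\<le>n'. c ^ j * Q j y)" using add.IH(2) by blast
    have "(\<Sum>j\<le>n. c ^ j * P j y) = (\<Sum>j\<le>n+n'. c ^ j * P j y)" for c y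
      by (rule sum.mono_neutral_left) (auto simp: P(2))
    moreover have "(\<Sum>j\<le>n'. c ^ j * Q j y) = (\<Sum>j\<le>n+n'. c ^ j * Q j y)" for c y
      by (rule sum.mono_neutral_left) (auto simp: Q(2))
    ultimately show ?case
      by (intro exI[of _ "n+n'"] exI[of _ "\<lambda>j x. P j x + Q j x"])
        (simp add: P Q poly_funs.add distrib_left sum.distrib)
  next
    case (mult p q)
    obtain n P where P: "\<And>j. P j \<in> poly_funs s" "\<And>j y. j > n \<Longrightarrow> P j y = 0"
       "\<And>c y. p (s c y) = (\<Sum>j\<le>n. c ^ j * P j y)" using mult.IH(1) by blast
    obtain n' Q where Q: "\<And>j. Q j \<in> poly_funs s" "\<And>j y. j > n' \<Longrightarrow> Q j y = 0"
       "\<And>c y. q (s c y) = (\<Sum>j\<le>n'. c ^ j * Q j y)" using mult.IH(2) by blast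
    show ?case
    proof (intro exI[of _ "n+n'"] exI[of _ "\<lambda>r y. \<Sum>k\<le>r. P k y * Q (r - k) y"] conjI allI impI)
      fix j show "(\<lambda>y. \<Sum>k\<le>j. P k y * Q (j - k) y) \<in> poly_funs s"
        by (intro poly_funs_sum poly_funs.mult P Q) simp
    next
      fix j y assume j: "j > n + n'"
      show "(\<Sum>k\<le>j. P k y * Q (j - k) y) = 0"
      proof (rule sum.neutral, intro ballI)
        fix k show "P k y * Q (j - k) y = 0" using P(2)[of k y] Q(2)[of "j - k" y] j by (cases "k > n") auto
      qed
    next
      fix c y
      have "p (s c y) * q (s c y) = (\<Sum>i\<le>n. P i y * c ^ i) * (\<Sum>j\<le>n'. Q j y * c ^ j)"
        by (simp add: P Q mult.commute)
      also have "\<dots> = (\<Sum>r\<le>n + n'. (\<Sum>k\<le>r. P k y * Q (r - k) y) * c ^ r)"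
        by (rule polynomial_product) (auto simp: P Q)
      finally show "p (s c y) * q (s c y) = (\<Sum>j\<le>n + n'. c ^ j * (\<Sum>k\<le>j. P k y * Q (j - k) y))"
        by (simp add: mult.commute)
    qed
  qed
  then obtain n P where P: "\<And>j. P j \<in> poly_funs s" "\<And>j y. j > n \<Longrightarrow> P j y = 0"
       "\<And>c y. p (s c y) = (\<Sum>j\<le>n. c ^ j * P j y)" by blast
  interpret vector_space s by (rule s)
  have "P j (s c y) = c ^ j * P j y" for j c y
  proof (cases "j \<le> n")
    case True
    show ?thesis
    proof (rule sum_powers_eqD[OF _ True, where a="\<lambda>j. P j (s c y)" and b="\<lambda>j. c ^ j * P j y"])
      fix t :: complex
      have "(\<Sum>j\<le>n. t ^ j * P j (s c y)) = p (s t (s c y))" by (rule P(3)[symmetric])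
      also have "\<dots> = p (s (t * c) y)" by (simp only: scale_scale)
      also have "\<dots> = (\<Sum>j\<le>n. (t * c) ^ j * P j y)" by (rule P(3))
      also have "\<dots> = (\<Sum>j\<le>n. t ^ j * (c ^ j * P j y))" by (simp only: power_mult_distrib mult.assoc)
      finally show "(\<Sum>j\<le>n. t ^ j * P j (s c y)) = (\<Sum>j\<le>n. t ^ j * (c ^ j * P j y))" .
    qed
  qed (simp add: P)
  then show ?thesis using P by (rule that[rotated -1])
qed

lemma span_singleton_eqD:
  assumes "vector_space s" "module.span s {x} = module.span s {y}" "x \<noteq> 0"
  shows "\<exists>c. c \<noteq> 0 \<and> x = s c y"
proof -
  interpret vector_space s by fact
  have "x \<in> span {y}" using assms(2) span_base[of x "{x}"] by simp
  then obtain c where "x = s c y" by (auto simp: span_singleton)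
  then show ?thesis using assms(3) by (intro exI[of _ c]) auto
qed

lemma span_singleton_scale:
  assumes "vector_space s" "c \<noteq> 0" shows "module.span s {s c y} = module.span s {y}"
proof -
  interpret vector_space s by fact
  have "s k y = s (k / c) (s c y)" for k using assms(2) by simp
  then have "range (\<lambda>k. s k y) \<subseteq> range (\<lambda>k. s k (s c y))" by (metis image_subsetI rangeI)
  moreover have "range (\<lambda>k. s k (s c y)) \<subseteq> range (\<lambda>k. s k y)" by auto
  ultimately show ?thesis by (auto simp: span_singleton)
qed

text \<open>
  An open set of a cone need not be defined by homogeneous polynomials, and a function that descends
  to the projective space need not be given as a quotient of homogeneous ones.  Both are
  repaired by passing to a homogeneous component, because the set and the function are invariant
  under scaling.
\<close>

lemma morphism_from_projective_sub:
  fixes s :: "complex \<Rightarrow> 'e \<Rightarrow> 'e::ab_group_add"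
  assumes vs: "vector_space s" and S: "module.subspace s S" and T: "T \<subseteq> lines s S"
    and lift: "\<And>w. w \<in> S - {0} \<Longrightarrow> module.span s {w} \<in> T \<Longrightarrow>
      \<exists>h r. r \<in> poly_funs s \<and> r w \<noteq> 0 \<and> (\<forall>p\<in>poly_funs s'. p \<circ> h \<in> poly_funs s) \<and>
        (\<forall>y\<in>S - {0}. module.span s {y} \<in> T \<and> r y \<noteq> 0 \<longrightarrow> h y \<in> Z' \<and> \<pi>' (h y) = f (module.span s {y}))"
  shows "morphism (sub_funspace (projective_funspace s S) T) (quotient_funspace (affine_funspace s' Z') \<pi>') f"
proof -
  interpret vector_space s by (rule vs)
  define \<pi> where "\<pi> = (\<lambda>y. span {y})"
  let ?P = "projective_funspace s S" and ?Y = "quotient_funspace (affine_funspace s' Z') \<pi>'"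
  have P_def: "?P = quotient_funspace (affine_funspace s (S - {0})) \<pi>"
    by (simp add: projective_funspace_def \<pi>_def)
  have ptsP: "points ?P = \<pi> ` (S - {0})" by (simp add: P_def points_quotient points_affine)
  have TP: "T \<subseteq> points ?P" using T unfolding ptsP lines_def \<pi>_def by auto
  have ptsT: "points (sub_funspace ?P T) = T" using TP by (auto simp: topo_sub)
  have sc: "s c y \<in> S - {0}" "\<pi> (s c y) = \<pi> y" if "y \<in> S - {0}" "c \<noteq> 0" for c y
    using that S by (auto simp: subspace_def \<pi>_def span_singleton_scale[OF vs])
  have TD: "\<exists>w. w \<in> S - {0} \<and> L = \<pi> w" if "L \<in> T" for L using that TP ptsP by blast
  have eqD: "\<exists>c. c \<noteq> 0 \<and> y = s c y'" if "\<pi> y = \<pi> y'" "y \<in> S - {0}" for y y'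
    using span_singleton_eqD[OF vs] that by (auto simp: \<pi>_def)
  define O' where "O' = (\<lambda>q. \<pi> ` {y \<in> S - {0}. q y \<noteq> (0::complex)})"
  have O'_iff: "\<pi> y \<in> O' q \<longleftrightarrow> q y \<noteq> 0"
    if "\<And>c y. q (s c y) = c ^ j * q y" "y \<in> S - {0}" for q y and j :: nat
  proof
    assume "\<pi> y \<in> O' q"
    then obtain y' where "y' \<in> S - {0}" "q y' \<noteq> 0" "\<pi> y = \<pi> y'" by (auto simp: O'_def)
    then show "q y \<noteq> 0" using eqD[of y y'] that by auto
  next
    assume "q y \<noteq> 0" then show "\<pi> y \<in> O' q" using that by (auto simp: O'_def)
  qed
  have O'_open: "openin (topo ?P) (O' q)"
    if q: "q \<in> poly_funs s" "\<And>c y. q (s c y) = c ^ j * q y" for q and j :: nat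
    unfolding P_def openin_quotient points_affine
  proof
    show "O' q \<subseteq> \<pi> ` (S - {0})" by (auto simp: O'_def)
    have "{x \<in> S - {0}. \<pi> x \<in> O' q} = {x \<in> S - {0}. q x \<noteq> 0}" using O'_iff[OF q(2)] by blast
    then show "openin (topo (affine_funspace s (S - {0}))) {x \<in> S - {0}. \<pi> x \<in> O' q}"
      unfolding openin_affine using q(1) by auto
  qed
  have lift': "\<exists>h r. r \<in> poly_funs s \<and> r w \<noteq> 0 \<and> (\<forall>p\<in>poly_funs s'. p \<circ> h \<in> poly_funs s) \<and>
        (\<forall>y\<in>S - {0}. \<pi> y \<in> T \<and> r y \<noteq> 0 \<longrightarrow> h y \<in> Z' \<and> \<pi>' (h y) = f (\<pi> y))"
    if "w \<in> S - {0}" "\<pi> w \<in> T" for w using lift[of w] that by (simp add: \<pi>_def)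
  have maps: "f \<in> T \<rightarrow> \<pi>' ` Z'"
  proof
    fix L assume L: "L \<in> T"
    then obtain w where w: "w \<in> S - {0}" "L = \<pi> w" using TD by blast
    show "f L \<in> \<pi>' ` Z'" using lift'[of w] w L by (metis imageI)
  qed
  have op: "openin (subtopology (topo ?P) T) {L \<in> T. f L \<in> U}" if U: "openin (topo ?Y) U" for U
  proof (subst openin_subopen, intro ballI)
    have N: "openin (topo (affine_funspace s' Z')) {z \<in> Z'. \<pi>' z \<in> U}"
      using U unfolding openin_quotient points_affine by blast
    fix L assume "L \<in> {L \<in> T. f L \<in> U}"
    then obtain w where w: "w \<in> S - {0}" "L = \<pi> w" "\<pi> w \<in> T" "f (\<pi> w) \<in> U" using TD by blast
    obtain h r where hr: "r \<in> poly_funs s" "r w \<noteq> 0" "\<And>p. p \<in> poly_funs s' \<Longrightarrow> p \<circ> h \<in> poly_funs s"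
      "\<And>y. y \<in> S - {0} \<Longrightarrow> \<pi> y \<in> T \<Longrightarrow> r y \<noteq> 0 \<Longrightarrow> h y \<in> Z' \<and> \<pi>' (h y) = f (\<pi> y)"
      using lift'[OF w(1,3)] by blast
    have "h w \<in> {z \<in> Z'. \<pi>' z \<in> U}" using hr w by simp
    then obtain p where p: "p \<in> poly_funs s'" "p (h w) \<noteq> 0" "\<And>y. y \<in> Z' \<Longrightarrow> p y \<noteq> 0 \<Longrightarrow> \<pi>' y \<in> U"
      using N unfolding openin_affine by blast
    \<comment> \<open>The factor \<open>r\<close> makes \<open>\<phi>\<close> vanish wherever
      nothing is known about the lift \<open>h\<close>.\<close>
    define \<phi> where "\<phi> = (\<lambda>y. (p \<circ> h) y * r y)"
    have "\<phi> \<in> poly_funs s" unfolding \<phi>_def by (rule poly_funs.mult[OF hr(3)[OF p(1)] hr(1)])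
    then obtain n Q where
      Q: "\<And>j. Q j \<in> poly_funs s" "\<And>j y. j > n \<Longrightarrow> Q j y = 0"
      "\<And>c y. \<phi> (s c y) = (\<Sum>j\<le>n. c ^ j * Q j y)" "\<And>j c y. Q j (s c y) = c ^ j * Q j y"
      by (rule poly_funs_homogeneous_components[OF vs]) (rule that)
    have "(\<Sum>j\<le>n. Q j w) = \<phi> w" using Q(3)[of 1 w] by simp
    also have "\<dots> \<noteq> 0" using p hr by (simp add: \<phi>_def)
    finally obtain j where j: "j \<le> n" "Q j w \<noteq> 0" by (metis atMost_iff sum.neutral)
    have "f (\<pi> y) \<in> U" if y: "y \<in> S - {0}" "\<pi> y \<in> T" "Q j y \<noteq> 0" for y
    proof (rule ccontr)
      assume nU: "f (\<pi> y) \<notin> U"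
      \<comment> \<open>\<open>f (\<pi> y)\<close> depends only on the line through
        \<open>y\<close>. If it lies outside \<open>U\<close>, then \<open>\<phi>\<close> vanishes
        on the whole punctured line, and so does each homogeneous component.\<close>
      have "(\<Sum>j\<le>n. c ^ j * Q j y) = 0" if c: "c \<noteq> 0" for c
      proof (cases "r (s c y) = 0")
        case True then show ?thesis using Q(3)[of c y] by (simp add: \<phi>_def)
      next
        case False
        then have "h (s c y) \<in> Z' \<and> \<pi>' (h (s c y)) = f (\<pi> y)" using hr(4)[of "s c y"] sc[OF y(1) c] y by simp
        then have "p (h (s c y)) = 0" using p(3) nU by metis
        then show ?thesis using Q(3)[of c y] by (simp add: \<phi>_def)
      qed
      from sum_powers_eq_0[OF this j(1)] show False using y by simp
    qed
    moreover have "\<pi> w \<in> O' (Q j)" using O'_iff[OF Q(4)] w j by blast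
    moreover have "openin (subtopology (topo ?P) T) (O' (Q j) \<inter> T)"
      using O'_open[OF Q(1) Q(4)] by (auto simp: openin_subtopology)
    ultimately show "\<exists>V. openin (subtopology (topo ?P) T) V \<and> L \<in> V \<and> V \<subseteq> {L \<in> T. f L \<in> U}"
      using w by (intro exI[of _ "O' (Q j) \<inter> T"]) (auto simp: O'_def)
  qed
  show ?thesis unfolding morphism_def
  proof (intro conjI allI impI)
    show "continuous_map (topo (sub_funspace ?P T)) (topo ?Y) f"
      unfolding continuous_map_def ptsT using op maps by (simp add: topo_sub points_quotient points_affine)
    fix U g assume Ug: "openin (topo ?Y) U \<and> g \<in> reg ?Y U"
    have g: "g \<circ> \<pi>' \<in> reg (affine_funspace s' Z') {z \<in> Z'. \<pi>' z \<in> U}"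
      using Ug unfolding reg_quotient points_affine by blast
    obtain V where V: "openin (topo ?P) V" "{L \<in> T. f L \<in> U} = V \<inter> T"
      using op[of U] Ug by (auto simp: openin_subtopology)
    show "g \<circ> f \<in> reg (sub_funspace ?P T) {x \<in> points (sub_funspace ?P T). f x \<in> U}"
      unfolding ptsT reg_sub
    proof
      fix L assume L: "L \<in> {x \<in> T. f x \<in> U}"
      then obtain w where w: "w \<in> S - {0}" "L = \<pi> w" "\<pi> w \<in> T" "f (\<pi> w) \<in> U" using TD by blast
      obtain h r where hr: "r \<in> poly_funs s" "r w \<noteq> 0" "\<And>p. p \<in> poly_funs s' \<Longrightarrow> p \<circ> h \<in> poly_funs s"
        "\<And>y. y \<in> S - {0} \<Longrightarrow> \<pi> y \<in> T \<Longrightarrow> r y \<noteq> 0 \<Longrightarrow> h y \<in> Z' \<and> \<pi>' (h y) = f (\<pi> y)"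
        using lift'[OF w(1,3)] by blast
      have "h w \<in> {z \<in> Z'. \<pi>' z \<in> U}" using hr w by simp
      then obtain p q where pq: "p \<in> poly_funs s'" "q \<in> poly_funs s'" "q (h w) \<noteq> 0"
        "\<And>y. y \<in> Z' \<Longrightarrow> \<pi>' y \<in> U \<Longrightarrow> q y \<noteq> 0 \<Longrightarrow> g (\<pi>' y) = p y / q y"
        using g unfolding reg_affine by fastforce
      define \<phi> where "\<phi> = (\<lambda>y. (p \<circ> h) y * r y)"
      define \<psi> where "\<psi> = (\<lambda>y. (q \<circ> h) y * r y)"
      have "\<phi> \<in> poly_funs s" unfolding \<phi>_def by (rule poly_funs.mult[OF hr(3)[OF pq(1)] hr(1)])
      then obtain n1 P where
        P: "\<And>j. P j \<in> poly_funs s" "\<And>j y. j > n1 \<Longrightarrow> P j y = 0"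
        "\<And>c y. \<phi> (s c y) = (\<Sum>j\<le>n1. c ^ j * P j y)" "\<And>j c y. P j (s c y) = c ^ j * P j y"
      by (rule poly_funs_homogeneous_components[OF vs]) (rule that)
      have "\<psi> \<in> poly_funs s" unfolding \<psi>_def by (rule poly_funs.mult[OF hr(3)[OF pq(2)] hr(1)])
      then obtain n2 Q where
        Q: "\<And>j. Q j \<in> poly_funs s" "\<And>j y. j > n2 \<Longrightarrow> Q j y = 0"
        "\<And>c y. \<psi> (s c y) = (\<Sum>j\<le>n2. c ^ j * Q j y)" "\<And>j c y. Q j (s c y) = c ^ j * Q j y"
      by (rule poly_funs_homogeneous_components[OF vs]) (rule that)
      have "(\<Sum>j\<le>n2. Q j w) = \<psi> w" using Q(3)[of 1 w] by simp
      also have "\<dots> \<noteq> 0" using pq hr by (simp add: \<psi>_def)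
      finally obtain j where j: "j \<le> n2" "Q j w \<noteq> 0" by (metis atMost_iff sum.neutral)
      \<comment> \<open>Numerator and denominator are components of the same degree
        \<open>j\<close>, so the quotient is constant on lines and any representative may be
        chosen.\<close>
      define G where "G = (\<lambda>L. let y = (SOME y. y \<in> S - {0} \<and> \<pi> y = L) in P j y / Q j y)"
      have G: "G (\<pi> y) = P j y / Q j y" if y: "y \<in> S - {0}" for y
      proof -
        define y' where "y' = (SOME y'. y' \<in> S - {0} \<and> \<pi> y' = \<pi> y)"
        have "y' \<in> S - {0} \<and> \<pi> y' = \<pi> y" unfolding y'_def by (rule someI[of _ y]) (use y in simp)
        then obtain c where "c \<noteq> 0" "y' = s c y" using eqD by blast
        then show ?thesis unfolding G_def Let_def y'_def[symmetric] by (simp add: P(4) Q(4))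
      qed
      have key: "g (f (\<pi> y)) = P j y / Q j y" if y: "y \<in> S - {0}" "\<pi> y \<in> T" "f (\<pi> y) \<in> U" "Q j y \<noteq> 0" for y
      proof -
        let ?n = "n1 + n2"
        \<comment> \<open>The quotient is controlled only at scalars where \<open>\<psi>\<close>,
          and hence \<open>?B\<close>, is nonzero. Multiplying by \<open>?B\<close> gives an
          identity at all nonzero scalars, and \<open>?B\<close> cancels afterwards as a nonzero
          polynomial.\<close>
        let ?A = "poly_of_coeffs ?n (\<lambda>j. g (f (\<pi> y)) * Q j y - P j y)" and ?B = "poly_of_coeffs ?n (\<lambda>j. Q j y)"
        have 1: "\<phi> (s c y) = (\<Sum>j\<le>?n. c ^ j * P j y)" for c
          unfolding P(3) by (rule sum.mono_neutral_left) (auto simp: P(2))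
        have 2: "\<psi> (s c y) = (\<Sum>j\<le>?n. c ^ j * Q j y)" for c
          unfolding Q(3) by (rule sum.mono_neutral_left) (auto simp: Q(2))
        have "?A * ?B = 0"
        proof (rule poly_eq_0_if_nonzero)
          fix c :: complex assume c: "c \<noteq> 0"
          have B: "poly ?B c = \<psi> (s c y)" by (simp add: poly_poly_of_coeffs 2)
          have "poly ?A c = g (f (\<pi> y)) * (\<Sum>j\<le>?n. c ^ j * Q j y) - (\<Sum>j\<le>?n. c ^ j * P j y)"
            unfolding poly_poly_of_coeffs right_diff_distrib sum_subtractf sum_distrib_left
            by (simp add: mult.left_commute)
          then have A: "poly ?A c = g (f (\<pi> y)) * \<psi> (s c y) - \<phi> (s c y)" by (simp only: 1 2)
          have "g (f (\<pi> y)) * \<psi> (s c y) = \<phi> (s c y)" if "\<psi> (s c y) \<noteq> 0"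
          proof -
            have nz: "r (s c y) \<noteq> 0" "q (h (s c y)) \<noteq> 0" using that by (auto simp: \<psi>_def)
            then have "h (s c y) \<in> Z' \<and> \<pi>' (h (s c y)) = f (\<pi> y)" using hr(4)[of "s c y"] sc[OF y(1) c] y by simp
            then have "g (f (\<pi> y)) = p (h (s c y)) / q (h (s c y))" using pq(4)[of "h (s c y)"] y nz by simp
            then show ?thesis using nz by (simp add: \<phi>_def \<psi>_def)
          qed
          then show "poly (?A * ?B) c = 0" using A B by auto
        qed
        moreover have "?B \<noteq> 0"
        proof
          assume "?B = 0" then have "coeff ?B j = 0" by simp
          then show False using j y by (simp add: coeff_poly_of_coeffs)
        qed
        ultimately have "coeff ?A j = 0" by simp
        then show ?thesis using j y by (simp add: coeff_poly_of_coeffs field_simps)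
      qed
      show "\<exists>W ga. openin (topo ?P) W \<and> L \<in> W \<and> W \<inter> T \<subseteq> {x \<in> T. f x \<in> U} \<and> ga \<in> reg ?P W \<and>
         (\<forall>y\<in>W \<inter> T. (g \<circ> f) y = ga y)"
      proof (intro exI conjI)
        show "openin (topo ?P) (O' (Q j) \<inter> V)" using V O'_open[OF Q(1) Q(4)] by blast
        show "L \<in> O' (Q j) \<inter> V" using O'_iff[OF Q(4) w(1)] j w L V by blast
        show "O' (Q j) \<inter> V \<inter> T \<subseteq> {x \<in> T. f x \<in> U}" using V by blast
        show "G \<in> reg ?P (O' (Q j) \<inter> V)"
          unfolding P_def reg_quotient points_affine reg_affine
          using O'_iff[OF Q(4)] G P(1) Q(1) by (metis (mono_tags, lifting) IntD1 comp_apply mem_Collect_eq)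
        show "\<forall>y\<in>O' (Q j) \<inter> V \<inter> T. (g \<circ> f) y = G y"
        proof
          fix L' assume L': "L' \<in> O' (Q j) \<inter> V \<inter> T"
          then obtain y where y: "y \<in> S - {0}" "L' = \<pi> y" "Q j y \<noteq> 0" by (auto simp: O'_def)
          then show "(g \<circ> f) L' = G L'" using key[of y] G[of y] L' V by auto
        qed
      qed
    qed
  qed
qed

section \<open>Symplectic bases\<close>

interpretation fs: vector_space "fscale :: complex \<Rightarrow> ('v \<Rightarrow> complex) \<Rightarrow> _"
  by (rule vector_space_fscale)

interpretation ts: vector_space "tscale :: complex \<Rightarrow> ('v \<Rightarrow> complex) \<times> _ \<times> _ \<Rightarrow> _"
  by (rule vector_space_tscale)

context symplectic_space
begin

lemma omega_add: "\<omega> (x + y) z = \<omega> x z + \<omega> y z" "\<omega> z (x + y) = \<omega> z x + \<omega> z y"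
  using linear_functional_add[OF linear_left] linear_functional_add[OF linear_right] by auto

lemma omega_scale: "\<omega> (smul c x) z = c * \<omega> x z" "\<omega> z (smul c x) = c * \<omega> z x"
  using linear_functional_scale[OF linear_left] linear_functional_scale[OF linear_right] by auto

lemma omega_zero: "\<omega> 0 z = 0" "\<omega> z 0 = 0"
  using omega_scale[of 0 0 z] omega_scale(2)[of z 0 0] by auto

lemma omega_minus: "\<omega> (- x) z = - \<omega> x z" "\<omega> z (- x) = - \<omega> z x"
  using omega_scale(1)[of "-1" x z] omega_scale(2)[of z "-1" x] by auto

lemma omega_diff: "\<omega> (x - y) z = \<omega> x z - \<omega> y z" "\<omega> z (x - y) = \<omega> z x - \<omega> z y"
  using omega_add(1)[of x "- y" z] omega_add(2)[of z x "- y"] by (auto simp: omega_minus)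

lemma omega_swap: "\<omega> y x = - \<omega> x y"
proof -
  have "\<omega> (x + y) (x + y) = 0" by (rule alternating)
  then have "\<omega> x y + \<omega> y x = 0" unfolding omega_add by (simp add: alternating add.commute)
  then show ?thesis by (simp add: add_eq_0_iff)
qed

lemmas omega_simps = omega_add omega_scale omega_zero omega_minus omega_diff alternating

lemma omega_in_dual: "\<omega> v \<in> dual_space smul"
  using linear_right by (simp add: dual_space_def)

lemma omega_not_zero: "v \<noteq> 0 \<Longrightarrow> \<exists>b. \<omega> v b = 1"
proof -
  assume "v \<noteq> 0"
  then obtain u where u: "\<omega> v u \<noteq> 0" using nondegenerate by blast
  then show ?thesis by (intro exI[of _ "smul (1 / \<omega> v u) u"]) (simp add: omega_simps)
qed

lemma vanishes_on_span:
  assumes "\<phi> \<in> dual_space smul" "\<And>s. s \<in> B \<Longrightarrow> \<phi> s = 0" "x \<in> span B" shows "\<phi> x = 0"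
  using assms(3)
proof (induction rule: span_induct_alt)
  case base
  then show ?case using linear_functional_scale[of smul \<phi> 0 0] assms(1) by (simp add: dual_space_def)
next
  case (step c x y)
  then show ?case using assms(1,2) by (simp add: dual_space_def linear_functional_scale linear_functional_add)
qed

end

locale symplectic_basis = symplectic_space smul \<omega>
  for smul :: "complex \<Rightarrow> 'v \<Rightarrow> 'v::ab_group_add" and \<omega> +
  fixes e\<^sub>1 f\<^sub>1 e\<^sub>2 f\<^sub>2 :: 'v
  assumes basis_omega: "\<omega> e\<^sub>1 f\<^sub>1 = 1" "\<omega> e\<^sub>2 f\<^sub>2 = 1" "\<omega> e\<^sub>1 e\<^sub>2 = 0" "\<omega> e\<^sub>1 f\<^sub>2 = 0" "\<omega> f\<^sub>1 e\<^sub>2 = 0" "\<omega> f\<^sub>1 f\<^sub>2 = 0"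
    and basis_expand: "x = smul (\<omega> x f\<^sub>1) e\<^sub>1 + smul (\<omega> e\<^sub>1 x) f\<^sub>1 + smul (\<omega> x f\<^sub>2) e\<^sub>2 + smul (\<omega> e\<^sub>2 x) f\<^sub>2"

context symplectic_space
begin

text \<open>Symplectic Gram-Schmidt: \<open>w\<close> projects along the hyperbolic plane of
  \<open>e1\<close> and \<open>f1\<close> onto its orthogonal complement. The complement is nonzero,
  since two vectors cannot span dimension four, and a second hyperbolic plane is taken inside
  it.\<close>

lemma symplectic_basis_exists:
  assumes dim: "dim UNIV = 4"
  shows "\<exists>e1 f1 e2 f2. symplectic_basis smul \<omega> e1 f1 e2 f2"
proof -
  obtain B where B: "independent B" "UNIV \<subseteq> span B" "card B = 4"
    using basis_exists[of UNIV] dim by metis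
  have finB: "finite B" using B(3) by (intro card_ge_0_finite) simp
  interpret fd: finite_dimensional_vector_space smul B
    using B finB by unfold_locales auto
  obtain e1 where "e1 \<in> B" using B(3) by fastforce
  then have e1: "e1 \<noteq> 0" using B(1) dependent_zero by blast
  obtain f1 where f1: "\<omega> e1 f1 = 1" using omega_not_zero[OF e1] by blast
  have f1e1: "\<omega> f1 e1 = -1" using omega_swap[of f1 e1] f1 by simp
  define w where "w = (\<lambda>x. x - smul (\<omega> x f1) e1 - smul (\<omega> e1 x) f1)"
  have w: "\<omega> e1 (w x) = 0" "\<omega> f1 (w x) = 0" for x
    using omega_swap[of f1 x] by (simp_all add: w_def omega_simps f1 f1e1)
  have i1: "independent {e1}" using e1 by simp
  have n2: "f1 \<notin> span {e1}"
    using vanishes_on_span[OF omega_in_dual, of "{e1}" e1 f1] f1 by (auto simp: alternating)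
  have i2: "independent {f1, e1}" using n2 i1 by (simp add: independent_insertI)
  have "\<exists>x. w x \<noteq> 0"
  proof (rule ccontr)
    assume "\<nexists>x. w x \<noteq> 0"
    then have "x = smul (\<omega> x f1) e1 + smul (\<omega> e1 x) f1" for x
      unfolding w_def by (metis add.commute diff_add_cancel diff_eq_diff_eq diff_zero eq_iff_diff_eq_0)
    then have "x \<in> span {e1, f1}" for x
      by (metis insertCI span_add span_base span_scale)
    then have "card B \<le> card {e1, f1}"
      using independent_span_bound[OF _ B(1), of "{e1, f1}"] by auto
    also have "\<dots> \<le> 2" by (simp add: card_insert_if)
    finally show False using B(3) by simp
  qed
  then obtain x2 where x2: "w x2 \<noteq> 0" by blast
  define e2 where "e2 = w x2"
  obtain u where u: "\<omega> e2 u = 1" using omega_not_zero x2 by (auto simp: e2_def)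
  define f2 where "f2 = w u"
  have e2: "\<omega> e1 e2 = 0" "\<omega> f1 e2 = 0" by (auto simp: e2_def w)
  then have e2': "\<omega> e2 e1 = 0" "\<omega> e2 f1 = 0" using omega_swap[of e2 e1] omega_swap[of e2 f1] by auto
  have f2: "\<omega> e1 f2 = 0" "\<omega> f1 f2 = 0" by (auto simp: f2_def w)
  have e2f2: "\<omega> e2 f2 = 1" using u e2' by (simp add: f2_def w_def omega_simps)
  have n3: "e2 \<notin> span {f1, e1}"
  proof
    assume "e2 \<in> span {f1, e1}"
    then have "\<omega> f2 e2 = 0" using vanishes_on_span[OF omega_in_dual, of "{f1,e1}" f2 e2] f2 omega_swap[of f2 e1] omega_swap[of f2 f1] by auto
    then show False using e2f2 omega_swap[of f2 e2] by simp
  qed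
  have n4: "f2 \<notin> span {e2, f1, e1}"
  proof
    assume "f2 \<in> span {e2, f1, e1}"
    then have "\<omega> e2 f2 = 0"
      by (rule vanishes_on_span[OF omega_in_dual, rotated -1]) (use e2' in \<open>auto simp: alternating\<close>)
    then show False using e2f2 by simp
  qed
  have i4: "independent {f2, e2, f1, e1}" using n3 n4 i2 by (simp add: independent_insertI)
  have "f1 \<notin> {e1}" "e2 \<notin> {f1, e1}" "f2 \<notin> {e2, f1, e1}"
    using n2 n3 n4 by (meson span_base)+
  then have "card {f2, e2, f1, e1} = 4" by simp
  then have sp: "UNIV \<subseteq> span {f2, e2, f1, e1}"
    using fd.card_ge_dim_independent[of "{f2,e2,f1,e1}" UNIV] i4 dim by simp
  have "x = smul (\<omega> x f1) e1 + smul (\<omega> e1 x) f1 + smul (\<omega> x f2) e2 + smul (\<omega> e2 x) f2" for x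
  proof -
    have "x \<in> span {f2, e2, f1, e1}" using sp by blast
    then obtain a where "x - smul a f2 \<in> span {e2, f1, e1}" unfolding span_breakdown_eq by blast
    then obtain b where "x - smul a f2 - smul b e2 \<in> span {f1, e1}" unfolding span_breakdown_eq by blast
    then obtain c where "x - smul a f2 - smul b e2 - smul c f1 \<in> span {e1}" unfolding span_breakdown_eq by blast
    then obtain d where "x - smul a f2 - smul b e2 - smul c f1 = smul d e1" unfolding span_singleton by blast
    then have x: "x = smul a f2 + smul b e2 + smul c f1 + smul d e1" by (simp add: algebra_simps)
    have "\<omega> f2 f1 = 0" "\<omega> f1 f2 = 0" "\<omega> f2 e1 = 0" using f2 omega_swap[of f2 e1] omega_swap[of f2 f1] by auto
    then have "\<omega> x f1 = d" "\<omega> e1 x = c" "\<omega> x f2 = b" "\<omega> e2 x = a"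
      unfolding x by (simp_all add: omega_simps f1 e2 e2' f2 e2f2)
    then show ?thesis using x by (simp add: algebra_simps)
  qed
  then have "symplectic_basis smul \<omega> e1 f1 e2 f2"
    using f1 e2 f2 e2f2 by unfold_locales auto
  then show ?thesis by blast
qed

end

context symplectic_basis
begin

section \<open>Coordinates in a symplectic basis\<close>

definition X0 :: "'v \<Rightarrow> complex" where "X0 x = \<omega> x f\<^sub>1"
definition X1 :: "'v \<Rightarrow> complex" where "X1 x = \<omega> e\<^sub>1 x"
definition X2 :: "'v \<Rightarrow> complex" where "X2 x = \<omega> x f\<^sub>2"
definition X3 :: "'v \<Rightarrow> complex" where "X3 x = \<omega> e\<^sub>2 x"

definition vec :: "complex \<Rightarrow> complex \<Rightarrow> complex \<Rightarrow> complex \<Rightarrow> 'v" where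
  "vec a b c d = smul a e\<^sub>1 + smul b f\<^sub>1 + smul c e\<^sub>2 + smul d f\<^sub>2"

lemma basis_omega': "\<omega> f\<^sub>1 e\<^sub>1 = -1" "\<omega> f\<^sub>2 e\<^sub>2 = -1" "\<omega> e\<^sub>2 e\<^sub>1 = 0" "\<omega> f\<^sub>2 e\<^sub>1 = 0" "\<omega> e\<^sub>2 f\<^sub>1 = 0" "\<omega> f\<^sub>2 f\<^sub>1 = 0"
  using omega_swap[of f\<^sub>1 e\<^sub>1] omega_swap[of f\<^sub>2 e\<^sub>2] omega_swap[of e\<^sub>2 e\<^sub>1] omega_swap[of f\<^sub>2 e\<^sub>1]
    omega_swap[of e\<^sub>2 f\<^sub>1] omega_swap[of f\<^sub>2 f\<^sub>1] basis_omega by auto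

lemma vec_coord: "vec (X0 x) (X1 x) (X2 x) (X3 x) = x"
  using basis_expand[of x] by (simp add: vec_def X0_def X1_def X2_def X3_def)

lemma coord_vec [simp]: "X0 (vec a b c d) = a" "X1 (vec a b c d) = b" "X2 (vec a b c d) = c" "X3 (vec a b c d) = d"
  by (simp_all add: vec_def X0_def X1_def X2_def X3_def omega_simps basis_omega basis_omega')

lemma coord_add [simp]: "X0 (x + y) = X0 x + X0 y" "X1 (x + y) = X1 x + X1 y"
    "X2 (x + y) = X2 x + X2 y" "X3 (x + y) = X3 x + X3 y"
  by (simp_all add: X0_def X1_def X2_def X3_def omega_simps)

lemma coord_smul [simp]: "X0 (smul c x) = c * X0 x" "X1 (smul c x) = c * X1 x"
    "X2 (smul c x) = c * X2 x" "X3 (smul c x) = c * X3 x"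
  by (simp_all add: X0_def X1_def X2_def X3_def omega_simps)

lemma coord_eqI: "X0 x = X0 y \<Longrightarrow> X1 x = X1 y \<Longrightarrow> X2 x = X2 y \<Longrightarrow> X3 x = X3 y \<Longrightarrow> x = y"
  by (metis vec_coord)

lemma omega_coord: "\<omega> v w = X0 v * X1 w - X1 v * X0 w + X2 v * X3 w - X3 v * X2 w"
proof -
  have "\<omega> (vec a b c d) w = a * X1 w - b * X0 w + c * X3 w - d * X2 w" for a b c d
    using omega_swap[of f\<^sub>1 w] omega_swap[of f\<^sub>2 w]
    by (simp add: vec_def omega_simps X0_def X1_def X2_def X3_def)
  from this[of "X0 v" "X1 v" "X2 v" "X3 v"] show ?thesis by (simp add: vec_coord)
qed

lemma dual_add: "l \<in> dual_space smul \<Longrightarrow> l (x + y) = l x + l y"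
  by (simp add: dual_space_def linear_functional_add)

lemma dual_scale: "l \<in> dual_space smul \<Longrightarrow> l (smul c x) = c * l x"
  by (simp add: dual_space_def linear_functional_scale)

lemma dual_diff: "l \<in> dual_space smul \<Longrightarrow> l (x - y) = l x - l y"
  using dual_add[of l x "smul (-1) y"] dual_scale[of l "-1" y] by simp

lemma dual_zero: "l \<in> dual_space smul \<Longrightarrow> l 0 = 0"
  using dual_scale[of l 0 0] by simp

text \<open>The inverse of the isomorphism \<open>v \<mapsto> \<omega> v\<close> onto the dual
  space. It is linear in the values of \<open>l\<close>, so a polynomial in the polar vector is also
  a polynomial in the equation of the hyperplane.\<close>

definition dual_vec :: "('v \<Rightarrow> complex) \<Rightarrow> 'v" where
  "dual_vec l = vec (l f\<^sub>1) (- l e\<^sub>1) (l f\<^sub>2) (- l e\<^sub>2)"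

lemma omega_dual_vec: "l \<in> dual_space smul \<Longrightarrow> \<omega> (dual_vec l) = l"
proof
  fix x assume l: "l \<in> dual_space smul"
  have "l x = l (vec (X0 x) (X1 x) (X2 x) (X3 x))" by (simp add: vec_coord)
  also have "\<dots> = X0 x * l e\<^sub>1 + X1 x * l f\<^sub>1 + X2 x * l e\<^sub>2 + X3 x * l f\<^sub>2"
    by (simp only: vec_def dual_add[OF l] dual_scale[OF l])
  finally show "\<omega> (dual_vec l) x = l x" by (simp add: dual_vec_def omega_coord)
qed

lemma dual_vec_omega: "dual_vec (\<omega> v) = v"
  by (rule coord_eqI)
    (simp_all add: dual_vec_def X0_def[symmetric] X2_def[symmetric], simp_all add: X1_def X3_def omega_swap[of v e\<^sub>1] omega_swap[of v e\<^sub>2])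

lemma dual_in_dualI:
  assumes "\<And>x y. l (x + y) = l x + l y" "\<And>c x. l (smul c x) = c * l x" shows "l \<in> dual_space smul"
  unfolding dual_space_def using assms vector_space_axioms
  by (auto simp: Vector_Spaces.linear_def module_hom_def module_hom_axioms_def vector_space_def Modules.module_def
      algebra_simps)

lemma coord_dual: "X0 \<in> dual_space smul" "X1 \<in> dual_space smul" "X2 \<in> dual_space smul" "X3 \<in> dual_space smul"
  by (rule dual_in_dualI, simp, simp)+

lemma dual_coord: "l \<in> dual_space smul \<Longrightarrow> l x = l e\<^sub>1 * X0 x + l f\<^sub>1 * X1 x + l e\<^sub>2 * X2 x + l f\<^sub>2 * X3 x"
  using dual_add[of l] dual_scale[of l] vec_coord[of x, unfolded vec_def] by (metis mult.commute)

end

section \<open>Forms\<close>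

lemma sym_forms_zero: "(\<lambda>_. 0) \<in> sym_forms A k W"
  using fs.span_zero unfolding sym_forms_def by (simp add: zero_fun_def)

lemma sym_forms_add: "f \<in> sym_forms A k W \<Longrightarrow> g \<in> sym_forms A k W \<Longrightarrow> (\<lambda>x. f x + g x) \<in> sym_forms A k W"
  using fs.span_add unfolding sym_forms_def by (simp add: plus_fun_def)

lemma sym_forms_scale: "f \<in> sym_forms A k W \<Longrightarrow> (\<lambda>x. c * f x) \<in> sym_forms A k W"
  using fs.span_scale unfolding sym_forms_def by (simp add: fscale_def)

lemma sym_forms_one: "restrict_form A (\<lambda>_. 1) \<in> sym_forms A 0 W"
  unfolding sym_forms_def by (rule fs.span_base) auto

lemma sym_forms_span_induct [consumes 1, case_names prod zero add scale]:
  assumes f: "f \<in> sym_forms A k W"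
    and prod: "\<And>w. \<forall>i<k. w i \<in> W \<Longrightarrow> P (restrict_form A (\<lambda>x. \<Prod>i<k. w i x))"
    and zero: "P (\<lambda>_. 0)" and add: "\<And>f g. P f \<Longrightarrow> P g \<Longrightarrow> P (\<lambda>x. f x + g x)"
    and scale: "\<And>c f. P f \<Longrightarrow> P (\<lambda>x. c * f x)"
  shows "P f"
  using f unfolding sym_forms_def
proof (induction rule: fs.span_induct_alt)
  case base show ?case using zero by (simp add: zero_fun_def)
next
  case (step c x y)
  then have "P (\<lambda>z. c * x z + y z)" by (intro add scale) (auto intro: prod)
  moreover have "fscale c x + y = (\<lambda>z. c * x z + y z)" by (auto simp: fscale_def)
  ultimately show ?case by simp
qed

lemma sym_forms_cons:
  assumes "w \<in> W" "f \<in> sym_forms A k W" shows "(\<lambda>x. w x * f x) \<in> sym_forms A (Suc k) W"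
  using assms(2)
proof (induction rule: sym_forms_span_induct)
  case (prod v)
  have "(\<lambda>x. w x * restrict_form A (\<lambda>x. \<Prod>i<k. v i x) x) = restrict_form A (\<lambda>x. \<Prod>i<Suc k. (v(k := w)) i x)"
    by (auto simp: restrict_form_def fun_eq_iff)
  then show ?case unfolding sym_forms_def using prod assms(1)
    by (intro fs.span_base) (auto intro!: exI[of _ "v(k := w)"])
next
  case zero show ?case by (simp add: sym_forms_zero)
next
  case (add f g) then show ?case using sym_forms_add by (fastforce simp: distrib_left)
next
  case (scale c f)
  have "(\<lambda>x. w x * (c * f x)) = (\<lambda>x. c * (w x * f x))" by (simp add: mult.left_commute)
  then show ?case using sym_forms_scale[OF scale] by simp
qed

text \<open>Linear factors are multiplied in one at a time, which changes the degree; hence the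
  predicate takes the degree as an argument.\<close>

lemma sym_forms_induct [consumes 1, case_names zero add scale one mult]:
  assumes f: "f \<in> sym_forms UNIV k W"
    and zero: "\<And>k. Q k (\<lambda>_. 0)"
    and add: "\<And>k f g. Q k f \<Longrightarrow> Q k g \<Longrightarrow> Q k (\<lambda>x. f x + g x)"
    and scale: "\<And>k c f. Q k f \<Longrightarrow> Q k (\<lambda>x. c * f x)"
    and one: "Q 0 (\<lambda>_. 1)"
    and mult: "\<And>k w f. w \<in> W \<Longrightarrow> f \<in> sym_forms UNIV k W \<Longrightarrow> Q k f \<Longrightarrow> Q (Suc k) (\<lambda>x. w x * f x)"
  shows "Q k f"
  using f
proof (induction rule: sym_forms_span_induct)
  case (prod w)
  have "Q n (\<lambda>x. \<Prod>i<n. w i x) \<and> (\<lambda>x. \<Prod>i<n. w i x) \<in> sym_forms UNIV n W" if "n \<le> k" for n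
    using that
  proof (induction n)
    case 0
    show ?case using one sym_forms_one[of UNIV W] by (simp add: restrict_form_def)
  next
    case (Suc n)
    then have "w n \<in> W" using prod by simp
    then show ?case using mult[of "w n" "\<lambda>x. \<Prod>i<n. w i x" n] sym_forms_cons[of "w n" W "\<lambda>x. \<Prod>i<n. w i x" UNIV n] Suc
      by (simp add: mult.commute)
  qed
  then show ?case by (simp add: restrict_form_def)
qed (use zero add scale in auto)

lemma sym_forms_const: "(\<lambda>_. c) \<in> sym_forms UNIV 0 W"
  using sym_forms_scale[OF sym_forms_one[of UNIV W], of c] by (simp add: restrict_form_def)

lemma sym_forms_linear: "w \<in> W \<Longrightarrow> w \<in> sym_forms UNIV 1 W"
  using sym_forms_cons[OF _ sym_forms_const[of 1 W], of w] by simp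

lemma sym_forms_mult:
  assumes "f \<in> sym_forms UNIV j W" "g \<in> sym_forms UNIV k W"
  shows "(\<lambda>x. f x * g x) \<in> sym_forms UNIV (j + k) W"
  using assms(1)
proof (induction rule: sym_forms_induct)
  case (zero k) show ?case by (simp add: sym_forms_zero)
next
  case (add j f h) then show ?case using sym_forms_add by (fastforce simp: distrib_right)
next
  case (scale j c f) then show ?case using sym_forms_scale by (fastforce simp: mult.assoc)
next
  case one show ?case using assms(2) by simp
next
  case (mult j w f) then show ?case using sym_forms_cons by (fastforce simp: mult.assoc)
qed

lemma sym_forms_power: "w \<in> W \<Longrightarrow> (\<lambda>x. w x ^ k) \<in> sym_forms UNIV k W"
proof (induction k)
  case 0 show ?case using sym_forms_const[of 1] by simp
next
  case (Suc k) then show ?case using sym_forms_cons[of w W "\<lambda>x. w x ^ k" UNIV k] by simp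
qed

context symplectic_basis
begin

section \<open>Taylor expansion and division of forms\<close>

abbreviation S :: "nat \<Rightarrow> ('v \<Rightarrow> complex) set" where
  "S k \<equiv> sym_forms UNIV k (dual_space smul)"

text \<open>The coefficients are kept as forms in \<open>x\<close>, with degrees, because two of
  them matter later as objects: the coefficient of order \<open>d - m\<close> of \<open>F\<close>
  becomes the cone equation, and the top coefficient of the cofactor is the constant by which it is
  multiplied.\<close>

lemma taylor:
  assumes "f \<in> S k"
  obtains G where "\<And>j. j \<le> k \<Longrightarrow> G j \<in> S (k - j)"
    "\<And>x s. f (x + smul s a) = (\<Sum>j\<le>k. s ^ j * G j x)"
    "\<And>x. G k x = f a" "G 0 = f"
proof -
  have "\<exists>G. (\<forall>j\<le>k. G j \<in> S (k - j)) \<and> (\<forall>x s. f (x + smul s a) = (\<Sum>j\<le>k. s ^ j * G j x)) \<and>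
      (\<forall>x. G k x = f a) \<and> G 0 = f"
    using assms
  proof (induction rule: sym_forms_induct)
    case (zero k) show ?case by (rule exI[of _ "\<lambda>_ _. 0"]) (simp add: sym_forms_zero)
  next
    case (add k f g)
    obtain G where G: "\<forall>j\<le>k. G j \<in> S (k - j)" "\<forall>x s. f (x + smul s a) = (\<Sum>j\<le>k. s ^ j * G j x)"
      "\<forall>x. G k x = f a" "G 0 = f" using add.IH(1) by blast
    obtain G' where G': "\<forall>j\<le>k. G' j \<in> S (k - j)" "\<forall>x s. g (x + smul s a) = (\<Sum>j\<le>k. s ^ j * G' j x)"
      "\<forall>x. G' k x = g a" "G' 0 = g" using add.IH(2) by blast
    show ?case
      by (rule exI[of _ "\<lambda>j x. G j x + G' j x"])
        (use G G' in \<open>simp add: sym_forms_add distrib_left sum.distrib\<close>)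
  next
    case (scale k c f)
    obtain G where G: "\<forall>j\<le>k. G j \<in> S (k - j)" "\<forall>x s. f (x + smul s a) = (\<Sum>j\<le>k. s ^ j * G j x)"
      "\<forall>x. G k x = f a" "G 0 = f" using scale.IH by blast
    show ?case
      by (rule exI[of _ "\<lambda>j x. c * G j x"])
        (use G in \<open>simp add: sym_forms_scale sum_distrib_left mult.left_commute\<close>)
  next
    case one show ?case by (rule exI[of _ "\<lambda>_ _. 1"]) (simp add: sym_forms_const)
  next
    case (mult k w f)
    obtain G where G: "\<forall>j\<le>k. G j \<in> S (k - j)" "\<forall>x s. f (x + smul s a) = (\<Sum>j\<le>k. s ^ j * G j x)"
      "\<forall>x. G k x = f a" "G 0 = f" using mult.IH by blast
    \<comment> \<open>The new factor contributes \<open>w x + s * w a\<close>: \<open>A\<close>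
      collects the part from \<open>w x\<close>, and \<open>B\<close>, with its index shifted by
      one, the part from \<open>s * w a\<close>.\<close>
    define A where "A = (\<lambda>j x. if j \<le> k then w x * G j x else 0)"
    define B where "B = (\<lambda>j x. if j > 0 then w a * G (j - 1) x else 0)"
    have A: "A j \<in> S (Suc k - j)" if "j \<le> Suc k" for j
    proof (cases "j \<le> k")
      case True
      then show ?thesis using sym_forms_cons[OF mult(1), of "G j" UNIV "k - j"] G by (simp add: A_def Suc_diff_le)
    qed (simp add: A_def sym_forms_zero)
    have B: "B j \<in> S (Suc k - j)" if "j \<le> Suc k" for j
    proof (cases j)
      case (Suc i)
      then show ?thesis using sym_forms_scale[of "G i" UNIV "k - i"] G(1) that by (simp add: B_def)
    qed (simp add: B_def sym_forms_zero)
    show ?case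
    proof (rule exI[of _ "\<lambda>j x. A j x + B j x"], intro conjI allI impI)
      fix j assume "j \<le> Suc k" then show "(\<lambda>x. A j x + B j x) \<in> S (Suc k - j)" by (intro sym_forms_add A B)
    next
      fix x s
      have "(\<Sum>j\<le>Suc k. s ^ j * A j x) = (\<Sum>j\<le>k. s ^ j * (w x * G j x))" by (simp add: A_def)
      moreover have "(\<Sum>j\<le>Suc k. s ^ j * B j x) = (\<Sum>j\<le>k. s ^ Suc j * (w a * G j x))"
        by (subst sum.atMost_Suc_shift) (simp add: B_def)
      ultimately have "(\<Sum>j\<le>Suc k. s ^ j * (A j x + B j x)) = (w x + s * w a) * (\<Sum>j\<le>k. s ^ j * G j x)"
        by (simp only: distrib_left distrib_right sum.distrib sum_distrib_left) (simp add: mult_ac)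
      then show "w (x + smul s a) * f (x + smul s a) = (\<Sum>j\<le>Suc k. s ^ j * (A j x + B j x))"
        using G(2) mult(1) by (simp add: dual_add dual_scale)
    next
      fix x show "A (Suc k) x + B (Suc k) x = w a * f a" using G by (simp add: A_def B_def)
    next
      show "(\<lambda>x. A 0 x + B 0 x) = (\<lambda>x. w x * f x)" using G by (simp add: A_def B_def)
    qed
  qed
  then show ?thesis using that by blast
qed

lemma form_poly:
  assumes "f \<in> S k"
  obtains p where "degree p \<le> k" "\<And>u. f (a + smul u b) = poly p u"
proof -
  obtain G where "\<And>x s. f (x + smul s b) = (\<Sum>j\<le>k. s ^ j * G j x)" using taylor[OF assms, of b] by metis
  then show ?thesis using that[of "poly_of_coeffs k (\<lambda>j. G j a)"] by (simp add: poly_poly_of_coeffs degree_poly_of_coeffs)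
qed

lemma form_scale: "f \<in> S k \<Longrightarrow> f (smul c x) = c ^ k * f x"
proof (induction rule: sym_forms_induct)
  case (mult k w f) then show ?case by (simp add: dual_scale)
qed (auto simp: algebra_simps)

text \<open>Division with remainder by \<open>l\<close>; the remainder is \<open>F\<close> after
  projection along \<open>a\<close> onto the kernel of \<open>l\<close>. A new factor
  \<open>w\<close> splits into \<open>w x - w a * l x\<close>, its value at the projected point, and
  a multiple of \<open>l\<close>.\<close>

lemma form_divide:
  assumes l: "l \<in> dual_space smul" "l a = 1" and "F \<in> S (Suc k)"
  obtains h where "h \<in> S k" "\<And>x. F x = F (x - smul (l x) a) + l x * h x"
proof -
  \<comment> \<open>A constant leaves quotient zero. Truncated subtraction would only say that the
    quotient is again a constant, so degree 0 is treated apart.\<close>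
  have "\<exists>h. (if k = 0 then h = (\<lambda>_. 0) else h \<in> S (k - 1)) \<and> (\<forall>x. f x = f (x - smul (l x) a) + l x * h x)"
    if "f \<in> S k" for k f
    using that
  proof (induction rule: sym_forms_induct)
    case (zero k) show ?case by (rule exI[of _ "\<lambda>_. 0"]) (simp add: sym_forms_zero)
  next
    case (add k f g)
    obtain h where h: "if k = 0 then h = (\<lambda>_. 0) else h \<in> S (k - 1)" "\<forall>x. f x = f (x - smul (l x) a) + l x * h x"
      using add.IH(1) by blast
    obtain h' where h': "if k = 0 then h' = (\<lambda>_. 0) else h' \<in> S (k - 1)" "\<forall>x. g x = g (x - smul (l x) a) + l x * h' x"
      using add.IH(2) by blast
    have "f x + g x = f (x - smul (l x) a) + g (x - smul (l x) a) + l x * (h x + h' x)" for x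
      using h(2)[rule_format, of x] h'(2)[rule_format, of x] by (simp add: algebra_simps)
    moreover have "if k = 0 then (\<lambda>x. h x + h' x) = (\<lambda>_. 0) else (\<lambda>x. h x + h' x) \<in> S (k - 1)"
    proof (cases "k = 0")
      case False then show ?thesis using h(1) h'(1) by (simp add: sym_forms_add)
    qed (use h(1) h'(1) in simp)
    ultimately show ?case by blast
  next
    case (scale k c f)
    obtain h where h: "if k = 0 then h = (\<lambda>_. 0) else h \<in> S (k - 1)" "\<forall>x. f x = f (x - smul (l x) a) + l x * h x"
      using scale.IH by blast
    have "c * f x = c * f (x - smul (l x) a) + l x * (c * h x)" for x
      using h(2)[rule_format, of x] by (simp add: algebra_simps)
    moreover have "if k = 0 then (\<lambda>x. c * h x) = (\<lambda>_. 0) else (\<lambda>x. c * h x) \<in> S (k - 1)"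
    proof (cases "k = 0")
      case False then show ?thesis using h(1) by (simp add: sym_forms_scale)
    qed (use h(1) in simp)
    ultimately show ?case by blast
  next
    case one show ?case by (rule exI[of _ "\<lambda>_. 0"]) simp
  next
    case (mult k w f)
    obtain h where h: "if k = 0 then h = (\<lambda>_. 0) else h \<in> S (k - 1)" "\<forall>x. f x = f (x - smul (l x) a) + l x * h x"
      using mult.IH by blast
    let ?w = "\<lambda>x. w x - w a * l x"
    have w': "?w \<in> dual_space smul"
      using mult(1) l by (intro dual_in_dualI) (simp_all add: dual_add dual_scale algebra_simps)
    have wx: "w (x - smul (l x) a) = ?w x" for x
      using mult(1) by (simp add: dual_diff dual_scale)
    have "(\<lambda>x. ?w x * h x) \<in> S k"
    proof (cases k)
      case (Suc i) then show ?thesis using sym_forms_cons[OF w', of h UNIV i] h(1) by simp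
    qed (use h(1) in \<open>simp add: sym_forms_zero\<close>)
    then have 1: "(\<lambda>x. ?w x * h x + w a * f x) \<in> S k"
      by (rule sym_forms_add[OF _ sym_forms_scale[OF mult(2)]])
    have 2: "w x * f x = w (x - smul (l x) a) * f (x - smul (l x) a) + l x * (?w x * h x + w a * f x)" for x
      unfolding wx using h(2)[rule_format, of x] by (simp add: algebra_simps)
    show ?case
    proof (rule exI[of _ "\<lambda>x. ?w x * h x + w a * f x"], rule conjI)
      show "if Suc k = 0 then (\<lambda>x. ?w x * h x + w a * f x) = (\<lambda>_. 0)
        else (\<lambda>x. ?w x * h x + w a * f x) \<in> S (Suc k - 1)" using 1 by simp
    qed (rule allI, rule 2)
  qed
  from this[OF assms(3)] show ?thesis using that by auto
qed

section \<open>Polar points and cones with vertex there\<close>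

definition hyp :: "'v \<Rightarrow> 'v set" where "hyp v = {x. \<omega> v x = 0}"

text \<open>Functionals with the same kernel are proportional: the value at some \<open>b\<close>
  off the kernel gives the factor, and nondegeneracy carries the proportionality over to the
  vectors.\<close>

lemma polar_point_hyp: "v \<noteq> 0 \<Longrightarrow> polar_point smul \<omega> (hyp v) = span {v}"
proof -
  assume v: "v \<noteq> 0"
  obtain b where b: "\<omega> v b = 1" using omega_not_zero[OF v] by blast
  have "u \<in> span {v}" if "\<exists>l\<in>dual_space smul. hyp v = {u. l u = 0} \<and> (\<forall>x. l x = \<omega> u x)" for u
  proof -
    have hu: "\<omega> v x = 0 \<longleftrightarrow> \<omega> u x = 0" for x using that by (auto simp: hyp_def set_eq_iff)
    have "\<omega> (u - smul (\<omega> u b) v) x = 0" for x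
    proof -
      have "\<omega> v (x - smul (\<omega> v x) b) = 0" using b by (simp add: omega_simps)
      then have "\<omega> u (x - smul (\<omega> v x) b) = 0" using hu by blast
      then show ?thesis by (simp add: omega_simps mult.commute)
    qed
    then have "u - smul (\<omega> u b) v = 0" using nondegenerate by blast
    then show ?thesis by (auto simp: span_singleton)
  qed
  then have "polar_point smul \<omega> (hyp v) \<subseteq> span {v}"
    unfolding polar_point_def by (intro span_minimal) (auto simp: subspace_span)
  moreover have "v \<in> polar_point smul \<omega> (hyp v)"
    unfolding polar_point_def by (rule span_base) (auto simp: hyp_def intro!: bexI[of _ "\<omega> v"] omega_in_dual)
  then have "span {v} \<subseteq> polar_point smul \<omega> (hyp v)"
    unfolding polar_point_def by (intro span_minimal) (auto simp: subspace_span)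
  ultimately show ?thesis by blast
qed

lemma cone_form_invariant:
  assumes "v \<noteq> 0" "q \<in> sym_forms (hyp v) m (G\<sigma>_fiber smul \<omega> (hyp v))" "\<omega> v x = 0"
  shows "q (x + smul s v) = q x"
  using assms(2)
proof (induction rule: sym_forms_span_induct)
  case (prod w)
  have "w i (x + smul s v) = w i x" if "i < m" for i
  proof -
    have "w i \<in> G\<sigma>_fiber smul \<omega> (hyp v)" using prod that by blast
    then obtain l where l: "l \<in> dual_space smul" "w i = restrict_form (hyp v) l" "w i v = 0"
      using polar_point_hyp[OF assms(1)] span_base[of v "{v}"] by (auto simp: G\<sigma>_fiber_def Q_fiber_def)
    then show ?thesis using assms(3) by (auto simp: restrict_form_def hyp_def omega_simps dual_add dual_scale split: if_splits)
  qed
  then show ?case using assms(3) by (simp add: restrict_form_def hyp_def omega_simps)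
qed auto

text \<open>For \<open>\<omega> v b = 1\<close> this is the projection along \<open>v\<close> onto
  the kernel of \<open>\<omega> b\<close>. It preserves \<open>\<omega> v\<close>, hence the
  hyperplane of \<open>v\<close>, and composing with it makes any form invariant under translation
  by \<open>v\<close>.\<close>

definition proj :: "'v \<Rightarrow> 'v \<Rightarrow> 'v \<Rightarrow> 'v" where "proj b v x = x + smul (\<omega> b x) v"

lemma restrict_proj_cone_form:
  assumes v: "v \<noteq> 0" and b: "\<omega> v b = 1" and "q \<in> S m"
  shows "restrict_form (hyp v) (\<lambda>x. q (proj b v x)) \<in> sym_forms (hyp v) m (G\<sigma>_fiber smul \<omega> (hyp v))"
  using assms(3)
proof (induction rule: sym_forms_induct)
  case (zero k) show ?case using sym_forms_zero by (simp add: restrict_form_def)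
next
  case (add k f g)
  have "restrict_form (hyp v) (\<lambda>x. f (proj b v x) + g (proj b v x)) =
    (\<lambda>x. restrict_form (hyp v) (\<lambda>x. f (proj b v x)) x + restrict_form (hyp v) (\<lambda>x. g (proj b v x)) x)"
    by (auto simp: restrict_form_def)
  then show ?case using sym_forms_add[OF add.IH] by simp
next
  case (scale k c f)
  have "restrict_form (hyp v) (\<lambda>x. c * f (proj b v x)) = (\<lambda>x. c * restrict_form (hyp v) (\<lambda>x. f (proj b v x)) x)"
    by (auto simp: restrict_form_def)
  then show ?case using sym_forms_scale[OF scale.IH] by simp
next
  case one show ?case by (rule sym_forms_one)
next
  case (mult k w f)
  have bv: "\<omega> b v = -1" using omega_swap[of b v] b by simp
  have lin: "(\<lambda>x. w (proj b v x)) \<in> dual_space smul"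
    using mult(1) by (intro dual_in_dualI) (simp_all add: proj_def dual_add dual_scale omega_simps algebra_simps)
  have van: "w (proj b v (smul c v)) = 0" for c
    using mult(1) by (simp add: proj_def dual_add dual_scale dual_zero omega_simps bv)
  have "restrict_form (hyp v) (\<lambda>x. w (proj b v x)) \<in> G\<sigma>_fiber smul \<omega> (hyp v)"
    unfolding G\<sigma>_fiber_def Q_fiber_def polar_point_hyp[OF v] using lin van
    by (auto simp: span_singleton restrict_form_def)
  from sym_forms_cons[OF this mult.IH] have "(\<lambda>x. restrict_form (hyp v) (\<lambda>x. w (proj b v x)) x *
      restrict_form (hyp v) (\<lambda>x. f (proj b v x)) x) \<in> sym_forms (hyp v) (Suc k) (G\<sigma>_fiber smul \<omega> (hyp v))" .
  moreover have "restrict_form (hyp v) (\<lambda>x. w (proj b v x) * f (proj b v x)) = (\<lambda>x. restrict_form (hyp v) (\<lambda>x. w (proj b v x)) x *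
      restrict_form (hyp v) (\<lambda>x. f (proj b v x)) x)" by (auto simp: restrict_form_def)
  ultimately show ?case by simp
qed

text \<open>Translation invariance replaces generation by linear forms that vanish at the polar
  point. Such generators are invariant; conversely, an invariant form agrees on the hyperplane with
  its composition with \<open>proj\<close>, whose linear factors vanish at \<open>v\<close>.\<close>

lemma restrict_cone_form_iff:
  assumes v: "v \<noteq> 0" and q: "q \<in> S m"
  shows "restrict_form (hyp v) q \<in> sym_forms (hyp v) m (G\<sigma>_fiber smul \<omega> (hyp v)) \<longleftrightarrow>
    (\<forall>x s. \<omega> v x = 0 \<longrightarrow> q (x + smul s v) = q x)"
proof
  assume *: "restrict_form (hyp v) q \<in> sym_forms (hyp v) m (G\<sigma>_fiber smul \<omega> (hyp v))"
  show "\<forall>x s. \<omega> v x = 0 \<longrightarrow> q (x + smul s v) = q x"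
  proof (intro allI impI)
    fix x s assume "\<omega> v x = 0"
    then show "q (x + smul s v) = q x"
      using cone_form_invariant[OF v *, of x s] by (simp add: restrict_form_def hyp_def omega_simps)
  qed
next
  assume *: "\<forall>x s. \<omega> v x = 0 \<longrightarrow> q (x + smul s v) = q x"
  obtain b where b: "\<omega> v b = 1" using omega_not_zero[OF v] by blast
  have "restrict_form (hyp v) q = restrict_form (hyp v) (\<lambda>x. q (proj b v x))"
    using * by (auto simp: restrict_form_def hyp_def proj_def)
  then show "restrict_form (hyp v) q \<in> sym_forms (hyp v) m (G\<sigma>_fiber smul \<omega> (hyp v))"
    using restrict_proj_cone_form[OF v b q] by simp
qed

text \<open>Homogeneous coordinates of a point of the bundle, with the polar vector in place of the
  equation of the hyperplane. All conditions concern ambient forms evaluated on the hyperplane, so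
  no restricted forms have to be carried along.\<close>

definition admissible :: "nat \<Rightarrow> nat \<Rightarrow> 'v \<Rightarrow> ('v \<Rightarrow> complex) \<Rightarrow> ('v \<Rightarrow> complex) \<Rightarrow> bool" where
  "admissible m d v q F \<longleftrightarrow> v \<noteq> 0 \<and> q \<in> S m \<and> F \<in> S d \<and> F \<noteq> 0 \<and>
    (\<forall>x s. \<omega> v x = 0 \<longrightarrow> q (x + smul s v) = q x) \<and> (\<exists>x. \<omega> v x = 0 \<and> q x \<noteq> 0) \<and>
    (\<exists>g\<in>S (d - m). \<forall>x. \<omega> v x = 0 \<longrightarrow> F x = q x * g x)"

lemma hyp_in_hyperplanes_iff: "hyp v \<in> hyperplanes smul \<longleftrightarrow> v \<noteq> 0"
proof
  assume "hyp v \<in> hyperplanes smul"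
  then obtain l where l: "hyp v = {u. l u = 0}" "l \<in> dual_space smul" "l \<noteq> 0" by (auto simp: hyperplanes_def)
  show "v \<noteq> 0"
  proof
    assume "v = 0" then have "\<forall>u. l u = 0" using l(1) by (auto simp: hyp_def omega_zero)
    then show False using l(3) by (auto simp: fun_eq_iff)
  qed
next
  assume "v \<noteq> 0"
  then obtain b where b: "\<omega> v b = 1" using omega_not_zero by blast
  have "\<omega> v \<noteq> 0"
  proof
    assume "\<omega> v = 0" then show False using b by (simp add: zero_fun_def)
  qed
  then show "hyp v \<in> hyperplanes smul" unfolding hyperplanes_def hyp_def using omega_in_dual by blast
qed

lemma span_in_lines_iff:
  assumes "\<And>c w. w \<in> W \<Longrightarrow> fscale c w \<in> W"
  shows "fs.span {w} \<in> lines fscale W \<longleftrightarrow> w \<in> W \<and> w \<noteq> 0"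
proof
  assume "fs.span {w} \<in> lines fscale W"
  then obtain w' where w': "w' \<in> W" "w' \<noteq> 0" "fs.span {w'} = fs.span {w}" by (auto simp: lines_def)
  then obtain c where c: "c \<noteq> 0" "w' = fscale c w" using span_singleton_eqD[OF vector_space_fscale] by blast
  then have "w = fscale (1 / c) w'" by simp
  then have "w \<in> W" using assms[OF w'(1)] by metis
  then show "w \<in> W \<and> w \<noteq> 0" using w' c by auto
qed (auto simp: lines_def)

text \<open>Forms on a hyperplane extend to the whole space, and every linear form is
  \<open>\<omega> v\<close> for some \<open>v\<close>; therefore the fibrewise conditions of the
  bundle become those of \<open>admissible\<close>.\<close>

lemma incidence_coords_iff:
  "z \<in> incidence_coords smul \<omega> m d \<longleftrightarrow> (\<exists>v q F. z = (\<omega> v, q, F) \<and> admissible m d v q F)"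
proof -
  have main: "(\<omega> v, q, F) \<in> incidence_coords smul \<omega> m d \<longleftrightarrow> admissible m d v q F" for v q F
  proof (cases "v \<noteq> 0 \<and> q \<in> S m \<and> F \<in> S d")
    case False
    then show ?thesis
      using hyp_in_hyperplanes_iff[of v]
      by (auto simp: admissible_def incidence_coords_def incidence_of_def incidence_points_def Y_points_def hyp_def)
  next
    case True
    then have v: "v \<noteq> 0" and q: "q \<in> S m" and F: "F \<in> S d" by auto
    let ?r = "restrict_form (hyp v) q"
    let ?Q = "sym_forms (hyp v) m (G\<sigma>_fiber smul \<omega> (hyp v))"
    let ?FF = "F_fiber smul m d (hyp v, fs.span {?r})"
    have "(\<omega> v, q, F) \<in> incidence_coords smul \<omega> m d \<longleftrightarrow>
      fs.span {?r} \<in> lines fscale ?Q \<and> fs.span {F} \<in> lines fscale ?FF"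
      using True hyp_in_hyperplanes_iff[of v] omega_in_dual[of v]
      by (auto simp: incidence_coords_def incidence_of_def incidence_points_def Y_points_def hyp_def)
    also have "fs.span {?r} \<in> lines fscale ?Q \<longleftrightarrow> ?r \<in> ?Q \<and> ?r \<noteq> 0"
      by (rule span_in_lines_iff) (use sym_forms_scale in \<open>auto simp: fscale_def\<close>)
    also have "fs.span {F} \<in> lines fscale ?FF \<longleftrightarrow> F \<in> ?FF \<and> F \<noteq> 0"
    proof (rule span_in_lines_iff)
      fix c w assume "w \<in> ?FF"
      then obtain q' g where w: "w \<in> S d" "q' \<in> fs.span {?r}" "g \<in> sym_forms (hyp v) (d - m) (Q_fiber smul (hyp v))"
        "restrict_form (hyp v) w = (\<lambda>x. q' x * g x)" by (auto simp: F_fiber_def)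
      have "restrict_form (hyp v) (fscale c w) = (\<lambda>x. c * restrict_form (hyp v) w x)"
        by (auto simp: restrict_form_def fscale_def)
      also have "\<dots> = (\<lambda>x. (fscale c q') x * g x)" using w(4) by (simp add: fscale_def mult.assoc)
      finally show "fscale c w \<in> ?FF"
        using w sym_forms_scale[OF w(1), of c] fs.span_scale[OF w(2), of c] by (auto simp: F_fiber_def fscale_def)
    qed
    also have "?r \<noteq> 0 \<longleftrightarrow> (\<exists>x. \<omega> v x = 0 \<and> q x \<noteq> 0)"
      by (auto simp: restrict_form_def hyp_def fun_eq_iff)
    also have "?r \<in> ?Q \<longleftrightarrow> (\<forall>x s. \<omega> v x = 0 \<longrightarrow> q (x + smul s v) = q x)" by (rule restrict_cone_form_iff[OF v q])
    also have "F \<in> ?FF \<longleftrightarrow> (\<exists>g\<in>S (d - m). \<forall>x. \<omega> v x = 0 \<longrightarrow> F x = q x * g x)"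
    proof
      assume "F \<in> ?FF"
      then obtain q' g where w: "q' \<in> fs.span {?r}" "g \<in> sym_forms (hyp v) (d - m) (Q_fiber smul (hyp v))"
        "restrict_form (hyp v) F = (\<lambda>x. q' x * g x)" by (auto simp: F_fiber_def)
      obtain g' where g': "g' \<in> S (d - m)" "g = restrict_form (hyp v) g'"
        using sym_forms_lift[OF _ w(2)] by blast
      \<comment> \<open>Members of the line \<open>L\<close> are multiples of the chosen equation;
        the scalar is moved into the cofactor.\<close>
      obtain c where c: "q' = fscale c ?r" using w(1) by (auto simp: fs.span_singleton)
      have "F x = q x * (c * g' x)" if "\<omega> v x = 0" for x
        using fun_cong[OF w(3), of x] that by (simp add: restrict_form_def hyp_def c g'(2) fscale_def)
      then show "\<exists>g\<in>S (d - m). \<forall>x. \<omega> v x = 0 \<longrightarrow> F x = q x * g x"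
        using sym_forms_scale[OF g'(1), of c] by (intro bexI[of _ "\<lambda>x. c * g' x"]) auto
    next
      assume "\<exists>g\<in>S (d - m). \<forall>x. \<omega> v x = 0 \<longrightarrow> F x = q x * g x"
      then obtain g where g: "g \<in> S (d - m)" "\<And>x. \<omega> v x = 0 \<Longrightarrow> F x = q x * g x" by blast
      have "restrict_form (hyp v) g \<in> sym_forms (hyp v) (d - m) (Q_fiber smul (hyp v))"
        using g(1)
      proof (induction rule: sym_forms_induct)
        case (zero k) show ?case using sym_forms_zero by (simp add: restrict_form_def)
      next
        case (add k f g)
        have "restrict_form (hyp v) (\<lambda>x. f x + g x) = (\<lambda>x. restrict_form (hyp v) f x + restrict_form (hyp v) g x)"
          by (auto simp: restrict_form_def)
        then show ?case using sym_forms_add[OF add.IH] by simp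
      next
        case (scale k c f)
        have "restrict_form (hyp v) (\<lambda>x. c * f x) = (\<lambda>x. c * restrict_form (hyp v) f x)"
          by (auto simp: restrict_form_def)
        then show ?case using sym_forms_scale[OF scale.IH] by simp
      next
        case one show ?case by (rule sym_forms_one)
      next
        case (mult k w f)
        then have "restrict_form (hyp v) w \<in> Q_fiber smul (hyp v)" by (auto simp: Q_fiber_def)
        from sym_forms_cons[OF this mult.IH] show ?case
          by (rule back_subst[of "\<lambda>f. f \<in> _"]) (auto simp: restrict_form_def)
      qed
      moreover have "restrict_form (hyp v) F = (\<lambda>x. ?r x * restrict_form (hyp v) g x)"
        using g(2) by (auto simp: restrict_form_def hyp_def)
      ultimately show "F \<in> ?FF" using F fs.span_base[of ?r "{?r}"] by (auto simp: F_fiber_def)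
    qed
    finally show ?thesis using True by (auto simp: admissible_def)
  qed
  show ?thesis
  proof
    assume z: "z \<in> incidence_coords smul \<omega> m d"
    obtain l q F where lqF: "z = (l, q, F)" by (cases z)
    then have "l \<in> dual_space smul" using z by (auto simp: incidence_coords_def)
    then have "l = \<omega> (dual_vec l)" by (simp add: omega_dual_vec)
    then show "\<exists>v q F. z = (\<omega> v, q, F) \<and> admissible m d v q F" using lqF z main by metis
  qed (use main in auto)
qed

lemma incidence_of_eqI:
  assumes "v' = smul c v" "c \<noteq> 0" "k \<noteq> 0" "k' \<noteq> 0"
    and "\<And>x. \<omega> v x = 0 \<Longrightarrow> q' x = k * q x" and "\<And>x. F' x = k' * F x"
  shows "incidence_of (\<omega> v', q', F') = incidence_of (\<omega> v, q, F)"
proof -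
  have h: "{u. \<omega> v' u = 0} = {u. \<omega> v u = 0}" using assms(1,2) by (auto simp: omega_simps)
  have "restrict_form {u. \<omega> v u = 0} q' = fscale k (restrict_form {u. \<omega> v u = 0} q)"
    using assms(5) by (auto simp: restrict_form_def fscale_def)
  moreover have "F' = fscale k' F" using assms(6) by (auto simp: fscale_def)
  ultimately show ?thesis
    using assms(3,4) by (simp add: incidence_of_def h span_singleton_scale[OF vector_space_fscale])
qed

lemma incidence_of_eqD:
  assumes "incidence_of (\<omega> v', q', F') = incidence_of (\<omega> v, q, F)" "v' \<noteq> 0" "v \<noteq> 0" "F' \<noteq> 0"
  shows "\<exists>c k. c \<noteq> 0 \<and> k \<noteq> 0 \<and> v' = smul c v \<and> F' = fscale k F"
proof -
  have "hyp v' = hyp v" using assms(1) by (auto simp: incidence_of_def hyp_def)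
  then have "span {v'} = span {v}" using polar_point_hyp assms(2,3) by metis
  then obtain c where "c \<noteq> 0" "v' = smul c v" using span_singleton_eqD[OF vector_space_axioms] assms(2) by blast
  moreover have "fs.span {F'} = fs.span {F}" using assms(1) by (auto simp: incidence_of_def)
  then obtain k where "k \<noteq> 0" "F' = fscale k F" using span_singleton_eqD[OF vector_space_fscale] assms(4) by blast
  ultimately show ?thesis by blast
qed

end

section \<open>Irreducibility of the incidence variety\<close>

text \<open>The degree bound is uniform in \<open>x\<close>, so \<open>f t\<close> is a finite sum
  of powers of \<open>t\<close> times fixed functions. Hence every linear functional, however it is
  defined on the infinite-dimensional function space, is polynomial along the curve.\<close>

definition poly_curve :: "(complex \<Rightarrow> 'a \<Rightarrow> complex) \<Rightarrow> bool" where
  "poly_curve f \<longleftrightarrow> (\<exists>n. \<forall>x. \<exists>P. degree P \<le> n \<and> (\<forall>t. f t x = poly P t))"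

lemma poly_curve_add: "poly_curve f \<Longrightarrow> poly_curve g \<Longrightarrow> poly_curve (\<lambda>t x. f t x + g t x)"
  unfolding poly_curve_def
proof (elim exE)
  fix n n' assume f: "\<forall>x. \<exists>P. degree P \<le> n \<and> (\<forall>t. f t x = poly P t)"
    and g: "\<forall>x. \<exists>P. degree P \<le> n' \<and> (\<forall>t. g t x = poly P t)"
  have "\<exists>P. degree P \<le> max n n' \<and> (\<forall>t. f t x + g t x = poly P t)" for x
  proof -
    obtain P Q where "degree P \<le> n" "\<forall>t. f t x = poly P t" "degree Q \<le> n'" "\<forall>t. g t x = poly Q t"
      using f g by blast
    then show ?thesis by (intro exI[of _ "P + Q"]) (auto intro!: degree_add_le simp: max.coboundedI1 max.coboundedI2)
  qed
  then show "\<exists>n. \<forall>x. \<exists>P. degree P \<le> n \<and> (\<forall>t. f t x + g t x = poly P t)" by blast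
qed

lemma poly_curve_mult: "poly_curve f \<Longrightarrow> poly_curve g \<Longrightarrow> poly_curve (\<lambda>t x. f t x * g t x)"
  unfolding poly_curve_def
proof (elim exE)
  fix n n' assume f: "\<forall>x. \<exists>P. degree P \<le> n \<and> (\<forall>t. f t x = poly P t)"
    and g: "\<forall>x. \<exists>P. degree P \<le> n' \<and> (\<forall>t. g t x = poly P t)"
  have "\<exists>P. degree P \<le> n + n' \<and> (\<forall>t. f t x * g t x = poly P t)" for x
  proof -
    obtain P Q where "degree P \<le> n" "\<forall>t. f t x = poly P t" "degree Q \<le> n'" "\<forall>t. g t x = poly Q t"
      using f g by blast
    then show ?thesis using degree_mult_le[of P Q] by (intro exI[of _ "P * Q"]) auto
  qed
  then show "\<exists>n. \<forall>x. \<exists>P. degree P \<le> n \<and> (\<forall>t. f t x * g t x = poly P t)" by blast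
qed

lemma poly_curve_linear: "poly_curve (\<lambda>t x. (1 - t) * f x + t * g x)"
  unfolding poly_curve_def
proof (rule exI[of _ 1], rule allI)
  fix x show "\<exists>P. degree P \<le> 1 \<and> (\<forall>t. (1 - t) * f x + t * g x = poly P t)"
    by (rule exI[of _ "[:f x, g x - f x:]"]) (auto simp: algebra_simps)
qed

lemma sum_fun_apply: "(\<Sum>i\<in>I. f i) x = (\<Sum>i\<in>I. f i x)"
  by (induction I rule: infinite_finite_induct) auto

lemma linear_functional_poly_curve:
  assumes f: "poly_curve f" and \<phi>: "Vector_Spaces.linear fscale (*) \<phi>"
  shows "\<exists>P. \<forall>t. \<phi> (f t) = poly P t"
proof -
  obtain n where "\<forall>x. \<exists>P. degree P \<le> n \<and> (\<forall>t. f t x = poly P t)" using f unfolding poly_curve_def ..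
  then obtain P where P: "\<And>x. degree (P x) \<le> n" "\<And>x t. f t x = poly (P x) t" by metis
  have eq: "f t = (\<Sum>j\<le>n. fscale (t ^ j) (\<lambda>x. coeff (P x) j))" for t
  proof
    fix x
    have "f t x = (\<Sum>j\<le>degree (P x). coeff (P x) j * t ^ j)" unfolding P(2) by (rule poly_altdef)
    also have "\<dots> = (\<Sum>j\<le>n. coeff (P x) j * t ^ j)"
      by (rule sum.mono_neutral_left) (use P(1)[of x] in \<open>auto simp: coeff_eq_0\<close>)
    finally have "f t x = (\<Sum>j\<le>n. coeff (P x) j * t ^ j)" .
    then show "f t x = (\<Sum>j\<le>n. fscale (t ^ j) (\<lambda>x. coeff (P x) j)) x"
      by (simp add: sum_fun_apply fscale_def mult.commute)
  qed
  have "\<phi> (f t) = (\<Sum>j\<le>n. t ^ j * \<phi> (\<lambda>x. coeff (P x) j))" for t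
  proof -
    interpret Vector_Spaces.linear fscale "(*)" \<phi> by (rule \<phi>)
    show ?thesis unfolding eq by (simp add: sum scale)
  qed
  then show ?thesis by (intro exI[of _ "poly_of_coeffs n (\<lambda>j. \<phi> (\<lambda>x. coeff (P x) j))"]) (simp add: poly_poly_of_coeffs)
qed

lemma linear_tscale_decompose:
  fixes \<phi> :: "('a \<Rightarrow> complex) \<times> ('a \<Rightarrow> complex) \<times> ('a \<Rightarrow> complex) \<Rightarrow> complex"
  assumes "Vector_Spaces.linear tscale (*) \<phi>"
  obtains \<phi>1 \<phi>2 \<phi>3 where "Vector_Spaces.linear fscale (*) \<phi>1" "Vector_Spaces.linear fscale (*) \<phi>2"
    "Vector_Spaces.linear fscale (*) \<phi>3" "\<And>l q F. \<phi> (l, q, F) = \<phi>1 l + \<phi>2 q + \<phi>3 F"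
proof -
  have L: "Vector_Spaces.linear fscale (*) (\<lambda>f. \<phi> (i f))"
    if "\<And>f g. i (f + g) = i f + i g" "\<And>c f. i (fscale c f) = tscale c (i f)" for i
    using that linear_functional_add[OF assms] linear_functional_scale[OF assms] vector_space_fscale
    by (auto simp: Vector_Spaces.linear_def module_hom_def module_hom_axioms_def vector_space_def Modules.module_def
      algebra_simps)
  show ?thesis
  proof (rule that)
    show "Vector_Spaces.linear fscale (*) (\<lambda>f. \<phi> (f, 0, 0))" by (rule L) (auto simp: tscale_def fscale_def)
    show "Vector_Spaces.linear fscale (*) (\<lambda>f. \<phi> (0, f, 0))" by (rule L) (auto simp: tscale_def fscale_def)
    show "Vector_Spaces.linear fscale (*) (\<lambda>f. \<phi> (0, 0, f))" by (rule L) (auto simp: tscale_def fscale_def)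
    fix l q F :: "'a \<Rightarrow> complex"
    have "(l, q, F) = (l, 0, 0) + (0, q, 0) + (0, 0, F)" by (simp add: fun_eq_iff)
    then show "\<phi> (l, q, F) = \<phi> (l, 0, 0) + \<phi> (0, q, 0) + \<phi> (0, 0, F)"
      by (simp only: linear_functional_add[OF assms])
  qed
qed

lemma poly_funs_poly_curve:
  assumes "p \<in> poly_funs tscale" "poly_curve l" "poly_curve q" "poly_curve F"
  shows "\<exists>P. \<forall>t. p (l t, q t, F t) = poly P t"
  using assms(1)
proof (induction rule: poly_funs.induct)
  case (const c) show ?case by (rule exI[of _ "[:c:]"]) simp
next
  case (linear \<phi>)
  obtain \<phi>1 \<phi>2 \<phi>3 where \<phi>: "Vector_Spaces.linear fscale (*) \<phi>1" "Vector_Spaces.linear fscale (*) \<phi>2"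
    "Vector_Spaces.linear fscale (*) \<phi>3" "\<And>l q F. \<phi> (l, q, F) = \<phi>1 l + \<phi>2 q + \<phi>3 F"
    by (rule linear_tscale_decompose[OF linear]) (rule that)
  obtain P1 P2 P3 where "\<forall>t. \<phi>1 (l t) = poly P1 t" "\<forall>t. \<phi>2 (q t) = poly P2 t" "\<forall>t. \<phi>3 (F t) = poly P3 t"
    using linear_functional_poly_curve assms \<phi> by metis
  then show ?case by (intro exI[of _ "P1 + P2 + P3"]) (simp add: \<phi>)
next
  case (add p q) then show ?case by (metis poly_add)
next
  case (mult p q) then show ?case by (metis poly_mult)
qed

context symplectic_basis
begin

section \<open>Normalised coordinates and rational curves in the bundle\<close>

lemma form_comp_linear:
  assumes "f \<in> S k" "\<And>l. l \<in> dual_space smul \<Longrightarrow> (\<lambda>x. l (R x)) \<in> dual_space smul"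
  shows "(\<lambda>x. f (R x)) \<in> S k"
  using assms(1)
proof (induction rule: sym_forms_induct)
  case (mult k w f) then show ?case using sym_forms_cons[OF assms(2)[OF mult(1)] mult.IH] by simp
qed (auto intro: sym_forms_zero sym_forms_add sym_forms_scale sym_forms_const)

lemma proj_form: "f \<in> S k \<Longrightarrow> (\<lambda>x. f (proj b v x)) \<in> S k"
  by (erule form_comp_linear, rule dual_in_dualI)
    (simp_all add: proj_def dual_add dual_scale omega_simps algebra_simps)

lemma proj_invariant: "\<omega> v b = 1 \<Longrightarrow> proj b v (x + smul s v) = proj b v x"
  using omega_swap[of b v] by (simp add: proj_def omega_simps scale_left_diff_distrib)

text \<open>The condition \<open>\<omega> w b = 1\<close> is affine, so it survives linear
  interpolation of polar vectors. The cone form matters only on the hyperplane, and composing with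
  \<open>proj\<close> fixes its extension to the whole space.\<close>

lemma admissible_normalize:
  assumes "admissible m d v q F" "\<omega> v b \<noteq> 0"
  defines "w \<equiv> smul (1 / \<omega> v b) v"
  shows "admissible m d w (\<lambda>x. q (proj b w x)) F" "\<omega> w b = 1"
    "incidence_of (\<omega> w, (\<lambda>x. q (proj b w x)), F) = incidence_of (\<omega> v, q, F)"
proof -
  let ?c = "1 / \<omega> v b"
  show wb: "\<omega> w b = 1" using assms(2) by (simp add: w_def omega_simps)
  have w0: "\<omega> w x = 0 \<longleftrightarrow> \<omega> v x = 0" for x using assms(2) by (simp add: w_def omega_simps)
  have q: "q (proj b w x) = q x" if "\<omega> v x = 0" for x
    using assms(1) that by (simp add: proj_def w_def admissible_def)
  have "w \<noteq> 0" using assms by (simp add: w_def admissible_def)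
  then show "admissible m d w (\<lambda>x. q (proj b w x)) F"
    using assms(1) proj_form proj_invariant[OF wb] unfolding admissible_def w0 by (auto simp: q)
  show "incidence_of (\<omega> w, (\<lambda>x. q (proj b w x)), F) = incidence_of (\<omega> v, q, F)"
    by (rule incidence_of_eqI[of _ ?c _ 1 1]) (use q assms(2) in \<open>auto simp: w_def\<close>)
qed

text \<open>\<open>F\<close> minus the product vanishes on the hyperplane, so the remainder after
  division by \<open>\<omega> v\<close> is zero. This turns the divisibility condition into free
  parameters \<open>q\<close>, \<open>g\<close>, \<open>h\<close>, which can be
  interpolated.\<close>

lemma admissible_decompose:
  assumes "admissible m d v q F" "\<omega> v b = 1" "m \<le> d" "m > 0"
  obtains g h where "g \<in> S (d - m)" "h \<in> S (d - 1)"
    "\<And>x. F x = q (proj b v x) * g x + \<omega> v x * h x"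
proof -
  obtain g where g: "g \<in> S (d - m)" "\<And>x. \<omega> v x = 0 \<Longrightarrow> F x = q x * g x" using assms(1) by (auto simp: admissible_def)
  have q: "q \<in> S m" "\<And>x s. \<omega> v x = 0 \<Longrightarrow> q (x + smul s v) = q x" "F \<in> S d" using assms(1) by (auto simp: admissible_def)
  have d: "Suc (d - 1) = d" "m + (d - m) = d" using assms by auto
  have "(\<lambda>x. q (proj b v x) * g x) \<in> S d" using sym_forms_mult[OF proj_form[OF q(1)] g(1)] d by simp
  then have "(\<lambda>x. F x + (-1) * (q (proj b v x) * g x)) \<in> S d" by (intro sym_forms_add sym_forms_scale q(3))
  then obtain h where h: "h \<in> S (d - 1)"
    "\<And>x. F x + (-1) * (q (proj b v x) * g x) =
      F (x - smul (\<omega> v x) b) + (-1) * (q (proj b v (x - smul (\<omega> v x) b)) * g (x - smul (\<omega> v x) b)) + \<omega> v x * h x"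
    using form_divide[OF omega_in_dual assms(2), of "\<lambda>x. F x + (-1) * (q (proj b v x) * g x)" "d - 1"] d by auto
  have "F y + (-1) * (q (proj b v y) * g y) = 0" if "\<omega> v y = 0" for y
    using g(2)[OF that] q(2)[OF that] by (simp add: proj_def)
  then have "F (x - smul (\<omega> v x) b) + (-1) * (q (proj b v (x - smul (\<omega> v x) b)) * g (x - smul (\<omega> v x) b)) = 0" for x
    using assms(2) by (simp add: omega_simps)
  then have "F x = q (proj b v x) * g x + \<omega> v x * h x" for x using h(2)[of x] by (simp add: algebra_simps)
  then show ?thesis using that g(1) h(1) by blast
qed

lemma common_nonvanishing:
  assumes "v\<^sub>1 \<noteq> 0" "v\<^sub>2 \<noteq> 0" obtains b where "\<omega> v\<^sub>1 b \<noteq> 0" "\<omega> v\<^sub>2 b \<noteq> 0"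
proof -
  obtain b1 b2 where b: "\<omega> v\<^sub>1 b1 = 1" "\<omega> v\<^sub>2 b2 = 1" using omega_not_zero assms by metis
  show ?thesis
  proof (cases "\<omega> v\<^sub>2 b1 = 0")
    case False then show ?thesis using that[of b1] b by simp
  next
    case True
    show ?thesis
    proof (cases "\<omega> v\<^sub>1 b2 = 0")
      case False then show ?thesis using that[of b2] b by simp
    next
      case t: True then show ?thesis using that[of "b1 + b2"] b True by (simp add: omega_simps)
    qed
  qed
qed

text \<open>
  Two points of the bundle are joined by a rational curve: choose \<open>b\<close> outside both hyperplanes,
  interpolate the polar points linearly, let the cone forms follow by projecting along the moving
  polar point to \<open>b\<^sup>\<bottom>\<close>, and interpolate the remaining factors.
\<close>

lemma admissible_connect:
  assumes md: "m \<le> d" "m > 0"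
    and a: "admissible m d w\<^sub>1 q\<^sub>1 F\<^sub>1" "admissible m d w\<^sub>2 q\<^sub>2 F\<^sub>2"
    and b: "\<omega> w\<^sub>1 b = 1" "\<omega> w\<^sub>2 b = 1"
    and inv: "\<And>x. q\<^sub>1 (proj b w\<^sub>1 x) = q\<^sub>1 x" "\<And>x. q\<^sub>2 (proj b w\<^sub>2 x) = q\<^sub>2 x"
    and p: "p\<^sub>1 \<in> poly_funs tscale" "p\<^sub>2 \<in> poly_funs tscale"
    and nz\<^sub>1: "p\<^sub>1 (\<omega> w\<^sub>1, q\<^sub>1, F\<^sub>1) \<noteq> 0" and nz\<^sub>2: "p\<^sub>2 (\<omega> w\<^sub>2, q\<^sub>2, F\<^sub>2) \<noteq> 0"
  shows "\<exists>v q F. admissible m d v q F \<and> p\<^sub>1 (\<omega> v, q, F) \<noteq> 0 \<and> p\<^sub>2 (\<omega> v, q, F) \<noteq> 0"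
proof -
  obtain g1 h1 where gh1: "g1 \<in> S (d - m)" "h1 \<in> S (d - 1)"
    "\<And>x. F\<^sub>1 x = q\<^sub>1 (proj b w\<^sub>1 x) * g1 x + \<omega> w\<^sub>1 x * h1 x"
    using admissible_decompose[OF a(1) b(1) md] by blast
  obtain g2 h2 where gh2: "g2 \<in> S (d - m)" "h2 \<in> S (d - 1)"
    "\<And>x. F\<^sub>2 x = q\<^sub>2 (proj b w\<^sub>2 x) * g2 x + \<omega> w\<^sub>2 x * h2 x"
    using admissible_decompose[OF a(2) b(2) md] by blast
  have qS: "q\<^sub>1 \<in> S m" "q\<^sub>2 \<in> S m" using a by (auto simp: admissible_def)
  define v where "v = (\<lambda>t. smul (1 - t) w\<^sub>1 + smul t w\<^sub>2)"
  define q where "q = (\<lambda>t x. (1 - t) * q\<^sub>1 (proj b (v t) x) + t * q\<^sub>2 (proj b (v t) x))"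
  define g where "g = (\<lambda>t x. (1 - t) * g1 x + t * g2 x)"
  define h where "h = (\<lambda>t x. (1 - t) * h1 x + t * h2 x)"
  define F where "F = (\<lambda>t x. q t x * g t x + \<omega> (v t) x * h t x)"
  have v01: "v 0 = w\<^sub>1" "v 1 = w\<^sub>2" by (auto simp: v_def)
  have z0: "q 0 = q\<^sub>1" "F 0 = F\<^sub>1"
    by (auto simp: q_def F_def g_def h_def v01 gh1 inv)
  have z1: "q 1 = q\<^sub>2" "F 1 = F\<^sub>2"
    by (auto simp: q_def F_def g_def h_def v01 gh2 inv)
  have vb: "\<omega> (v t) b = 1" for t using b by (simp add: v_def omega_simps)
  have bv: "\<omega> b (v t) = -1" for t using vb omega_swap[of b "v t"] by simp
  have "(\<lambda>t. \<omega> (v t)) = (\<lambda>t x. (1 - t) * \<omega> w\<^sub>1 x + t * \<omega> w\<^sub>2 x)"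
    by (intro ext) (simp add: v_def omega_simps)
  then have cv: "poly_curve (\<lambda>t. \<omega> (v t))" using poly_curve_linear by simp
  have move: "\<exists>P. degree P \<le> m \<and> (\<forall>t. f (a + smul t c) = poly P t)" if "f \<in> S m" for f a c
    using form_poly[OF that] by metis
  have projt: "proj b (v t) x = (x + smul (\<omega> b x) w\<^sub>1) + smul t (smul (\<omega> b x) (w\<^sub>2 - w\<^sub>1))" for t x
    by (simp add: proj_def v_def algebra_simps)
  have cq: "poly_curve (\<lambda>t x. f (proj b (v t) x))" if "f \<in> S m" for f
    unfolding poly_curve_def projt using move[OF that] by blast
  have ct: "poly_curve (\<lambda>t x. 1 - t)" "poly_curve (\<lambda>t x. t)"
    using poly_curve_linear[of "\<lambda>_. 1" "\<lambda>_. 0"] poly_curve_linear[of "\<lambda>_. 0" "\<lambda>_. 1"] by auto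
  have cQ: "poly_curve q" unfolding q_def by (intro poly_curve_add poly_curve_mult ct cq qS)
  have cF: "poly_curve F" unfolding F_def g_def h_def
    by (intro poly_curve_add[OF poly_curve_mult[OF cQ poly_curve_linear] poly_curve_mult[OF cv poly_curve_linear]])
  obtain A where A: "\<And>t. p\<^sub>1 (\<omega> (v t), q t, F t) = poly A t" using poly_funs_poly_curve[OF p(1) cv cQ cF] by blast
  obtain B where B: "\<And>t. p\<^sub>2 (\<omega> (v t), q t, F t) = poly B t" using poly_funs_poly_curve[OF p(2) cv cQ cF] by blast
  have A0: "A \<noteq> 0" using A[of 0] nz\<^sub>1 z0 v01 by auto
  have B0: "B \<noteq> 0" using B[of 1] nz\<^sub>2 z1 v01 by auto
  obtain x\<^sub>0 where x\<^sub>0: "\<omega> w\<^sub>1 x\<^sub>0 = 0" "q\<^sub>1 x\<^sub>0 \<noteq> 0" using a(1) by (auto simp: admissible_def)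
  \<comment> \<open>The witness for a nonzero cone form has to move with the hyperplane:
    \<open>x t\<close> is the projection of \<open>x\<^sub>0\<close> along \<open>b\<close> onto the
    hyperplane of \<open>v t\<close>.\<close>
  define x where "x = (\<lambda>t. x\<^sub>0 - smul (\<omega> (v t) x\<^sub>0) b)"
  have x0: "x 0 = x\<^sub>0" by (simp add: x_def v01 x\<^sub>0)
  have xh: "\<omega> (v t) (x t) = 0" for t by (simp add: x_def omega_simps vb)
  have "proj b (v t) (x t) = (x\<^sub>0 - smul (\<omega> w\<^sub>1 x\<^sub>0) b + smul (\<omega> b x\<^sub>0) w\<^sub>1)
      + smul t (smul (\<omega> w\<^sub>1 x\<^sub>0 - \<omega> w\<^sub>2 x\<^sub>0) b + smul (\<omega> b x\<^sub>0) (w\<^sub>2 - w\<^sub>1))" for t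
    by (simp add: proj_def x_def v_def omega_simps algebra_simps)
  then have "\<exists>P. \<forall>t. f (proj b (v t) (x t)) = poly P t" if "f \<in> S m" for f
    using move[OF that] by metis
  then obtain P1 P2 where "\<And>t. q\<^sub>1 (proj b (v t) (x t)) = poly P1 t" "\<And>t. q\<^sub>2 (proj b (v t) (x t)) = poly P2 t"
    using qS by metis
  then have C: "q t (x t) = poly ([:1, -1:] * P1 + [:0, 1:] * P2) t" for t by (simp add: q_def left_diff_distrib)
  let ?C = "[:1, -1:] * P1 + [:0, 1:] * P2"
  have "poly ?C 0 \<noteq> 0" using C[of 0] x\<^sub>0 by (simp add: z0 x0)
  then have C0: "?C \<noteq> 0" by (metis poly_0)
  obtain y where y: "F\<^sub>1 y \<noteq> 0" using a(1) by (auto simp: admissible_def fun_eq_iff)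
  obtain E where E: "\<And>t. F t y = poly E t" using cF unfolding poly_curve_def by metis
  have E0: "E \<noteq> 0" using E[of 0] z0 y by auto
  \<comment> \<open>Each factor is nonzero at an end of the curve, \<open>B\<close> at
    \<open>t = 1\<close> and the others at \<open>t = 0\<close>; a value of \<open>t\<close> that is
    a root of none of them meets all open conditions at once.\<close>
  have "A * B * (?C * E) \<noteq> 0" using A0 B0 C0 E0 by simp
  then obtain t where "poly (A * B * (?C * E)) t \<noteq> 0" using poly_all_0_iff_0 by blast
  then have t: "poly A t \<noteq> 0" "poly B t \<noteq> 0" "q t (x t) \<noteq> 0" "F t y \<noteq> 0" using C E by auto
  have qSt: "q t \<in> S m" unfolding q_def by (intro sym_forms_add sym_forms_scale proj_form qS)
  have gSt: "g t \<in> S (d - m)" unfolding g_def by (intro sym_forms_add sym_forms_scale gh1 gh2)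
  have hSt: "h t \<in> S (d - 1)" unfolding h_def by (intro sym_forms_add sym_forms_scale gh1 gh2)
  have FSt: "F t \<in> S d" unfolding F_def
    using sym_forms_add[OF sym_forms_mult[OF qSt gSt], of "\<lambda>x. \<omega> (v t) x * h t x"]
      sym_forms_cons[OF omega_in_dual hSt, of "v t"] md by simp
  have "admissible m d (v t) (q t) (F t)"
    unfolding admissible_def
  proof (intro conjI allI impI)
    show "v t \<noteq> 0" using vb[of t] by (auto simp: omega_zero)
    show "q t \<in> S m" "F t \<in> S d" by fact+
    show "F t \<noteq> 0" using t(4) by auto
    show "q t (x + smul s (v t)) = q t x" for x s by (simp add: q_def proj_invariant[OF vb])
    show "\<exists>x. \<omega> (v t) x = 0 \<and> q t x \<noteq> 0" using xh t by blast
    show "\<exists>g\<in>S (d - m). \<forall>x. \<omega> (v t) x = 0 \<longrightarrow> F t x = q t x * g x"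
      by (rule bexI[OF _ gSt]) (simp add: F_def)
  qed
  then show ?thesis using t A B by metis
qed

text \<open>Normalisation replaces \<open>v\<close> and \<open>q\<close> by other representatives of
  the same bundle point before the curve is drawn. Therefore the hypotheses ask for a polynomial at
  every representative with the given form.\<close>

lemma admissible_irreducible:
  assumes md: "m \<le> d" "m > 0"
    and a: "admissible m d v\<^sub>1 q\<^sub>1 F\<^sub>1" "admissible m d v\<^sub>2 q\<^sub>2 F\<^sub>2"
    and p\<^sub>1: "\<And>v q. admissible m d v q F\<^sub>1 \<Longrightarrow> incidence_of (\<omega> v, q, F\<^sub>1) = incidence_of (\<omega> v\<^sub>1, q\<^sub>1, F\<^sub>1) \<Longrightarrow>
      \<exists>p\<in>poly_funs tscale. p (\<omega> v, q, F\<^sub>1) \<noteq> 0 \<and> (\<forall>v q F. admissible m d v q F \<longrightarrow> p (\<omega> v, q, F) \<noteq> 0 \<longrightarrow> P\<^sub>1 v q F)"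
    and p\<^sub>2: "\<And>v q. admissible m d v q F\<^sub>2 \<Longrightarrow> incidence_of (\<omega> v, q, F\<^sub>2) = incidence_of (\<omega> v\<^sub>2, q\<^sub>2, F\<^sub>2) \<Longrightarrow>
      \<exists>p\<in>poly_funs tscale. p (\<omega> v, q, F\<^sub>2) \<noteq> 0 \<and> (\<forall>v q F. admissible m d v q F \<longrightarrow> p (\<omega> v, q, F) \<noteq> 0 \<longrightarrow> P\<^sub>2 v q F)"
  shows "\<exists>v q F. admissible m d v q F \<and> P\<^sub>1 v q F \<and> P\<^sub>2 v q F"
proof -
  have "v\<^sub>1 \<noteq> 0" "v\<^sub>2 \<noteq> 0" using a by (auto simp: admissible_def)
  then obtain b where b: "\<omega> v\<^sub>1 b \<noteq> 0" "\<omega> v\<^sub>2 b \<noteq> 0" by (rule common_nonvanishing)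
  define w\<^sub>1 where "w\<^sub>1 = smul (1 / \<omega> v\<^sub>1 b) v\<^sub>1"
  define w\<^sub>2 where "w\<^sub>2 = smul (1 / \<omega> v\<^sub>2 b) v\<^sub>2"
  note n1 = admissible_normalize[OF a(1) b(1), folded w\<^sub>1_def]
  note n2 = admissible_normalize[OF a(2) b(2), folded w\<^sub>2_def]
  have pp: "proj b v (proj b v x) = proj b v x" if "\<omega> v b = 1" for v x
    using proj_invariant[OF that, of x "\<omega> b x"] by (simp add: proj_def)
  obtain p1 where p1: "p1 \<in> poly_funs tscale" "p1 (\<omega> w\<^sub>1, \<lambda>x. q\<^sub>1 (proj b w\<^sub>1 x), F\<^sub>1) \<noteq> 0"
    "\<And>v q F. admissible m d v q F \<Longrightarrow> p1 (\<omega> v, q, F) \<noteq> 0 \<Longrightarrow> P\<^sub>1 v q F" using p\<^sub>1[OF n1(1,3)] by blast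
  obtain p2 where p2: "p2 \<in> poly_funs tscale" "p2 (\<omega> w\<^sub>2, \<lambda>x. q\<^sub>2 (proj b w\<^sub>2 x), F\<^sub>2) \<noteq> 0"
    "\<And>v q F. admissible m d v q F \<Longrightarrow> p2 (\<omega> v, q, F) \<noteq> 0 \<Longrightarrow> P\<^sub>2 v q F" using p\<^sub>2[OF n2(1,3)] by blast
  have "\<exists>v q F. admissible m d v q F \<and> p1 (\<omega> v, q, F) \<noteq> 0 \<and> p2 (\<omega> v, q, F) \<noteq> 0"
    by (rule admissible_connect[OF md n1(1) n2(1) n1(2) n2(2) _ _ p1(1) p2(1) p1(2) p2(2)])
      (simp_all add: pp n1(2) n2(2))
  then show ?thesis using p1(3) p2(3) by blast
qed

lemma incidence_variety_irreducible:
  assumes md: "m \<le> d" "m > 0"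
    and U: "openin (topo (incidence_variety smul \<omega> m d)) U\<^sub>1" "openin (topo (incidence_variety smul \<omega> m d)) U\<^sub>2"
      "U\<^sub>1 \<noteq> {}" "U\<^sub>2 \<noteq> {}"
  shows "U\<^sub>1 \<inter> U\<^sub>2 \<noteq> {}"
proof -
  let ?Z = "incidence_coords smul \<omega> m d"
  have zin: "(\<omega> v, q, F) \<in> ?Z" if "admissible m d v q F" for v q F
    using that unfolding incidence_coords_iff by blast
  have pt: "\<exists>v q F. admissible m d v q F \<and> incidence_of (\<omega> v, q, F) \<in> U"
    if U: "openin (topo (incidence_variety smul \<omega> m d)) U" "U \<noteq> {}" for U
  proof -
    have "U \<subseteq> incidence_of ` ?Z"
      using U(1) unfolding incidence_variety_def openin_quotient points_affine by auto
    then obtain z where z: "z \<in> ?Z" "incidence_of z \<in> U" using U(2) by blast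
    then show ?thesis unfolding incidence_coords_iff by blast
  qed
  have nb: "\<exists>p\<in>poly_funs tscale. p (\<omega> v, q, F) \<noteq> 0 \<and>
      (\<forall>v q F. admissible m d v q F \<longrightarrow> p (\<omega> v, q, F) \<noteq> 0 \<longrightarrow> incidence_of (\<omega> v, q, F) \<in> U)"
    if U: "openin (topo (incidence_variety smul \<omega> m d)) U"
      and a: "admissible m d v q F" "incidence_of (\<omega> v, q, F) \<in> U" for U v q F
  proof -
    have "openin (topo (affine_funspace tscale ?Z)) {z \<in> ?Z. incidence_of z \<in> U}"
      using U unfolding incidence_variety_def openin_quotient points_affine by auto
    then obtain p where "p \<in> poly_funs tscale" "p (\<omega> v, q, F) \<noteq> 0" "\<forall>z\<in>?Z. p z \<noteq> 0 \<longrightarrow> incidence_of z \<in> U"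
      unfolding openin_affine using a(2) zin[OF a(1)] by blast
    then show ?thesis using zin by blast
  qed
  obtain v\<^sub>1 q\<^sub>1 F\<^sub>1 where 1: "admissible m d v\<^sub>1 q\<^sub>1 F\<^sub>1" "incidence_of (\<omega> v\<^sub>1, q\<^sub>1, F\<^sub>1) \<in> U\<^sub>1" using pt[OF U(1,3)] by blast
  obtain v\<^sub>2 q\<^sub>2 F\<^sub>2 where 2: "admissible m d v\<^sub>2 q\<^sub>2 F\<^sub>2" "incidence_of (\<omega> v\<^sub>2, q\<^sub>2, F\<^sub>2) \<in> U\<^sub>2" using pt[OF U(2,4)] by blast
  have "\<exists>v q F. admissible m d v q F \<and> incidence_of (\<omega> v, q, F) \<in> U\<^sub>1 \<and> incidence_of (\<omega> v, q, F) \<in> U\<^sub>2"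
    by (rule admissible_irreducible[OF md 1(1) 2(1)]) (use nb[OF U(1)] nb[OF U(2)] 1(2) 2(2) in metis)+
  then show ?thesis by blast
qed

end

section \<open>Rings of functions\<close>

text \<open>A common frame for the polynomials in \<open>F\<close>, those in \<open>v\<close> and
  \<open>F\<close>, and those in \<open>v\<close> alone, which makes closure under sums, products
  and determinants a single argument.\<close>

definition function_ring :: "('a \<Rightarrow> complex) set \<Rightarrow> bool" where
  "function_ring R \<longleftrightarrow> (\<forall>c. (\<lambda>_. c) \<in> R) \<and>
    (\<forall>f\<in>R. \<forall>g\<in>R. (\<lambda>x. f x + g x) \<in> R \<and> (\<lambda>x. f x * g x) \<in> R)"

lemma function_ring_const: "function_ring R \<Longrightarrow> (\<lambda>_. c) \<in> R"
  and function_ring_add: "function_ring R \<Longrightarrow> f \<in> R \<Longrightarrow> g \<in> R \<Longrightarrow> (\<lambda>x. f x + g x) \<in> R"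
  and function_ring_mult: "function_ring R \<Longrightarrow> f \<in> R \<Longrightarrow> g \<in> R \<Longrightarrow> (\<lambda>x. f x * g x) \<in> R"
  unfolding function_ring_def by blast+

lemma function_ring_poly_funs: "function_ring (poly_funs s)"
  unfolding function_ring_def by (simp add: poly_funs.const poly_funs.add poly_funs.mult)

lemma function_ring_sum:
  assumes R: "function_ring R" and "finite I" and "\<And>i. i \<in> I \<Longrightarrow> f i \<in> R"
  shows "(\<lambda>x. \<Sum>i\<in>I. f i x) \<in> R"
  using assms(2,3)
proof (induction rule: finite_induct)
  case empty show ?case using function_ring_const[OF R, of 0] by simp
next
  case (insert i I)
  then have "(\<lambda>x. f i x + (\<Sum>i\<in>I. f i x)) \<in> R" by (intro function_ring_add[OF R]) auto
  then show ?case using insert by simp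
qed

lemma function_ring_prod:
  assumes R: "function_ring R" and "finite I" and "\<And>i. i \<in> I \<Longrightarrow> f i \<in> R"
  shows "(\<lambda>x. \<Prod>i\<in>I. f i x) \<in> R"
  using assms(2,3)
proof (induction rule: finite_induct)
  case empty show ?case using function_ring_const[OF R, of 1] by simp
next
  case (insert i I)
  then have "(\<lambda>x. f i x * (\<Prod>i\<in>I. f i x)) \<in> R" by (intro function_ring_mult[OF R]) auto
  then show ?case using insert by simp
qed

lemma function_ring_power:
  assumes R: "function_ring R" and "f \<in> R" shows "(\<lambda>x. f x ^ k) \<in> R"
  using function_ring_prod[OF R, of "{..<k}" "\<lambda>_. f"] assms(2) by simp

lemma function_ring_det:
  assumes R: "function_ring R" and a: "\<And>i j. i < n \<Longrightarrow> j < n \<Longrightarrow> (\<lambda>x. a x i j) \<in> R"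
  shows "(\<lambda>x. Determinant.det (Matrix.mat n n (\<lambda>(i, j). a x i j))) \<in> R"
proof -
  have eq: "Determinant.det (Matrix.mat n n (\<lambda>(i, j). a x i j)) =
    (\<Sum>p | p permutes {0..<n}. of_int (sign p) * (\<Prod>i = 0..<n. a x i (p i)))" for x
  proof -
    have "p i < n" if "p permutes {0..<n}" "i < n" for p i using permutes_in_image[OF that(1), of i] that(2) by simp
    then show ?thesis unfolding Determinant.det_def by (auto intro!: sum.cong prod.cong)
  qed
  show ?thesis unfolding eq
  proof (intro function_ring_sum[OF R] function_ring_mult[OF R] function_ring_const[OF R] function_ring_prod[OF R])
    show "finite {p. p permutes {0..<n}}" by (rule finite_permutations) simp
    fix p i assume "p \<in> {p. p permutes {0..<n}}" "i \<in> {0..<n}"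
    then have "p i \<in> {0..<n}" using permutes_in_image[of p "{0..<n}" i] by simp
    then show "(\<lambda>x. a x i (p i)) \<in> R" using \<open>i \<in> {0..<n}\<close> by (auto intro: a)
  qed simp
qed

lemma mat_delete_mat:
  fixes n :: nat
  assumes "k < n" "l < n"
  shows "mat_delete (Matrix.mat n n f) k l = Matrix.mat (n - 1) (n - 1)
    (\<lambda>(i, j). f (if i < k then i else Suc i, if j < l then j else Suc j))"
  using assms by (auto simp: mat_delete_def intro!: eq_matI)

text \<open>Multiplying by the adjugate instead of inverting keeps the solution polynomial, and the
  identity holds even where \<open>D\<close> vanishes. At \<open>x\<^sub>0\<close> the matrix is the
  identity, whence \<open>D x\<^sub>0 = 1\<close>.\<close>

lemma function_ring_cramer:
  fixes n :: nat
  assumes R: "function_ring R" and a: "\<And>i j. i < n \<Longrightarrow> j < n \<Longrightarrow> (\<lambda>x. a x i j) \<in> R"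
    and x\<^sub>0: "\<And>i j. i < n \<Longrightarrow> j < n \<Longrightarrow> a x\<^sub>0 i j = (if i = j then 1 else 0)"
  obtains D M where "D \<in> R" "\<And>i j. i < n \<Longrightarrow> j < n \<Longrightarrow> (\<lambda>x. M x i j) \<in> R" "D x\<^sub>0 = 1"
    "\<And>x z b i. (\<And>i. i < n \<Longrightarrow> (\<Sum>j<n. a x i j * z j) = b i) \<Longrightarrow> i < n \<Longrightarrow> D x * z i = (\<Sum>j<n. M x i j * b j)"
proof -
  define A where "A = (\<lambda>x. Matrix.mat n n (\<lambda>(i, j). a x i j))"
  define D where "D = (\<lambda>x. Determinant.det (A x))"
  define M where "M = (\<lambda>x i j. adj_mat (A x) $$ (i, j))"
  have A: "A x \<in> carrier_mat n n" for x by (simp add: A_def)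
  show ?thesis
  proof (rule that[of D M])
    show "D \<in> R" unfolding D_def A_def by (rule function_ring_det[OF R a])
    have "A x\<^sub>0 = 1\<^sub>m n" by (rule eq_matI) (auto simp: A_def x\<^sub>0)
    then show "D x\<^sub>0 = 1" by (simp add: D_def)
    fix i j assume ij: "i < n" "j < n"
    have eq: "M x i j = (-1) ^ (j + i) * Determinant.det (Matrix.mat (n - 1) (n - 1)
      (\<lambda>(i', j'). a x (if i' < j then i' else Suc i') (if j' < i then j' else Suc j')))" for x
      using ij A[of x] by (simp add: M_def adj_mat_def cofactor_def A_def mat_delete_mat)
    show "(\<lambda>x. M x i j) \<in> R" unfolding eq
      by (intro function_ring_mult[OF R] function_ring_const[OF R] function_ring_det[OF R] a) auto
  next
    fix x z b i assume eqs: "\<And>i. i < n \<Longrightarrow> (\<Sum>j<n. a x i j * z j) = b i" and i: "i < n"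
    have "A x *\<^sub>v Matrix.vec n z = Matrix.vec n b"
      by (rule eq_vecI) (auto simp: A_def scalar_prod_def eqs[symmetric] atLeast0LessThan)
    then have "adj_mat (A x) *\<^sub>v (A x *\<^sub>v Matrix.vec n z) = adj_mat (A x) *\<^sub>v Matrix.vec n b" by simp
    moreover have "adj_mat (A x) *\<^sub>v (A x *\<^sub>v Matrix.vec n z) = (adj_mat (A x) * A x) *\<^sub>v Matrix.vec n z"
      using A[of x] adj_mat(1)[OF A[of x]] by (simp add: assoc_mult_mat_vec[where n\<^sub>3=n])
    moreover have "(adj_mat (A x) * A x) *\<^sub>v Matrix.vec n z = D x \<cdot>\<^sub>v Matrix.vec n z"
    proof (rule eq_vecI)
      fix i assume "i < dim_vec (D x \<cdot>\<^sub>v Matrix.vec n z)"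
      then have i: "i < n" by simp
      have "(\<Sum>j = 0..<n. D x * (if i = j then 1 else 0) * z j) = (\<Sum>j = 0..<n. if j = i then D x * z i else 0)"
        by (rule sum.cong) auto
      moreover have "vec_index (adj_mat (A x) * A x *\<^sub>v Matrix.vec n z) i = (\<Sum>j = 0..<n. D x * (if i = j then 1 else 0) * z j)"
        unfolding adj_mat(3)[OF A] using i by (auto simp: scalar_prod_def D_def intro!: sum.cong)
      ultimately show "vec_index (adj_mat (A x) * A x *\<^sub>v Matrix.vec n z) i = vec_index (D x \<cdot>\<^sub>v Matrix.vec n z) i"
        using i by simp
    qed (simp add: adj_mat(3)[OF A])
    ultimately have "vec_index (D x \<cdot>\<^sub>v Matrix.vec n z) i = vec_index (adj_mat (A x) *\<^sub>v Matrix.vec n b) i" by simp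
    then show "D x * z i = (\<Sum>j<n. M x i j * b j)"
      using i adj_mat(1)[OF A[of x]] by (simp add: M_def scalar_prod_def atLeast0LessThan)
  qed
qed

lemma det_eq_0_if_kernel:
  fixes n :: nat
  assumes z: "\<And>i. i < n \<Longrightarrow> (\<Sum>j<n. a i j * z j) = 0" "j < n" "z j \<noteq> (0::complex)"
  shows "Determinant.det (Matrix.mat n n (\<lambda>(i, j). a i j)) = 0"
proof -
  let ?A = "Matrix.mat n n (\<lambda>(i, j). a i j)"
  have "?A *\<^sub>v Matrix.vec n z = 0\<^sub>v n"
    by (rule eq_vecI) (auto simp: scalar_prod_def z(1) atLeast0LessThan)
  moreover have "Matrix.vec n z \<noteq> 0\<^sub>v n"
  proof
    assume "Matrix.vec n z = 0\<^sub>v n"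
    then have "vec_index (Matrix.vec n z) j = vec_index (0\<^sub>v n) j" by simp
    then show False using z(2,3) by simp
  qed
  ultimately show ?thesis
    using det_0_iff_vec_prod_zero[of ?A n] by (auto intro!: exI[of _ "Matrix.vec n z"])
qed

section \<open>Coefficients by interpolation\<close>

definition lagrange :: "nat \<Rightarrow> nat \<Rightarrow> complex poly" where
  "lagrange n i = (\<Prod>k\<in>{..n} - {i}. Polynomial.smult (1 / (of_nat i - of_nat k)) [:- of_nat k, 1:])"

text \<open>Interpolation at \<open>0, ..., n\<close> makes a coefficient a fixed linear combination
  of values. It therefore depends polynomially on whatever parameters the values depend on
  polynomially, without any formal polynomials in those parameters.\<close>

definition coefd :: "nat \<Rightarrow> nat \<Rightarrow> (complex \<Rightarrow> complex) \<Rightarrow> complex" where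
  "coefd n j g = (\<Sum>i\<le>n. coeff (lagrange n i) j * g (of_nat i))"

lemma coefd_eq:
  assumes p: "degree p \<le> n" "\<And>t. g t = poly p t" shows "coefd n j g = coeff p j"
proof -
  have deg: "degree (lagrange n i) \<le> n" if "i \<le> n" for i
  proof -
    have "degree (lagrange n i) \<le> (\<Sum>k\<in>{..n} - {i}. degree (Polynomial.smult (1 / (of_nat i - of_nat k)) [:- of_nat k, 1::complex:]))"
      unfolding lagrange_def by (rule degree_prod_sum_le[unfolded o_def]) simp
    also have "\<dots> \<le> (\<Sum>k\<in>{..n} - {i}. 1)" by (intro sum_mono) (simp add: degree_smult_le)
    finally show ?thesis using that by simp
  qed
  have val: "poly (lagrange n i) (of_nat k) = (if i = k then 1 else 0)" if "i \<le> n" "k \<le> n" for i k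
  proof (cases "i = k")
    case True
    then show ?thesis by (auto simp: lagrange_def poly_prod diff_divide_distrib[symmetric] intro!: prod.neutral)
  next
    case False
    then show ?thesis using that by (auto simp: lagrange_def poly_prod intro!: prod_zero)
  qed
  have "p = (\<Sum>i\<le>n. Polynomial.smult (poly p (of_nat i)) (lagrange n i))" (is "_ = ?q")
  proof (rule poly_eqI_degree[of "of_nat ` {..n}"])
    fix x :: complex assume "x \<in> of_nat ` {..n}"
    then obtain k where k: "k \<le> n" "x = of_nat k" by auto
    have "poly ?q x = (\<Sum>i\<le>n. poly p (of_nat i) * (if i = k then 1 else 0))"
      unfolding poly_sum k(2) by (intro sum.cong) (auto simp: val k)
    also have "\<dots> = poly p x" using k by (simp add: if_distrib cong: if_cong)
    finally show "poly p x = poly ?q x" by simp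
  next
    have c: "card (of_nat ` {..n} :: complex set) = Suc n"
      by (subst card_image) (auto intro: inj_onI)
    show "degree p < card (of_nat ` {..n} :: complex set)" using p(1) c by simp
    have "degree ?q \<le> n"
      by (rule degree_sum_le, simp, rule order_trans[OF degree_smult_le deg], simp)
    then show "degree ?q < card (of_nat ` {..n} :: complex set)" using c by simp
  qed
  then have "coeff p j = (\<Sum>i\<le>n. poly p (of_nat i) * coeff (lagrange n i) j)"
    by (metis (no_types, lifting) coeff_sum coeff_smult sum.cong)
  then show ?thesis by (simp add: coefd_def p(2) mult.commute)
qed

section \<open>Monomials\<close>

type_synonym exps = "nat \<times> nat \<times> nat \<times> nat"

definition mdeg :: "exps \<Rightarrow> nat" where "mdeg = (\<lambda>(a, b, c, d). a + b + c + d)"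

definition Exp :: "nat \<Rightarrow> exps set" where "Exp k = {\<beta>. mdeg \<beta> = k}"

lemma finite_Exp: "finite (Exp k)"
proof -
  have "Exp k \<subseteq> {..k} \<times> {..k} \<times> {..k} \<times> {..k}" by (auto simp: Exp_def mdeg_def)
  then show ?thesis by (rule finite_subset) auto
qed

context symplectic_basis
begin

definition mon :: "exps \<Rightarrow> 'v \<Rightarrow> complex" where
  "mon = (\<lambda>(a, b, c, d) x. X0 x ^ a * X1 x ^ b * X2 x ^ c * X3 x ^ d)"

lemma mon_add: "mon (\<beta> + \<gamma>) x = mon \<beta> x * mon \<gamma> x"
  by (cases \<beta>; cases \<gamma>) (simp add: mon_def power_add mult_ac)

lemma mon_smul: "mon \<beta> (smul t x) = t ^ mdeg \<beta> * mon \<beta> x"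
  by (cases \<beta>) (simp add: mon_def mdeg_def power_add power_mult_distrib mult_ac)

text \<open>In the four coordinates the sum is a polynomial in the first with coefficients
  polynomial in the second, and so on, so the one-variable statement applies four times. Extending
  by zero to a full box of exponents gives the nested shape.\<close>

lemma mon_independent:
  assumes A: "finite A" and 0: "\<And>x. (\<Sum>\<beta>\<in>A. c \<beta> * mon \<beta> x) = 0" and "\<beta> \<in> A"
  shows "c \<beta> = 0"
proof -
  define c' where "c' = (\<lambda>\<beta>. if \<beta> \<in> A then c \<beta> else 0)"
  define N where "N = Max (mdeg ` A)"
  have N: "mdeg \<beta> \<le> N" if "\<beta> \<in> A" for \<beta> using that A by (simp add: N_def)
  let ?B = "{..N} \<times> {..N} \<times> {..N} \<times> {..N}"
  have AB: "A \<subseteq> ?B"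
  proof
    fix \<beta> assume "\<beta> \<in> A"
    from N[OF this] show "\<beta> \<in> ?B" by (auto simp: mdeg_def split: prod.splits)
  qed
  have "(\<Sum>i\<le>N. x ^ i * (\<Sum>j\<le>N. y ^ j * (\<Sum>k\<le>N. z ^ k * (\<Sum>l\<le>N. w ^ l * c' (i, j, k, l))))) = 0" for x y z w
  proof -
    have "(\<Sum>i\<le>N. x ^ i * (\<Sum>j\<le>N. y ^ j * (\<Sum>k\<le>N. z ^ k * (\<Sum>l\<le>N. w ^ l * c' (i, j, k, l))))) =
      (\<Sum>i\<le>N. \<Sum>j\<le>N. \<Sum>k\<le>N. \<Sum>l\<le>N. c' (i, j, k, l) * mon (i, j, k, l) (vec x y z w))"
      by (simp add: sum_distrib_left mon_def mult_ac)
    also have "\<dots> = (\<Sum>\<beta>\<in>?B. c' \<beta> * mon \<beta> (vec x y z w))"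
      by (simp add: sum.cartesian_product split_def)
    also have "\<dots> = (\<Sum>\<beta>\<in>A. c' \<beta> * mon \<beta> (vec x y z w))"
      by (rule sum.mono_neutral_right) (use AB in \<open>auto simp: c'_def\<close>)
    also have "\<dots> = (\<Sum>\<beta>\<in>A. c \<beta> * mon \<beta> (vec x y z w))" by (rule sum.cong) (auto simp: c'_def)
    finally show ?thesis using 0 by simp
  qed
  note z1 = sum_powers_eq_0[OF this]
  note z2 = sum_powers_eq_0[OF z1]
  note z3 = sum_powers_eq_0[OF z2]
  note z4 = sum_powers_eq_0[OF z3]
  obtain i j k l where \<beta>: "\<beta> = (i, j, k, l)" by (cases \<beta>)
  have "i \<le> N" "j \<le> N" "k \<le> N" "l \<le> N" using AB assms(3) \<beta> by auto
  then have "c' (i, j, k, l) = 0" by (intro z4)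
  then show ?thesis using assms(3) by (simp add: c'_def \<beta>)
qed

lemma mon_inj: "mon \<beta> = mon \<gamma> \<Longrightarrow> \<beta> = \<gamma>"
proof (rule ccontr)
  assume eq: "mon \<beta> = mon \<gamma>" and ne: "\<beta> \<noteq> \<gamma>"
  have "(if \<beta> = \<beta> then 1 else - 1 :: complex) = 0"
    by (rule mon_independent[of "{\<beta>, \<gamma>}" "\<lambda>\<delta>. if \<delta> = \<beta> then 1 else - 1"]) (use eq ne in auto)
  then show False by simp
qed

lemma form_in_span_mon: "f \<in> S k \<Longrightarrow> f \<in> fs.span (mon ` Exp k)"
proof (induction rule: sym_forms_induct)
  case (zero k) show ?case using fs.span_zero by (simp add: zero_fun_def)
next
  case (add k f g) then show ?case using fs.span_add[OF add.IH] by (simp add: plus_fun_def)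
next
  case (scale k c f) then show ?case using fs.span_scale[OF scale.IH, of c] unfolding fscale_def[of c f] by simp
next
  case one
  have "mon (0, 0, 0, 0) = (\<lambda>_. 1)" by (auto simp: mon_def)
  then show ?case by (intro fs.span_base) (auto simp: Exp_def mdeg_def image_iff)
next
  case (mult k w f)
  have step: "(\<lambda>x. mon \<delta> x * f x) \<in> fs.span (mon ` Exp (Suc k))" if "mdeg \<delta> = 1" for \<delta>
    using mult.IH
  proof (induction rule: fs.span_induct_alt)
    case base show ?case using fs.span_zero by (simp add: zero_fun_def)
  next
    case (step c g h)
    then obtain \<gamma> where \<gamma>: "\<gamma> \<in> Exp k" "g = mon \<gamma>" by blast
    have "\<delta> + \<gamma> \<in> Exp (Suc k)" using \<gamma>(1) that by (auto simp: Exp_def mdeg_def split: prod.splits)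
    then have "fscale c (mon (\<delta> + \<gamma>)) + (\<lambda>x. mon \<delta> x * h x) \<in> fs.span (mon ` Exp (Suc k))"
      by (intro fs.span_add[OF fs.span_scale[OF fs.span_base] step(2)] imageI)
    moreover have "fscale c (mon (\<delta> + \<gamma>)) + (\<lambda>x. mon \<delta> x * h x) = (\<lambda>x. mon \<delta> x * (fscale c g + h) x)"
      by (auto simp: fscale_def mon_add \<gamma> algebra_simps)
    ultimately show ?case by simp
  qed
  have "(\<lambda>x. w x * f x) = fscale (w e\<^sub>1) (\<lambda>x. mon (1, 0, 0, 0) x * f x) + fscale (w f\<^sub>1) (\<lambda>x. mon (0, 1, 0, 0) x * f x)
      + fscale (w e\<^sub>2) (\<lambda>x. mon (0, 0, 1, 0) x * f x) + fscale (w f\<^sub>2) (\<lambda>x. mon (0, 0, 0, 1) x * f x)"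
  proof
    fix x show "w x * f x = (fscale (w e\<^sub>1) (\<lambda>x. mon (1, 0, 0, 0) x * f x) + fscale (w f\<^sub>1) (\<lambda>x. mon (0, 1, 0, 0) x * f x)
      + fscale (w e\<^sub>2) (\<lambda>x. mon (0, 0, 1, 0) x * f x) + fscale (w f\<^sub>2) (\<lambda>x. mon (0, 0, 0, 1) x * f x)) x"
      unfolding dual_coord[OF mult(1), of x] by (simp add: fscale_def mon_def algebra_simps)
  qed
  moreover have "\<dots> \<in> fs.span (mon ` Exp (Suc k))"
    by (intro fs.span_add fs.span_scale step) (auto simp: mdeg_def)
  ultimately show ?case by simp
qed

text \<open>\<open>poly_funs\<close> is generated by functionals that are linear on all functions,
  so a coefficient, prescribed on the independent monomials only, has to be extended.\<close>

lemma coefficient_functional_exists: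
  "\<exists>\<phi>. Vector_Spaces.linear fscale (*) \<phi> \<and> (\<forall>\<gamma>\<in>Exp k. \<phi> (mon \<gamma>) = (if \<gamma> = \<beta> then 1 else 0 :: complex))"
proof -
  have "fs.independent (mon ` Exp k)"
  proof (rule fs.independent_if_scalars_zero)
    show "finite (mon ` Exp k)" using finite_Exp by simp
    fix f x assume 0: "(\<Sum>x\<in>mon ` Exp k. fscale (f x) x) = 0" and "x \<in> mon ` Exp k"
    then obtain \<beta> where \<beta>: "\<beta> \<in> Exp k" "x = mon \<beta>" by blast
    have "(\<Sum>\<beta>\<in>Exp k. f (mon \<beta>) * mon \<beta> y) = (\<Sum>x\<in>mon ` Exp k. fscale (f x) x) y" for y
      by (subst sum.reindex) (auto intro: inj_onI dest: mon_inj simp: sum_fun_apply fscale_def)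
    then have "(\<Sum>\<beta>\<in>Exp k. f (mon \<beta>) * mon \<beta> y) = 0" for y using 0 by simp
    from mon_independent[OF finite_Exp this \<beta>(1)] show "f x = 0" by (simp add: \<beta>)
  qed
  moreover have "vector_space_pair (fscale :: complex \<Rightarrow> ('v \<Rightarrow> complex) \<Rightarrow> _) ((*) :: complex \<Rightarrow> complex \<Rightarrow> complex)"
    by unfold_locales (auto simp: algebra_simps)
  ultimately obtain \<phi> where \<phi>: "Vector_Spaces.linear fscale (*) \<phi>"
    "\<forall>x\<in>mon ` Exp k. \<phi> x = (if x = mon \<beta> then 1 else 0 :: complex)"
    using vector_space_pair.linear_independent_extend[of fscale "(*)" "mon ` Exp k" "\<lambda>x. if x = mon \<beta> then 1 else 0"] by blast
  have "\<forall>\<gamma>\<in>Exp k. \<phi> (mon \<gamma>) = (if \<gamma> = \<beta> then 1 else 0)" using \<phi>(2) by (auto dest: mon_inj)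
  then show ?thesis using \<phi>(1) by blast
qed

definition cf :: "nat \<Rightarrow> exps \<Rightarrow> ('v \<Rightarrow> complex) \<Rightarrow> complex" where
  "cf k \<beta> = (SOME \<phi>. Vector_Spaces.linear fscale (*) \<phi> \<and> (\<forall>\<gamma>\<in>Exp k. \<phi> (mon \<gamma>) = (if \<gamma> = \<beta> then 1 else 0)))"

lemma cf: "Vector_Spaces.linear fscale (*) (cf k \<beta>)" "\<gamma> \<in> Exp k \<Longrightarrow> cf k \<beta> (mon \<gamma>) = (if \<gamma> = \<beta> then 1 else 0)"
  using someI_ex[OF coefficient_functional_exists[of k \<beta>]] unfolding cf_def by auto

lemma form_expand: "F \<in> S k \<Longrightarrow> F x = (\<Sum>\<beta>\<in>Exp k. cf k \<beta> F * mon \<beta> x)"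
proof -
  assume "F \<in> S k"
  then have "F \<in> fs.span (mon ` Exp k)" by (rule form_in_span_mon)
  then show ?thesis
  proof (induction rule: fs.span_induct_alt)
    case base
    have "cf k \<beta> (\<lambda>_. 0) = 0" for \<beta>
      using linear_functional_scale[OF cf(1), of k \<beta> 0 "\<lambda>_. 0"] by (simp add: fscale_def)
    then show ?case by (simp add: zero_fun_def)
  next
    case (step c g h)
    then obtain \<gamma> where \<gamma>: "\<gamma> \<in> Exp k" "g = mon \<gamma>" by blast
    have "cf k \<beta> (fscale c g + h) = (if \<beta> = \<gamma> then c else 0) + cf k \<beta> h" for \<beta>
      using \<gamma> by (simp add: linear_functional_add[OF cf(1)] linear_functional_scale[OF cf(1)] cf(2))
    then have "(\<Sum>\<beta>\<in>Exp k. cf k \<beta> (fscale c g + h) * mon \<beta> x) =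
      (\<Sum>\<beta>\<in>Exp k. (if \<beta> = \<gamma> then c * mon \<gamma> x else 0)) + (\<Sum>\<beta>\<in>Exp k. cf k \<beta> h * mon \<beta> x)"
      unfolding sum.distrib[symmetric] by (intro sum.cong) (auto simp: distrib_right)
    moreover have "(\<Sum>\<beta>\<in>Exp k. (if \<beta> = \<gamma> then c * mon \<gamma> x else 0)) = c * mon \<gamma> x"
      using \<gamma> finite_Exp by simp
    moreover have "(fscale c g + h) x = c * mon \<gamma> x + h x" by (simp add: fscale_def \<gamma>)
    ultimately show ?case using step(2) by metis
  qed
qed

section \<open>Polynomials in a vector and a form\<close>

text \<open>The generators are already products of a polynomial in the form and a monomial in the
  vector. This normal form gives the expansion in monomials of \<open>v\<close> with coefficients
  polynomial in \<open>F\<close>, from which the linear system for Cramer's rule is read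
  off.\<close>

inductive_set bip :: "('v \<times> ('v \<Rightarrow> complex) \<Rightarrow> complex) set" where
  base: "p \<in> poly_funs fscale \<Longrightarrow> (\<lambda>z. p (snd z) * mon \<beta> (fst z)) \<in> bip"
| add: "E \<in> bip \<Longrightarrow> E' \<in> bip \<Longrightarrow> (\<lambda>z. E z + E' z) \<in> bip"

lemma bip_mult: "E \<in> bip \<Longrightarrow> E' \<in> bip \<Longrightarrow> (\<lambda>z. E z * E' z) \<in> bip"
proof (induction arbitrary: E' rule: bip.induct)
  case (base p \<beta>)
  show ?case using base.prems
  proof (induction rule: bip.induct)
    case (base q \<gamma>)
    have "(\<lambda>z. (\<lambda>F. p F * q F) (snd z) * mon (\<beta> + \<gamma>) (fst z)) \<in> bip"
      by (rule bip.base) (rule poly_funs.mult[OF \<open>p \<in> poly_funs fscale\<close> base])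
    then show ?case by (simp add: mon_add mult_ac)
  next
    case (add E E')
    have "(\<lambda>z. p (snd z) * mon \<beta> (fst z) * E z + p (snd z) * mon \<beta> (fst z) * E' z) \<in> bip"
      by (rule bip.add[OF add.IH])
    then show ?case by (simp only: distrib_left)
  qed
next
  case (add E1 E2)
  have "(\<lambda>z. E1 z * E' z + E2 z * E' z) \<in> bip" by (rule bip.add[OF add.IH(1)[OF add.prems] add.IH(2)[OF add.prems]])
  then show ?case by (simp only: distrib_right)
qed

lemma bip_form: "p \<in> poly_funs fscale \<Longrightarrow> (\<lambda>z. p (snd z)) \<in> bip"
  using bip.base[of p "(0, 0, 0, 0)"] by (simp add: mon_def)

lemma bip_mon: "(\<lambda>z. mon \<beta> (fst z)) \<in> bip"
  using bip.base[OF poly_funs.const[of 1], of \<beta>] by simp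

lemma function_ring_bip: "function_ring bip"
  unfolding function_ring_def using bip.add bip_mult bip_form[OF poly_funs.const] by auto

lemma bip_coord: "(\<lambda>z. X0 (fst z)) \<in> bip" "(\<lambda>z. X1 (fst z)) \<in> bip" "(\<lambda>z. X2 (fst z)) \<in> bip" "(\<lambda>z. X3 (fst z)) \<in> bip"
  using bip_mon[of "(1, 0, 0, 0)"] bip_mon[of "(0, 1, 0, 0)"] bip_mon[of "(0, 0, 1, 0)"] bip_mon[of "(0, 0, 0, 1)"]
  by (simp_all add: mon_def)

lemma bip_expand:
  assumes "E \<in> bip"
  obtains A c where "finite A" "\<And>\<beta>. c \<beta> \<in> poly_funs fscale" "\<And>\<beta> F. \<beta> \<notin> A \<Longrightarrow> c \<beta> F = 0"
    "\<And>v F. E (v, F) = (\<Sum>\<beta>\<in>A. c \<beta> F * mon \<beta> v)"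
proof -
  have "\<exists>A c. finite A \<and> (\<forall>\<beta>. c \<beta> \<in> poly_funs fscale) \<and> (\<forall>\<beta> F. \<beta> \<notin> A \<longrightarrow> c \<beta> F = 0) \<and>
    (\<forall>v F. E (v, F) = (\<Sum>\<beta>\<in>A. c \<beta> F * mon \<beta> v))"
    using assms
  proof (induction rule: bip.induct)
    case (base p \<beta>)
    show ?case
      by (rule exI[of _ "{\<beta>}"], rule exI[of _ "\<lambda>\<gamma>. if \<gamma> = \<beta> then p else (\<lambda>_. 0)"])
        (use base in \<open>auto simp: poly_funs.const\<close>)
  next
    case (add E E')
    obtain A c where A: "finite A" "\<And>\<beta>. c \<beta> \<in> poly_funs fscale" "\<And>\<beta> F. \<beta> \<notin> A \<Longrightarrow> c \<beta> F = 0"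
      "\<And>v F. E (v, F) = (\<Sum>\<beta>\<in>A. c \<beta> F * mon \<beta> v)" using add.IH(1) by blast
    obtain A' c' where A': "finite A'" "\<And>\<beta>. c' \<beta> \<in> poly_funs fscale" "\<And>\<beta> F. \<beta> \<notin> A' \<Longrightarrow> c' \<beta> F = 0"
      "\<And>v F. E' (v, F) = (\<Sum>\<beta>\<in>A'. c' \<beta> F * mon \<beta> v)" using add.IH(2) by blast
    have "(\<Sum>\<beta>\<in>A. c \<beta> F * mon \<beta> v) = (\<Sum>\<beta>\<in>A \<union> A'. c \<beta> F * mon \<beta> v)" for v F
      by (rule sum.mono_neutral_left) (use A A' in auto)
    moreover have "(\<Sum>\<beta>\<in>A'. c' \<beta> F * mon \<beta> v) = (\<Sum>\<beta>\<in>A \<union> A'. c' \<beta> F * mon \<beta> v)" for v F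
      by (rule sum.mono_neutral_left) (use A A' in auto)
    ultimately show ?case
      by (intro exI[of _ "A \<union> A'"] exI[of _ "\<lambda>\<beta> F. c \<beta> F + c' \<beta> F"])
        (use A A' in \<open>simp add: poly_funs.add distrib_right sum.distrib\<close>)
  qed
  then show ?thesis using that by blast
qed

lemma bip_compose:
  assumes "E \<in> bip" "function_ring R"
    and "(\<lambda>e. X0 (a e)) \<in> R" "(\<lambda>e. X1 (a e)) \<in> R" "(\<lambda>e. X2 (a e)) \<in> R" "(\<lambda>e. X3 (a e)) \<in> R"
    and b: "\<And>p. p \<in> poly_funs fscale \<Longrightarrow> (\<lambda>e. p (b e)) \<in> R"
  shows "(\<lambda>e. E (a e, b e)) \<in> R"
  using assms(1)
proof (induction rule: bip.induct)
  case (base p \<beta>)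
  obtain i j k l where \<beta>: "\<beta> = (i, j, k, l)" by (cases \<beta>)
  have "(\<lambda>e. mon \<beta> (a e)) \<in> R"
    unfolding \<beta> mon_def prod.case using assms
    by (intro function_ring_mult[OF assms(2)] function_ring_power[OF assms(2)])
  then show ?case using function_ring_mult[OF assms(2) b[OF base]] by simp
next
  case (add E E') then show ?case using function_ring_add[OF assms(2) add.IH] by simp
qed

text \<open>
  The coordinates of a form are linear functionals on forms, extended to all functions;
  \<open>formeval d F\<close> is the form with these coordinates, so that it depends polynomially on \<open>F\<close>.
\<close>

definition formeval :: "nat \<Rightarrow> ('v \<Rightarrow> complex) \<Rightarrow> 'v \<Rightarrow> complex" where
  "formeval d F x = (\<Sum>\<beta>\<in>Exp d. cf d \<beta> F * mon \<beta> x)"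

lemma formeval_eq: "F \<in> S d \<Longrightarrow> formeval d F x = F x"
  by (simp add: formeval_def form_expand)

lemma formeval_bip: "(\<lambda>z. formeval d (snd z) (fst z)) \<in> bip"
  unfolding formeval_def
  by (intro function_ring_sum[OF function_ring_bip] function_ring_mult[OF function_ring_bip] finite_Exp
      bip_form poly_funs.linear cf bip_mon)

lemma formeval_compose_bip:
  assumes "(\<lambda>z. X0 (a z)) \<in> bip" "(\<lambda>z. X1 (a z)) \<in> bip" "(\<lambda>z. X2 (a z)) \<in> bip" "(\<lambda>z. X3 (a z)) \<in> bip"
  shows "(\<lambda>z. formeval d (snd z) (a z)) \<in> bip"
  using bip_compose[OF formeval_bip function_ring_bip assms bip_form] by simp

lemma coefd_bip: "(\<And>t. (\<lambda>z. g z t) \<in> bip) \<Longrightarrow> (\<lambda>z. coefd n j (g z)) \<in> bip"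
  unfolding coefd_def
  by (intro function_ring_sum[OF function_ring_bip] function_ring_mult[OF function_ring_bip]
      function_ring_const[OF function_ring_bip]) auto

end

section \<open>Common factors of binary forms\<close>

lemma coefd_0:
  assumes "degree p \<le> n" "\<And>t. g t = poly p t" shows "coefd n 0 g = g 0"
  using coefd_eq[OF assms, of 0] assms(2)[of 0] by (simp add: poly_0_coeff_0)

text \<open>
  Sylvester-type determinant of the equation \<open>a p\<^sub>1 + b p\<^sub>0 = 0\<close> in the \<open>d - 1\<close> coefficients
  of \<open>a\<close> and the \<open>d - 2\<close> coefficients of \<open>b\<close>; row \<open>r\<close> is the coefficient of degree \<open>\<kappa> r\<close>.
\<close>

definition sylvester :: "nat \<Rightarrow> (nat \<Rightarrow> nat) \<Rightarrow> (nat \<Rightarrow> complex) \<Rightarrow> (nat \<Rightarrow> complex) \<Rightarrow> complex" where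
  "sylvester d \<kappa> p\<^sub>0 p\<^sub>1 = Determinant.det (Matrix.mat (2 * d - 3) (2 * d - 3) (\<lambda>(r, c).
     if c < d - 1 then (if c \<le> \<kappa> r then p\<^sub>1 (\<kappa> r - c) else 0)
     else (if c - (d - 1) \<le> \<kappa> r then p\<^sub>0 (\<kappa> r - (c - (d - 1))) else 0)))"

lemma convolution_restrict:
  fixes a :: "complex poly"
  assumes "degree a < N"
  shows "(\<Sum>c<N. (if c \<le> k then coeff P (k - c) else 0) * coeff a c) = coeff (a * P) k"
proof -
  have "coeff (a * P) k = (\<Sum>c\<le>k. coeff a c * coeff P (k - c))" by (rule coeff_mult)
  also have "\<dots> = (\<Sum>c\<in>{..k} \<inter> {..<N}. coeff a c * coeff P (k - c))"
    by (rule sum.mono_neutral_right) (use assms in \<open>auto dest!: le_degree\<close>)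
  also have "\<dots> = (\<Sum>c<N. (if c \<le> k then coeff P (k - c) else 0) * coeff a c)"
    by (rule sum.mono_neutral_cong_left) auto
  finally show ?thesis by simp
qed

text \<open>The cofactors give the syzygy \<open>a = R\<^sub>0\<close>,
  \<open>b = - R\<^sub>1\<close>; a common factor of degree at least two makes them short enough for
  the prescribed columns. In the intended degrees there are \<open>2 * d - 2\<close> coefficients to
  compare and one unknown fewer, so \<open>\<kappa>\<close> chooses which rows to keep; any choice
  gives a valid equation.\<close>

lemma sylvester_common_factor:
  assumes d: "d \<ge> 3" and p: "\<And>k. p\<^sub>0 k = coeff (Q * R\<^sub>0) k" "\<And>k. p\<^sub>1 k = coeff (Q * R\<^sub>1) k"
    and deg: "degree R\<^sub>0 \<le> d - 2" "degree R\<^sub>1 \<le> d - 3"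
  shows "sylvester d \<kappa> p\<^sub>0 p\<^sub>1 = 0"
proof -
  obtain a b where ab: "a * (Q * R\<^sub>1) + b * (Q * R\<^sub>0) = 0" "degree a \<le> d - 2" "degree b \<le> d - 3" "a \<noteq> 0 \<or> b \<noteq> 0"
  proof (cases "R\<^sub>0 = 0 \<and> R\<^sub>1 = 0")
    case True then show ?thesis using that[of 1 0] by simp
  next
    case False
    show ?thesis
    proof (rule that[of R\<^sub>0 "- R\<^sub>1"])
      show "R\<^sub>0 * (Q * R\<^sub>1) + - R\<^sub>1 * (Q * R\<^sub>0) = 0" by (simp add: mult_ac)
    qed (use deg False in auto)
  qed
  define z where "z = (\<lambda>c. if c < d - 1 then coeff a c else coeff b (c - (d - 1)))"
  let ?n = "2 * d - 3"
  have n: "?n = (d - 1) + (d - 2)" using d by simp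
  have "(\<Sum>c<M + N. f c) = (\<Sum>c<M. f c) + (\<Sum>c<N. f (M + c))" for f :: "nat \<Rightarrow> complex" and M N
    by (induction N) (simp_all add: add.assoc)
  then have split: "(\<Sum>c<?n. f c) = (\<Sum>c<d - 1. f c) + (\<Sum>c<d - 2. f (d - 1 + c))" for f :: "nat \<Rightarrow> complex"
    unfolding n .
  have row: "(\<Sum>c<?n. (if c < d - 1 then (if c \<le> k then p\<^sub>1 (k - c) else 0)
     else (if c - (d - 1) \<le> k then p\<^sub>0 (k - (c - (d - 1))) else 0)) * z c) = 0" for k
  proof -
    have "(\<Sum>c<d - 1. (if c \<le> k then p\<^sub>1 (k - c) else 0) * coeff a c) = coeff (a * (Q * R\<^sub>1)) k"
      unfolding p by (rule convolution_restrict) (use ab(2) d in simp)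
    moreover have "(\<Sum>c<d - 2. (if c \<le> k then p\<^sub>0 (k - c) else 0) * coeff b c) = coeff (b * (Q * R\<^sub>0)) k"
      unfolding p by (rule convolution_restrict) (use ab(3) d in simp)
    moreover have "coeff (a * (Q * R\<^sub>1)) k + coeff (b * (Q * R\<^sub>0)) k = 0"
      using ab(1) by (metis coeff_0 coeff_add)
    moreover obtain D where "d = Suc D" using d by (cases d) auto
    ultimately show ?thesis unfolding split by (simp add: z_def cong: if_cong)
  qed
  obtain j where "j < ?n" "z j \<noteq> 0"
  proof (cases "a = 0")
    case False
    then show ?thesis using that[of "degree a"] ab(2) d by (simp add: z_def leading_coeff_neq_0)
  next
    case True
    then show ?thesis using that[of "d - 1 + degree b"] ab(3,4) d by (simp add: z_def leading_coeff_neq_0)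
  qed
  then show ?thesis unfolding sylvester_def using row by (intro det_eq_0_if_kernel[where z=z]) auto
qed

text \<open>Dropping the row of degree \<open>d - 1\<close> puts the single entry \<open>A\<close>
  of each \<open>b\<close> column on the diagonal. The \<open>a\<close> columns start with
  \<open>p\<^sub>1 0\<close> on the diagonal.\<close>

lemma sylvester_triangular:
  assumes d: "d \<ge> 3" and p\<^sub>0: "\<And>k. p\<^sub>0 k = (if k = d then A else 0)"
  shows "sylvester d (\<lambda>r. if r < d - 1 then r else r + 1) p\<^sub>0 p\<^sub>1 = p\<^sub>1 0 ^ (d - 1) * A ^ (d - 2)"
proof -
  let ?n = "2 * d - 3"
  let ?f = "\<lambda>r c. let k = (if r < d - 1 then r else r + 1) in
     if c < d - 1 then (if c \<le> k then p\<^sub>1 (k - c) else 0)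
     else (if c - (d - 1) \<le> k then p\<^sub>0 (k - (c - (d - 1))) else 0)"
  let ?A = "Matrix.mat ?n ?n (\<lambda>(r, c). ?f r c)"
  have "Determinant.det ?A = prod_list (diag_mat ?A)"
    by (rule det_lower_triangular[of ?n]) (use d in \<open>auto simp: p\<^sub>0 Let_def\<close>)
  also have "\<dots> = (\<Prod>i<?n. if i < d - 1 then p\<^sub>1 0 else A)"
    unfolding diag_mat_def prod.distinct_set_conv_list[OF distinct_upt, symmetric] using d
    by (auto simp: p\<^sub>0 lessThan_atLeast0 intro!: prod.cong)
  also have "{..<?n} = {..<d - 1} \<union> {d - 1..<?n}" using d by auto
  also have "(\<Prod>i\<in>{..<d - 1} \<union> {d - 1..<?n}. if i < d - 1 then p\<^sub>1 0 else A) =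
    (\<Prod>i<d - 1. p\<^sub>1 0) * (\<Prod>i\<in>{d - 1..<?n}. A)"
    by (subst prod.union_disjoint) (auto intro!: arg_cong2[where f="(*)"] prod.cong)
  also have "\<dots> = p\<^sub>1 0 ^ (d - 1) * A ^ (d - 2)"
  proof -
    have "?n - (d - 1) = d - 2" using d by simp
    then show ?thesis by simp
  qed
  finally show ?thesis by (simp add: sylvester_def Let_def)
qed

text \<open>Every column has a single nonzero entry: in degree \<open>d - 1 + c\<close> for the
  \<open>a\<close> columns, and in degrees \<open>1\<close> to \<open>d - 2\<close> for the
  \<open>b\<close> columns. These degrees are distinct, and dropping the constant row while
  reordering the others leaves a multiple of the identity.\<close>

lemma sylvester_diagonal:
  assumes d: "d \<ge> 3" and p\<^sub>0: "\<And>k. p\<^sub>0 k = (if k = 1 then A else 0)" and p\<^sub>1: "\<And>k. p\<^sub>1 k = (if k = d - 1 then A else 0)"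
  shows "sylvester d (\<lambda>r. if r < d - 1 then d - 1 + r else r - (d - 1) + 1) p\<^sub>0 p\<^sub>1 = A ^ (2 * d - 3)"
proof -
  define \<kappa> where "\<kappa> = (\<lambda>r. if r < d - 1 then d - 1 + r else r - (d - 1) + 1)"
  have entry: "(if c < d - 1 then (if c \<le> \<kappa> r then p\<^sub>1 (\<kappa> r - c) else 0)
     else (if c - (d - 1) \<le> \<kappa> r then p\<^sub>0 (\<kappa> r - (c - (d - 1))) else 0)) = (if r = c then A else 0)"
    if rc: "r < 2 * d - 3" "c < 2 * d - 3" for r c
  proof (cases "r < d - 1")
    case r: True
    show ?thesis
    proof (cases "c < d - 1")
      case True
      then have "\<kappa> r - c = d - 1 \<longleftrightarrow> r = c" "c \<le> \<kappa> r" using r by (auto simp: \<kappa>_def)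
      then show ?thesis using True p\<^sub>1 by simp
    next
      case False
      then have "\<kappa> r - (c - (d - 1)) \<noteq> 1" "r \<noteq> c" using r rc d by (auto simp: \<kappa>_def)
      then show ?thesis using False p\<^sub>0 by simp
    qed
  next
    case r: False
    show ?thesis
    proof (cases "c < d - 1")
      case True
      then have "\<kappa> r - c \<noteq> d - 1" "r \<noteq> c" using r rc d by (auto simp: \<kappa>_def)
      then show ?thesis using True p\<^sub>1 by simp
    next
      case False
      then have "c - (d - 1) \<le> \<kappa> r \<and> \<kappa> r - (c - (d - 1)) = 1 \<longleftrightarrow> r = c" using r rc d by (auto simp: \<kappa>_def)
      then show ?thesis using False p\<^sub>0 by auto
    qed
  qed
  have "Matrix.mat (2 * d - 3) (2 * d - 3) (\<lambda>(r, c).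
     if c < d - 1 then (if c \<le> \<kappa> r then p\<^sub>1 (\<kappa> r - c) else 0)
     else (if c - (d - 1) \<le> \<kappa> r then p\<^sub>0 (\<kappa> r - (c - (d - 1))) else 0)) = A \<cdot>\<^sub>m 1\<^sub>m (2 * d - 3)"
    by (rule eq_matI) (simp_all only: index_mat dim_row_mat dim_col_mat prod.case entry index_smult_mat one_mat_def mult_1_right mult_zero_right if_distrib[of "\<lambda>x. A * x"])
  then show ?thesis unfolding sylvester_def \<kappa>_def[symmetric] by simp
qed

section \<open>The surface with a unique involutive cone section\<close>

text \<open>
  In the coordinates \<open>x\<^sub>1, y\<^sub>1, x\<^sub>2, y\<^sub>2\<close>, called \<open>X0, X1, X2, X3\<close> below, \<open>F\<^sub>0\<close> is
  \<open>x\<^sub>1\<^sup>d\<^sup>-\<^sup>1 y\<^sub>1 + y\<^sub>1\<^sup>d\<^sup>-\<^sup>1 y\<^sub>2 + x\<^sub>2\<^sup>d\<close>.  Away from the plane \<open>y\<^sub>1 = 0\<close> its surface is the graph of a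
  polynomial that is nonlinear on each line, so that \<open>y\<^sub>1 = x\<^sub>2 = 0\<close> is the only line on it.
  Therefore \<open>e\<^sub>1\<close> is the only point whose polar plane section contains a cone of degree at least 2
  with vertex at the point, and the equations of this condition cut it out with multiplicity one.
\<close>

context symplectic_basis
begin

text \<open>Only the divisibility part of \<open>admissible\<close>, without the nonvanishing
  conditions. It is all that the equations for the polar point need, and it is invariant under
  scaling of \<open>v\<close>.\<close>

definition compat :: "nat \<Rightarrow> nat \<Rightarrow> 'v \<Rightarrow> ('v \<Rightarrow> complex) \<Rightarrow> bool" where
  "compat m d v F \<longleftrightarrow> F \<in> S d \<and> (\<exists>q\<in>S m. \<exists>g\<in>S (d - m).
    (\<forall>x s. \<omega> v x = 0 \<longrightarrow> q (x + smul s v) = q x) \<and> (\<forall>x. \<omega> v x = 0 \<longrightarrow> F x = q x * g x))"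

lemma admissible_compat: "admissible m d v q F \<Longrightarrow> compat m d v F"
  unfolding admissible_def compat_def by blast

lemma compat_smul: "compat m d v F \<Longrightarrow> t \<noteq> 0 \<Longrightarrow> compat m d (smul t v) F"
  unfolding compat_def by (simp add: omega_simps) blast

text \<open>On the hyperplane \<open>F (x + s v)\<close> equals \<open>q x\<close> times a
  polynomial in \<open>s\<close> of degree at most \<open>d - m \<le> d - 2\<close>. The coefficient
  of \<open>s^(d-1)\<close> is the derivative of \<open>F\<close> at \<open>v\<close> in direction
  \<open>x\<close>.\<close>

lemma compat_tangent:
  assumes "compat m d v F" "\<omega> v x = 0" "2 \<le> m" "m \<le> d"
  shows "coefd d (d - 1) (\<lambda>s. F (x + smul s v)) = 0"
proof -
  obtain q g where *: "g \<in> S (d - m)" "\<And>x s. \<omega> v x = 0 \<Longrightarrow> q (x + smul s v) = q x"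
    "\<And>x. \<omega> v x = 0 \<Longrightarrow> F x = q x * g x" using assms(1) unfolding compat_def by blast
  obtain p where p: "degree p \<le> d - m" "\<And>s. g (x + smul s v) = poly p s" using form_poly[OF *(1)] by metis
  have "F (x + smul s v) = poly (Polynomial.smult (q x) p) s" for s
    using *(3)[of "x + smul s v"] *(2)[OF assms(2)] assms(2) by (simp add: omega_simps p)
  moreover have "degree (Polynomial.smult (q x) p) \<le> d - m" using degree_smult_le p(1) by (rule order_trans)
  ultimately have "coefd d (d - 1) (\<lambda>s. F (x + smul s v)) = coeff (Polynomial.smult (q x) p) (d - 1)"
    by (intro coefd_eq) auto
  also have "\<dots> = 0" using p(1) assms(3,4) by (simp add: coeff_eq_0)
  finally show ?thesis .
qed

definition jet :: "nat \<Rightarrow> nat \<Rightarrow> ('v \<Rightarrow> complex) \<Rightarrow> 'v \<Rightarrow> 'v \<Rightarrow> 'v \<Rightarrow> nat \<Rightarrow> complex" where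
  "jet d j F v e f k = coefd d k (\<lambda>u. coefd d j (\<lambda>s. F (e + smul u f + smul s v)))"

text \<open>Since \<open>q\<close> does not change along \<open>v\<close>, the polynomial
  \<open>Q u = q (e + u f)\<close> divides every Taylor coefficient of \<open>F\<close> along
  \<open>v\<close>; the cofactors are the Taylor coefficients of \<open>g\<close>, of degree at most
  \<open>d - m - j\<close> in \<open>u\<close>.\<close>

lemma compat_sylvester:
  assumes "compat m d v F" "\<omega> v e = 0" "\<omega> v f = 0" "2 \<le> m" "m \<le> d" "3 \<le> d"
  shows "sylvester d \<kappa> (jet d 0 F v e f) (jet d 1 F v e f) = 0"
proof -
  obtain q g where *: "q \<in> S m" "g \<in> S (d - m)" "\<And>x s. \<omega> v x = 0 \<Longrightarrow> q (x + smul s v) = q x"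
    "\<And>x. \<omega> v x = 0 \<Longrightarrow> F x = q x * g x" using assms(1) unfolding compat_def by blast
  obtain Q where Q: "degree Q \<le> m" "\<And>u. q (e + smul u f) = poly Q u" using form_poly[OF *(1)] by metis
  obtain G where G: "\<And>j. j \<le> d - m \<Longrightarrow> G j \<in> S (d - m - j)"
    "\<And>x s. g (x + smul s v) = (\<Sum>j\<le>d - m. s ^ j * G j x)" using taylor[OF *(2)] by metis
  have "\<exists>p. degree p \<le> d - m - j \<and> (\<forall>u. G j (e + smul u f) = poly p u)" if "j \<le> d - m" for j
    using form_poly[OF G(1)[OF that]] by metis
  then obtain R where R: "\<And>j. j \<le> d - m \<Longrightarrow> degree (R j) \<le> d - m - j"
    "\<And>j u. j \<le> d - m \<Longrightarrow> G j (e + smul u f) = poly (R j) u" by metis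
  define R' where "R' = (\<lambda>j. if j \<le> d - m then R j else 0)"
  have R': "degree (R' j) \<le> d - m - j" for j using R(1)[of j] by (simp add: R'_def)
  have inner: "coefd d j (\<lambda>s. F (e + smul u f + smul s v)) = poly (Q * R' j) u" if "j \<le> d" for j u
  proof -
    let ?x = "e + smul u f"
    have x: "\<omega> v ?x = 0" using assms(2,3) by (simp add: omega_simps)
    let ?p = "poly_of_coeffs (d - m) (\<lambda>j. poly (Q * R j) u)"
    have "F (?x + smul s v) = poly ?p s" for s
      using *(4)[of "?x + smul s v"] *(3)[OF x] x
      by (simp add: omega_simps G(2) R(2) Q(2) poly_poly_of_coeffs sum_distrib_left mult.left_commute)
    then have "coefd d j (\<lambda>s. F (?x + smul s v)) = coeff ?p j"
      by (intro coefd_eq order_trans[OF degree_poly_of_coeffs]) simp_all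
    then show ?thesis by (simp add: coeff_poly_of_coeffs R'_def)
  qed
  have jet: "jet d j F v e f k = coeff (Q * R' j) k" if "j \<le> 1" for j k
    unfolding jet_def
  proof (rule coefd_eq)
    show "degree (Q * R' j) \<le> d"
      using degree_mult_le[of Q "R' j"] Q(1) R'[of j] assms(5) by linarith
    show "coefd d j (\<lambda>s. F (e + smul t f + smul s v)) = poly (Q * R' j) t" for t
      using inner that assms(6) by simp
  qed
  have deg: "degree (R' 0) \<le> d - 2" "degree (R' 1) \<le> d - 3"
    using R'[of 0] R'[of 1] assms(4) by linarith+
  show ?thesis
    by (rule sylvester_common_factor[OF assms(6) _ _ deg]) (use jet in auto)
qed

definition F\<^sub>0 :: "nat \<Rightarrow> 'v \<Rightarrow> complex" where
  "F\<^sub>0 d x = X0 x ^ (d - 1) * X1 x + X1 x ^ (d - 1) * X3 x + X2 x ^ d"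

lemma F\<^sub>0_form: "d \<ge> 1 \<Longrightarrow> F\<^sub>0 d \<in> S d"
proof -
  assume d: "d \<ge> 1"
  have "(\<lambda>x. X0 x ^ (d - 1) * X1 x + X1 x ^ (d - 1) * X3 x + X2 x ^ d) \<in> S d"
  proof (intro sym_forms_add sym_forms_power coord_dual)
    show "(\<lambda>x. X0 x ^ (d - 1) * X1 x) \<in> S d" "(\<lambda>x. X1 x ^ (d - 1) * X3 x) \<in> S d"
      using sym_forms_mult[OF sym_forms_power sym_forms_linear, of X0 "dual_space smul" X1 "d - 1"]
        sym_forms_mult[OF sym_forms_power sym_forms_linear, of X1 "dual_space smul" X3 "d - 1"] d
      by (simp_all add: coord_dual)
  qed
  then show ?thesis unfolding F\<^sub>0_def[abs_def] .
qed

section \<open>The ideal of equations and its fibre over \<open>F\<^sub>0\<close>\<close>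

definition compat_ideal :: "nat \<Rightarrow> nat \<Rightarrow> ('v \<times> ('v \<Rightarrow> complex) \<Rightarrow> complex) set" where
  "compat_ideal m d = {E \<in> bip. \<forall>v F. compat m d v F \<longrightarrow> E (v, F) = 0}"

text \<open>These are specialisations of equations valid for all compatible pairs, not all
  polynomials vanishing at the compatible points of \<open>F\<^sub>0\<close>. Each element thus
  comes with a deformation to other forms, and multiplicities are retained.\<close>

definition fiber_ideal :: "nat \<Rightarrow> nat \<Rightarrow> ('v \<Rightarrow> complex) set" where
  "fiber_ideal m d = {\<lambda>v. E (v, F\<^sub>0 d) | E. E \<in> compat_ideal m d}"

definition Vpoly :: "('v \<Rightarrow> complex) set" where
  "Vpoly = {p. (\<lambda>z. p (fst z)) \<in> bip}"

lemma function_ring_Vpoly: "function_ring Vpoly"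
  unfolding function_ring_def Vpoly_def
  using function_ring_const[OF function_ring_bip] function_ring_add[OF function_ring_bip] function_ring_mult[OF function_ring_bip]
  by blast

lemma Vpoly_coord: "X0 \<in> Vpoly" "X1 \<in> Vpoly" "X2 \<in> Vpoly" "X3 \<in> Vpoly"
  using bip_coord by (simp_all add: Vpoly_def)

lemmas Vpoly_intros = function_ring_const[OF function_ring_Vpoly] function_ring_add[OF function_ring_Vpoly]
  function_ring_mult[OF function_ring_Vpoly] function_ring_power[OF function_ring_Vpoly] Vpoly_coord

lemma mon_Vpoly: "mon \<beta> \<in> Vpoly"
  using bip_mon by (simp add: Vpoly_def)

lemma fiber_ideal_add: "p \<in> fiber_ideal m d \<Longrightarrow> q \<in> fiber_ideal m d \<Longrightarrow> (\<lambda>v. p v + q v) \<in> fiber_ideal m d"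
proof -
  assume "p \<in> fiber_ideal m d" "q \<in> fiber_ideal m d"
  then obtain E E' where "E \<in> compat_ideal m d" "p = (\<lambda>v. E (v, F\<^sub>0 d))" "E' \<in> compat_ideal m d" "q = (\<lambda>v. E' (v, F\<^sub>0 d))"
    by (auto simp: fiber_ideal_def)
  then show ?thesis unfolding fiber_ideal_def compat_ideal_def
    by (auto intro!: exI[of _ "\<lambda>z. E z + E' z"] bip.add)
qed

lemma fiber_ideal_mult: "r \<in> Vpoly \<Longrightarrow> p \<in> fiber_ideal m d \<Longrightarrow> (\<lambda>v. r v * p v) \<in> fiber_ideal m d"
proof -
  assume r: "r \<in> Vpoly" and "p \<in> fiber_ideal m d"
  then obtain E where E: "E \<in> compat_ideal m d" "p = (\<lambda>v. E (v, F\<^sub>0 d))" by (auto simp: fiber_ideal_def)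
  have "(\<lambda>z. r (fst z) * E z) \<in> compat_ideal m d"
    using r E function_ring_mult[OF function_ring_bip, of "\<lambda>z. r (fst z)" E] by (simp add: compat_ideal_def Vpoly_def)
  then show ?thesis unfolding fiber_ideal_def by (intro CollectI exI[of _ "\<lambda>z. r (fst z) * E z"]) (simp add: E)
qed

lemma fiber_ideal_sum: "finite A \<Longrightarrow> A \<noteq> {} \<Longrightarrow> (\<And>i. i \<in> A \<Longrightarrow> p i \<in> fiber_ideal m d) \<Longrightarrow> (\<lambda>v. \<Sum>i\<in>A. p i v) \<in> fiber_ideal m d"
  by (induction rule: finite_ne_induct) (auto intro: fiber_ideal_add)

text \<open>Membership in the radical of \<open>fiber_ideal\<close>, i.e. nilpotency modulo
  it.\<close>

definition nilpotent :: "nat \<Rightarrow> nat \<Rightarrow> ('v \<Rightarrow> complex) \<Rightarrow> bool" where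
  "nilpotent m d p \<longleftrightarrow> p \<in> Vpoly \<and> (\<exists>N. (\<lambda>v. p v ^ N) \<in> fiber_ideal m d)"

lemma fiber_ideal_subset_Vpoly: "fiber_ideal m d \<subseteq> Vpoly"
proof
  fix p assume "p \<in> fiber_ideal m d"
  then obtain E where "E \<in> bip" "p = (\<lambda>v. E (v, F\<^sub>0 d))" by (auto simp: fiber_ideal_def compat_ideal_def)
  then show "p \<in> Vpoly"
    using bip_compose[OF _ function_ring_bip, of E fst "\<lambda>_. F\<^sub>0 d"] bip_coord function_ring_const[OF function_ring_bip]
    by (simp add: Vpoly_def)
qed

lemma nilpotent_fiber_ideal: "p \<in> fiber_ideal m d \<Longrightarrow> nilpotent m d p"
  unfolding nilpotent_def using fiber_ideal_subset_Vpoly by (auto intro!: exI[of _ 1])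

lemma nilpotent_mult: "r \<in> Vpoly \<Longrightarrow> nilpotent m d p \<Longrightarrow> nilpotent m d (\<lambda>v. r v * p v)"
proof -
  assume r: "r \<in> Vpoly" and "nilpotent m d p"
  then obtain N where "p \<in> Vpoly" "(\<lambda>v. p v ^ N) \<in> fiber_ideal m d" by (auto simp: nilpotent_def)
  moreover from fiber_ideal_mult[OF _ this(2), of "\<lambda>v. r v ^ N"] have "(\<lambda>v. (r v * p v) ^ N) \<in> fiber_ideal m d"
    using r by (simp add: Vpoly_intros power_mult_distrib)
  ultimately show ?thesis using r by (auto simp: nilpotent_def Vpoly_intros)
qed

lemma nilpotent_add: "nilpotent m d p \<Longrightarrow> nilpotent m d q \<Longrightarrow> nilpotent m d (\<lambda>v. p v + q v)"
proof -
  assume "nilpotent m d p" "nilpotent m d q"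
  then obtain N M where N: "p \<in> Vpoly" "(\<lambda>v. p v ^ N) \<in> fiber_ideal m d" and M: "q \<in> Vpoly" "(\<lambda>v. q v ^ M) \<in> fiber_ideal m d"
    by (auto simp: nilpotent_def)
  have "(\<lambda>v. \<Sum>k\<le>N + M. of_nat (N + M choose k) * p v ^ k * q v ^ (N + M - k)) \<in> fiber_ideal m d"
  proof (rule fiber_ideal_sum)
    fix k assume "k \<in> {..N + M}"
    show "(\<lambda>v. of_nat (N + M choose k) * p v ^ k * q v ^ (N + M - k)) \<in> fiber_ideal m d"
    proof (cases "N \<le> k")
      case True
      have "(\<lambda>v. (of_nat (N + M choose k) * p v ^ (k - N) * q v ^ (N + M - k)) * p v ^ N) \<in> fiber_ideal m d"
        by (rule fiber_ideal_mult[OF _ N(2)]) (intro Vpoly_intros N M)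
      moreover have "p v ^ k = p v ^ (k - N) * p v ^ N" for v using True by (simp add: power_add[symmetric])
      ultimately show ?thesis by (simp add: mult_ac)
    next
      case False
      have "(\<lambda>v. (of_nat (N + M choose k) * p v ^ k * q v ^ (N - k)) * q v ^ M) \<in> fiber_ideal m d"
        by (rule fiber_ideal_mult[OF _ M(2)]) (intro Vpoly_intros N M)
      moreover have "q v ^ (N + M - k) = q v ^ (N - k) * q v ^ M" for v using False by (simp add: power_add[symmetric])
      ultimately show ?thesis by (simp add: mult_ac)
    qed
  qed auto
  then have "(\<lambda>v. (p v + q v) ^ (N + M)) \<in> fiber_ideal m d" by (simp add: binomial_ring)
  then show ?thesis using N M by (auto simp: nilpotent_def Vpoly_intros)
qed

lemma nilpotent_power: "p \<in> Vpoly \<Longrightarrow> nilpotent m d (\<lambda>v. p v ^ k) \<Longrightarrow> nilpotent m d p"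
  unfolding nilpotent_def by (auto simp: power_mult[symmetric])

text \<open>The polynomial is the derivative of \<open>F\<^sub>0\<close> at \<open>v\<close> in
  direction \<open>x v\<close>, obtained by expanding \<open>F\<^sub>0\<close> along
  \<open>x v + s v\<close>. The direction must itself be polynomial in \<open>v\<close> and lie in
  the hyperplane of \<open>v\<close> for every \<open>v\<close>.\<close>

lemma tangent_in_fiber_ideal:
  assumes x: "(\<lambda>v. X0 (x v)) \<in> Vpoly" "(\<lambda>v. X1 (x v)) \<in> Vpoly" "(\<lambda>v. X2 (x v)) \<in> Vpoly" "(\<lambda>v. X3 (x v)) \<in> Vpoly"
    and \<omega>: "\<And>v. \<omega> v (x v) = 0" and md: "2 \<le> m" "m \<le> d" and n: "d = Suc n" "n = Suc n'"
  shows "(\<lambda>v. X1 (x v) * X0 v ^ n + of_nat n * X0 (x v) * X0 v ^ n' * X1 v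
     + X3 (x v) * X1 v ^ n + of_nat n * X1 (x v) * X1 v ^ n' * X3 v
     + of_nat d * X2 (x v) * X2 v ^ n) \<in> fiber_ideal m d"
proof -
  let ?E = "\<lambda>z. coefd d (d - 1) (\<lambda>s. formeval d (snd z) (x (fst z) + smul s (fst z)))"
  have c: "(\<lambda>z. X (x (fst z)) + s * X (fst z)) \<in> bip" if "X \<in> Vpoly" "(\<lambda>v. X (x v)) \<in> Vpoly" for X s
    using that unfolding Vpoly_def mem_Collect_eq
    by (intro function_ring_add[OF function_ring_bip] function_ring_mult[OF function_ring_bip] function_ring_const[OF function_ring_bip])
  have "?E \<in> bip"
    by (intro coefd_bip formeval_compose_bip) (simp_all add: c x Vpoly_coord)
  moreover have "?E (v, F) = 0" if "compat m d v F" for v F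
  proof -
    have "F \<in> S d" using that by (simp add: compat_def)
    then show ?thesis using compat_tangent[OF that \<omega> md] by (simp add: formeval_eq)
  qed
  ultimately have E: "?E \<in> compat_ideal m d" by (simp add: compat_ideal_def)
  have top: "coeff ([:a, b:] ^ k) k = b ^ k" for a b :: complex and k
  proof (induction k)
    case (Suc k)
    have "coeff ([:a, b:] ^ k) (Suc k) = 0"
      by (rule coeff_eq_0) (use degree_power_le[of "[:a, b:]" k] in \<open>auto simp: le_less_trans split: if_splits\<close>)
    then show ?case using Suc by simp
  qed simp
  have sub: "coeff ([:a, b:] ^ Suc k) k = of_nat (Suc k) * a * b ^ k" for a b :: complex and k
  proof (induction k)
    case (Suc k)
    have "coeff ([:a, b:] ^ Suc (Suc k)) (Suc k) = a * coeff ([:a, b:] ^ Suc k) (Suc k) + b * coeff ([:a, b:] ^ Suc k) k"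
      by simp
    then show ?case unfolding Suc.IH top by (simp add: algebra_simps)
  qed simp
  have "?E (v, F\<^sub>0 d) = X1 (x v) * X0 v ^ n + of_nat n * X0 (x v) * X0 v ^ n' * X1 v
     + X3 (x v) * X1 v ^ n + of_nat n * X1 (x v) * X1 v ^ n' * X3 v
     + of_nat d * X2 (x v) * X2 v ^ n" for v
  proof -
    let ?l = "\<lambda>X. [:X (x v), X v:] :: complex poly"
    let ?p = "?l X0 ^ n * ?l X1 + ?l X1 ^ n * ?l X3 + ?l X2 ^ d"
    have l: "degree (?l X ^ k) \<le> k" for X k
      using degree_power_le[of "?l X" k] by (auto split: if_splits intro: order_trans)
    have l1: "degree (?l X) \<le> 1" for X by simp
    have "degree ?p \<le> d"
      by (intro degree_add_le l order_trans[OF degree_mult_le])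
        (use l[of X0 n] l[of X1 n] l1[of X1] l1[of X3] n in linarith)+
    moreover have "formeval d (F\<^sub>0 d) (x v + smul s v) = poly ?p s" for s
    proof -
      have "F\<^sub>0 d \<in> S d" "d - 1 = n" using F\<^sub>0_form[of d] n by simp_all
      then show ?thesis by (simp add: formeval_eq F\<^sub>0_def algebra_simps)
    qed
    ultimately have "?E (v, F\<^sub>0 d) = coeff ?p n" using coefd_eq[of ?p d _ n] n by simp
    moreover have m1: "coeff (?l X ^ n * ?l Y) n = Y (x v) * X v ^ n + of_nat n * X (x v) * X v ^ n' * Y v" for X Y
    proof -
      have "coeff (?l X ^ n * ?l Y) n = Y (x v) * coeff (?l X ^ n) n + Y v * coeff (?l X ^ n) n'"
        unfolding mult.commute[of "?l X ^ n"] using n by simp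
      then show ?thesis unfolding top unfolding n(2) sub by (simp add: mult_ac)
    qed
    moreover have "coeff (?l X2 ^ d) n = of_nat d * X2 (x v) * X2 v ^ n" unfolding n(1) by (rule sub)
    ultimately show ?thesis by (simp only: coeff_add add.assoc)
  qed
  then show ?thesis unfolding fiber_ideal_def using E by (auto intro!: exI[of _ ?E])
qed

lemma sylvester_in_fiber_ideal:
  assumes e: "(\<lambda>v. X0 (e v)) \<in> Vpoly" "(\<lambda>v. X1 (e v)) \<in> Vpoly" "(\<lambda>v. X2 (e v)) \<in> Vpoly" "(\<lambda>v. X3 (e v)) \<in> Vpoly"
    and f: "(\<lambda>v. X0 (f v)) \<in> Vpoly" "(\<lambda>v. X1 (f v)) \<in> Vpoly" "(\<lambda>v. X2 (f v)) \<in> Vpoly" "(\<lambda>v. X3 (f v)) \<in> Vpoly"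
    and \<omega>: "\<And>v. \<omega> v (e v) = 0" "\<And>v. \<omega> v (f v) = 0" and md: "2 \<le> m" "m \<le> d" "3 \<le> d"
  shows "(\<lambda>v. sylvester d \<kappa> (jet d 0 (F\<^sub>0 d) v (e v) (f v)) (jet d 1 (F\<^sub>0 d) v (e v) (f v))) \<in> fiber_ideal m d"
proof -
  let ?j = "\<lambda>i z. jet d i (formeval d (snd z)) (fst z) (e (fst z)) (f (fst z))"
  let ?E = "\<lambda>z. sylvester d \<kappa> (?j 0 z) (?j 1 z)"
  have c: "(\<lambda>z. X (e (fst z)) + u * X (f (fst z)) + s * X (fst z)) \<in> bip"
    if "X \<in> Vpoly" "(\<lambda>v. X (e v)) \<in> Vpoly" "(\<lambda>v. X (f v)) \<in> Vpoly" for X s u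
    using that unfolding Vpoly_def mem_Collect_eq
    by (intro function_ring_add[OF function_ring_bip] function_ring_mult[OF function_ring_bip] function_ring_const[OF function_ring_bip])
  have j: "(\<lambda>z. ?j i z k) \<in> bip" for i k unfolding jet_def
    by (intro coefd_bip formeval_compose_bip) (simp_all add: c e f Vpoly_coord)
  have "?E \<in> bip"
    unfolding sylvester_def
  proof (rule function_ring_det[OF function_ring_bip])
    fix r c
    show "(\<lambda>z. if c < d - 1 then (if c \<le> \<kappa> r then ?j 1 z (\<kappa> r - c) else 0)
     else (if c - (d - 1) \<le> \<kappa> r then ?j 0 z (\<kappa> r - (c - (d - 1))) else 0)) \<in> bip"
    proof -
      obtain D where "d = Suc D" using md by (cases d) auto
      then show ?thesis
        using j function_ring_const[OF function_ring_bip, of 0]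
        by (cases "c < D"; cases "c \<le> \<kappa> r"; cases "c - D \<le> \<kappa> r") simp_all
    qed
  qed
  moreover have "?E (v, F) = 0" if "compat m d v F" for v F
  proof -
    have "F \<in> S d" using that by (simp add: compat_def)
    then have "formeval d F = F" by (auto simp: formeval_eq)
    then show ?thesis using compat_sylvester[OF that \<omega> md] by simp
  qed
  ultimately have E: "?E \<in> compat_ideal m d" by (simp add: compat_ideal_def)
  have "formeval d (F\<^sub>0 d) = F\<^sub>0 d" using F\<^sub>0_form[of d] md by (auto simp: formeval_eq)
  then show ?thesis unfolding fiber_ideal_def using E by (auto intro!: exI[of _ ?E])
qed

section \<open>Nilpotency of the coordinates other than \<open>X0\<close>\<close>

lemma jet_0:
  assumes "F \<in> S d" shows "jet d 0 F v e f k = coefd d k (\<lambda>u. F (e + smul u f))"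
proof -
  have "coefd d 0 (\<lambda>s. F (x + smul s v)) = F x" for x
  proof -
    obtain p where "degree p \<le> d" "\<And>s. F (x + smul s v) = poly p s" using form_poly[OF assms] by metis
    from coefd_0[OF this] show ?thesis by simp
  qed
  then show ?thesis by (simp add: jet_def)
qed

lemma jet_at_0:
  assumes "F \<in> S d" "j \<le> d" shows "jet d j F v e f 0 = coefd d j (\<lambda>s. F (e + smul s v))"
proof -
  obtain G where G: "\<And>j. j \<le> d \<Longrightarrow> G j \<in> S (d - j)" "\<And>x s. F (x + smul s v) = (\<Sum>j\<le>d. s ^ j * G j x)"
    using taylor[OF assms(1)] by metis
  have "coefd d j (\<lambda>s. F (x + smul s v)) = G j x" for x
    using coefd_eq[OF degree_poly_of_coeffs, of "\<lambda>s. F (x + smul s v)" d "\<lambda>j. G j x" j] assms(2) by (simp add: poly_poly_of_coeffs G coeff_poly_of_coeffs)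
  moreover obtain p where "degree p \<le> d - j" "\<And>u. G j (e + smul u f) = poly p u" using form_poly[OF G(1)[OF assms(2)]] by metis
  then have "coefd d 0 (\<lambda>u. G j (e + smul u f)) = G j (e + smul 0 f)" by (intro coefd_0) auto
  ultimately show ?thesis by (simp add: jet_def)
qed

text \<open>\<open>e v\<close> and \<open>f v\<close> are chosen in the hyperplane with
  \<open>X1 = 0\<close>, where \<open>F\<^sub>0\<close> reduces to \<open>X2^d\<close>. Then the
  order-zero part is a single monomial in \<open>u\<close>, and the triangular determinant is a
  product of powers of \<open>X1\<close> and \<open>X2\<close>.\<close>

lemma nilpotent_X1_X2:
  assumes md: "2 \<le> m" "m \<le> d" "3 \<le> d" shows "nilpotent m d (\<lambda>v. X1 v * X2 v)"
proof -
  define e where "e = (\<lambda>v. vec (X2 v) 0 0 (X1 v))"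
  define f where "f = (\<lambda>v. vec (- X3 v) 0 (X1 v) 0)"
  define n where "n = d - 1"
  have n: "d = Suc n" "n \<ge> 2" using md by (auto simp: n_def)
  have F: "F\<^sub>0 d \<in> S d" using F\<^sub>0_form md by simp
  have neg: "(\<lambda>v. - X3 v) \<in> Vpoly" using Vpoly_intros(3)[OF Vpoly_intros(1)[of "-1"] Vpoly_coord(4)] by simp
  have J: "(\<lambda>v. sylvester d (\<lambda>r. if r < d - 1 then r else r + 1) (jet d 0 (F\<^sub>0 d) v (e v) (f v)) (jet d 1 (F\<^sub>0 d) v (e v) (f v))) \<in> fiber_ideal m d"
    by (rule sylvester_in_fiber_ideal) (use md in \<open>simp_all add: e_def f_def Vpoly_intros neg omega_coord\<close>)
  have "jet d 0 (F\<^sub>0 d) v (e v) (f v) k = (if k = d then X1 v ^ d else 0)" for v k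
  proof -
    have "F\<^sub>0 d (e v + smul u (f v)) = poly (monom (X1 v ^ d) d) u" for u
      using n by (simp add: F\<^sub>0_def e_def f_def poly_monom power_mult_distrib)
    then show ?thesis unfolding jet_0[OF F] using coefd_eq[OF degree_monom_le] by (auto simp: coefd_eq[OF degree_monom_le])
  qed
  from sylvester_triangular[OF md(3) this]
  have "(\<lambda>v. jet d 1 (F\<^sub>0 d) v (e v) (f v) 0 ^ n * (X1 v ^ d) ^ (d - 2)) \<in> fiber_ideal m d" using J by (simp add: n_def)
  moreover have "jet d 1 (F\<^sub>0 d) v (e v) (f v) 0 = X1 v * X2 v ^ n" for v
  proof -
    let ?p = "[:X2 v, X0 v:] ^ n * [:0, X1 v:] + monom (X1 v ^ n) n * [:X1 v, X3 v:] + monom (X2 v ^ d) d"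
    have p: "degree ([:X2 v, X0 v:] ^ n) \<le> n" using degree_power_le[of "[:X2 v, X0 v:]" n] by (auto split: if_splits)
    have "degree ?p \<le> d"
    proof (intro degree_add_le degree_monom_le order_trans[OF degree_mult_le])
      show "degree ([:X2 v, X0 v:] ^ n) + degree [:0, X1 v:] \<le> d" using p n by simp
      show "degree (monom (X1 v ^ n) n) + degree [:X1 v, X3 v:] \<le> d" using degree_monom_le[of "X1 v ^ n" n] n by simp
    qed
    moreover have "F\<^sub>0 d (e v + smul s v) = poly ?p s" for s
      using n by (simp add: F\<^sub>0_def e_def poly_monom poly_power power_mult_distrib algebra_simps)
    ultimately have "coefd d 1 (\<lambda>s. F\<^sub>0 d (e v + smul s v)) = coeff ?p 1" by (rule coefd_eq)
    also have "coeff (monom (X1 v ^ n) n * [:X1 v, X3 v:]) 1 = 0"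
      using n by (simp add: coeff_monom_mult)
    moreover have "coeff ([:X2 v, X0 v:] ^ n * [:0, X1 v:]) 1 = X1 v * X2 v ^ n"
    proof -
      have "coeff ([:0, X1 v:] * [:X2 v, X0 v:] ^ n) 1 = X1 v * coeff ([:X2 v, X0 v:] ^ n) 0" by simp
      also have "coeff ([:X2 v, X0 v:] ^ n) 0 = X2 v ^ n" by (simp add: coeff_0_power)
      finally show ?thesis by (simp add: mult.commute)
    qed
    ultimately show ?thesis unfolding jet_at_0[OF F, of 1, simplified] using jet_at_0[OF F, of 1] n by simp
  qed
  ultimately have "(\<lambda>v. (X1 v * X2 v ^ n) ^ n * (X1 v ^ d) ^ (d - 2)) \<in> fiber_ideal m d" by simp
  \<comment> \<open>The multiplier equalises the exponents of \<open>X1\<close> and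
    \<open>X2\<close>.\<close>
  then have "(\<lambda>v. (X1 v ^ (n * n) * X2 v ^ (n + d * (d - 2))) * ((X1 v * X2 v ^ n) ^ n * (X1 v ^ d) ^ (d - 2))) \<in> fiber_ideal m d"
    by (rule fiber_ideal_mult[rotated]) (intro Vpoly_intros)
  moreover have "(X1 v ^ (n * n) * X2 v ^ (n + d * (d - 2))) * ((X1 v * X2 v ^ n) ^ n * (X1 v ^ d) ^ (d - 2))
     = (X1 v * X2 v) ^ (n * n + n + d * (d - 2))" for v
    by (simp add: power_mult_distrib power_add power_mult[symmetric] mult_ac)
  ultimately show ?thesis unfolding nilpotent_def by (auto intro!: Vpoly_intros)
qed

text \<open>A monomial that is not a pure power of \<open>X3\<close> contains a factor
  \<open>X0\<close>, \<open>X1\<close> or \<open>X2\<close>, so the remainder is the value on the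
  line where these three vanish.\<close>

lemma bip_mod_X0_X1_X2:
  assumes "E \<in> bip"
  obtains r\<^sub>0 r\<^sub>1 r\<^sub>2 where "r\<^sub>0 \<in> Vpoly" "r\<^sub>1 \<in> Vpoly" "r\<^sub>2 \<in> Vpoly"
    "\<And>v. E (v, F) = E (vec 0 0 0 (X3 v), F) + X0 v * r\<^sub>0 v + X1 v * r\<^sub>1 v + X2 v * r\<^sub>2 v"
proof -
  have "\<exists>r\<^sub>0\<in>Vpoly. \<exists>r\<^sub>1\<in>Vpoly. \<exists>r\<^sub>2\<in>Vpoly.
    \<forall>v. E (v, F) = E (vec 0 0 0 (X3 v), F) + X0 v * r\<^sub>0 v + X1 v * r\<^sub>1 v + X2 v * r\<^sub>2 v"
    using assms
  proof (induction rule: bip.induct)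
    case (base p \<beta>)
    obtain a b c e where \<beta>: "\<beta> = (a, b, c, e)" by (cases \<beta>)
    have 0: "(\<lambda>_. 0) \<in> Vpoly" by (rule Vpoly_intros)
    have m: "(\<lambda>v. p F * mon \<gamma> v) \<in> Vpoly" for \<gamma> by (intro Vpoly_intros mon_Vpoly)
    show ?case
    proof (cases a)
      case (Suc a')
      show ?thesis
        by (rule bexI[OF bexI[OF bexI[OF _ 0] 0] m[of "(a', b, c, e)"]]) (simp add: \<beta> Suc mon_def)
    next
      case a: 0
      show ?thesis
      proof (cases b)
        case (Suc b')
        show ?thesis
          by (rule bexI[OF bexI[OF bexI[OF _ 0] m[of "(a, b', c, e)"]] 0]) (simp add: \<beta> Suc mon_def)
      next
        case b: 0
        show ?thesis
        proof (cases c)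
          case (Suc c')
          show ?thesis
            by (rule bexI[OF bexI[OF bexI[OF _ m[of "(a, b, c', e)"]] 0] 0]) (simp add: \<beta> Suc mon_def)
        next
          case c: 0
          show ?thesis
            by (rule bexI[OF bexI[OF bexI[OF _ 0] 0] 0]) (simp add: \<beta> a b c mon_def)
        qed
      qed
    qed
  next
    case (add E E')
    obtain r0 r1 r2 where r: "r0 \<in> Vpoly" "r1 \<in> Vpoly" "r2 \<in> Vpoly"
      "\<And>v. E (v, F) = E (vec 0 0 0 (X3 v), F) + X0 v * r0 v + X1 v * r1 v + X2 v * r2 v" using add.IH(1) by blast
    obtain s0 s1 s2 where s: "s0 \<in> Vpoly" "s1 \<in> Vpoly" "s2 \<in> Vpoly"
      "\<And>v. E' (v, F) = E' (vec 0 0 0 (X3 v), F) + X0 v * s0 v + X1 v * s1 v + X2 v * s2 v" using add.IH(2) by blast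
    show ?case
    proof (rule bexI[of _ "\<lambda>v. r0 v + s0 v"], rule bexI[of _ "\<lambda>v. r1 v + s1 v"], rule bexI[of _ "\<lambda>v. r2 v + s2 v"], rule allI)
      fix v
      show "E (v, F) + E' (v, F) = E (vec 0 0 0 (X3 v), F) + E' (vec 0 0 0 (X3 v), F) +
        X0 v * (r0 v + s0 v) + X1 v * (r1 v + s1 v) + X2 v * (r2 v + s2 v)"
        using r(4)[of v] s(4)[of v] by (simp add: algebra_simps)
    qed (intro Vpoly_intros r s)+
  qed
  then show ?thesis using that by blast
qed

text \<open>This excludes \<open>f\<^sub>2\<close>. The surface of \<open>F\<^sub>0\<close> is
  singular there, so tangency says nothing. At \<open>v = w f\<^sub>2\<close> the choices become
  \<open>e = w e\<^sub>1\<close> and \<open>f = w f\<^sub>1\<close>, with restriction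
  \<open>u w^d + s u^(d-1) w^d\<close>, which is the diagonal case.\<close>

lemma power_X3_mod_fiber_ideal:
  assumes md: "2 \<le> m" "m \<le> d" "3 \<le> d"
  obtains N r\<^sub>0 r\<^sub>1 r\<^sub>2 where "r\<^sub>0 \<in> Vpoly" "r\<^sub>1 \<in> Vpoly" "r\<^sub>2 \<in> Vpoly"
    "(\<lambda>v. X3 v ^ N + X0 v * r\<^sub>0 v + X1 v * r\<^sub>1 v + X2 v * r\<^sub>2 v) \<in> fiber_ideal m d"
proof -
  define e where "e = (\<lambda>v. vec (X3 v) 0 (- X1 v) 0)"
  define f where "f = (\<lambda>v. vec 0 (X3 v) (X0 v) 0)"
  define n where "n = d - 1"
  define \<kappa> where "\<kappa> = (\<lambda>r. if r < d - 1 then d - 1 + r else r - (d - 1) + 1)"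
  have n: "d = Suc n" "n \<ge> 2" using md by (auto simp: n_def)
  have F: "F\<^sub>0 d \<in> S d" using F\<^sub>0_form md by simp
  have neg: "(\<lambda>v. - X1 v) \<in> Vpoly" using Vpoly_intros(3)[OF Vpoly_intros(1)[of "-1"] Vpoly_coord(2)] by simp
  let ?s = "\<lambda>v. sylvester d \<kappa> (jet d 0 (F\<^sub>0 d) v (e v) (f v)) (jet d 1 (F\<^sub>0 d) v (e v) (f v))"
  have J: "?s \<in> fiber_ideal m d"
    by (rule sylvester_in_fiber_ideal) (use md in \<open>simp_all add: e_def f_def Vpoly_intros neg omega_coord\<close>)
  then obtain E where E: "E \<in> bip" "?s = (\<lambda>v. E (v, F\<^sub>0 d))" by (auto simp: fiber_ideal_def compat_ideal_def)
  obtain r\<^sub>0 r\<^sub>1 r\<^sub>2 where r: "r\<^sub>0 \<in> Vpoly" "r\<^sub>1 \<in> Vpoly" "r\<^sub>2 \<in> Vpoly"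
    "\<And>v. E (v, F\<^sub>0 d) = E (vec 0 0 0 (X3 v), F\<^sub>0 d) + X0 v * r\<^sub>0 v + X1 v * r\<^sub>1 v + X2 v * r\<^sub>2 v"
    using bip_mod_X0_X1_X2[OF E(1)] by metis
  have "?s (vec 0 0 0 w) = (w ^ d) ^ (2 * d - 3)" for w
  proof -
    let ?v = "vec 0 0 0 w"
    have val: "F\<^sub>0 d (e ?v + smul u (f ?v) + smul s ?v) = poly [:u * w ^ d, u ^ n * w ^ d:] s" for u s
      using n by (simp add: F\<^sub>0_def e_def f_def power_mult_distrib algebra_simps)
    have deg: "degree [:u * w ^ d, u ^ n * w ^ d:] \<le> d" for u using n by (auto simp: degree_pCons_eq_if)
    have "jet d 0 (F\<^sub>0 d) ?v (e ?v) (f ?v) k = (if k = 1 then w ^ d else 0)" for k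
    proof -
      have "jet d 0 (F\<^sub>0 d) ?v (e ?v) (f ?v) k = coefd d k (\<lambda>u. u * w ^ d)"
        unfolding jet_def coefd_eq[OF deg val] by simp
      also have "\<dots> = coeff [:0, w ^ d:] k" by (rule coefd_eq) (use n in auto)
      finally show ?thesis by (auto simp: coeff_pCons split: nat.splits)
    qed
    moreover have "jet d 1 (F\<^sub>0 d) ?v (e ?v) (f ?v) k = (if k = d - 1 then w ^ d else 0)" for k
    proof -
      have "jet d 1 (F\<^sub>0 d) ?v (e ?v) (f ?v) k = coefd d k (\<lambda>u. u ^ n * w ^ d)"
        unfolding jet_def coefd_eq[OF deg val] by simp
      also have "\<dots> = coeff (monom (w ^ d) n) k"
        by (rule coefd_eq) (use n degree_monom_le[of "w ^ d" n] in \<open>auto simp: poly_monom mult.commute\<close>)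
      finally show ?thesis by (simp add: n_def)
    qed
    ultimately show ?thesis unfolding \<kappa>_def by (rule sylvester_diagonal[OF md(3)])
  qed
  then have "E (vec 0 0 0 (X3 v), F\<^sub>0 d) = X3 v ^ (d * (2 * d - 3))" for v
    using fun_cong[OF E(2), of "vec 0 0 0 (X3 v)"] by (simp add: power_mult)
  then have "E (v, F\<^sub>0 d) = X3 v ^ (d * (2 * d - 3)) + X0 v * r\<^sub>0 v + X1 v * r\<^sub>1 v + X2 v * r\<^sub>2 v" for v
    using r(4)[of v] by simp
  then have "(\<lambda>v. X3 v ^ (d * (2 * d - 3)) + X0 v * r\<^sub>0 v + X1 v * r\<^sub>1 v + X2 v * r\<^sub>2 v) \<in> fiber_ideal m d"
    using J E(2) by simp
  then show ?thesis using that r by blast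
qed


text \<open>Three tangent directions combine with the nilpotency of \<open>X1 X2\<close> to make
  \<open>X1\<close>, then \<open>X2\<close>, then \<open>X0 X3\<close> nilpotent. Only
  \<open>e\<^sub>1\<close> and \<open>f\<^sub>2\<close> are left as possible points, and the
  relation for the power of \<open>X3\<close> removes the second.\<close>

lemma basic_nilpotents:
  assumes md: "2 \<le> m" "m \<le> d" "3 \<le> d" and n: "d = Suc n" "n = Suc n'"
  shows "nilpotent m d X1" "nilpotent m d X2" "nilpotent m d X3"
proof -
  have d0: "of_nat d \<noteq> (0::complex)" using md by simp
  have e: "(\<lambda>v. X1 v * X1 v ^ n + of_nat n * X2 v * X0 v ^ n' * X1 v) \<in> fiber_ideal m d"
    using tangent_in_fiber_ideal[of "\<lambda>v. vec (X2 v) 0 0 (X1 v)", OF _ _ _ _ _ md(1,2) n]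
    by (simp add: Vpoly_intros omega_coord algebra_simps)
  have "nilpotent m d (\<lambda>v. (- of_nat n * X0 v ^ n') * (X1 v * X2 v))"
    by (rule nilpotent_mult[OF _ nilpotent_X1_X2[OF md]]) (intro Vpoly_intros)
  from nilpotent_add[OF nilpotent_fiber_ideal[OF e] this] have "nilpotent m d (\<lambda>v. X1 v ^ d)"
    by (simp add: n algebra_simps)
  then show 1: "nilpotent m d X1" by (rule nilpotent_power[OF Vpoly_coord(2)])
  have "(\<lambda>v. X3 v * X1 v ^ n + of_nat d * X2 v * X2 v ^ n) \<in> fiber_ideal m d"
    using tangent_in_fiber_ideal[of "\<lambda>v. vec 0 0 (X2 v) (X3 v)", OF _ _ _ _ _ md(1,2) n]
    by (simp add: Vpoly_intros omega_coord algebra_simps)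
  moreover have "nilpotent m d (\<lambda>v. ((- 1) * X3 v * X1 v ^ n') * X1 v)"
    by (rule nilpotent_mult[OF _ 1]) (intro Vpoly_intros)
  ultimately have "nilpotent m d (\<lambda>v. (X3 v * X1 v ^ n + of_nat d * X2 v * X2 v ^ n) + ((- 1) * X3 v * X1 v ^ n') * X1 v)"
    by (intro nilpotent_add[OF nilpotent_fiber_ideal])
  then have "nilpotent m d (\<lambda>v. of_nat d * X2 v ^ d)" by (simp add: n algebra_simps)
  then have "nilpotent m d (\<lambda>v. (1 / of_nat d) * (of_nat d * X2 v ^ d))" by (rule nilpotent_mult[rotated]) (rule Vpoly_intros)
  moreover have "(\<lambda>v. (1 / of_nat d) * (of_nat d * X2 v ^ d)) = (\<lambda>v. X2 v ^ d)"
    using d0 by (intro ext) simp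
  ultimately have "nilpotent m d (\<lambda>v. X2 v ^ d)" by (simp only:)
  then show 2: "nilpotent m d X2" by (rule nilpotent_power[OF Vpoly_coord(3)])
  have "(\<lambda>v. X3 v * X0 v ^ n + of_nat n * X3 v * X1 v ^ n' * X3 v + of_nat d * X0 v * X2 v ^ n) \<in> fiber_ideal m d"
    using tangent_in_fiber_ideal[of "\<lambda>v. vec 0 (X3 v) (X0 v) 0", OF _ _ _ _ _ md(1,2) n]
    by (simp add: Vpoly_intros omega_coord algebra_simps)
  moreover have "n' = Suc (n' - 1)" using md n by simp
  then obtain n'' where n'': "n' = Suc n''" by blast
  have "nilpotent m d (\<lambda>v. (- of_nat n * X3 v * X1 v ^ n'' * X3 v) * X1 v)"
    by (rule nilpotent_mult[OF _ 1]) (intro Vpoly_intros)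
  moreover have "nilpotent m d (\<lambda>v. (- of_nat d * X0 v * X2 v ^ n') * X2 v)"
    by (rule nilpotent_mult[OF _ 2]) (intro Vpoly_intros)
  ultimately have "nilpotent m d (\<lambda>v. (X3 v * X0 v ^ n + of_nat n * X3 v * X1 v ^ n' * X3 v + of_nat d * X0 v * X2 v ^ n) +
     ((- of_nat n * X3 v * X1 v ^ n'' * X3 v) * X1 v + (- of_nat d * X0 v * X2 v ^ n') * X2 v))"
    by (intro nilpotent_add[OF nilpotent_fiber_ideal nilpotent_add])
  then have "nilpotent m d (\<lambda>v. X3 v * X0 v ^ n)" by (simp add: n n'' algebra_simps)
  then have "nilpotent m d (\<lambda>v. X3 v ^ n' * (X3 v * X0 v ^ n))" by (rule nilpotent_mult[rotated]) (intro Vpoly_intros)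
  then have "nilpotent m d (\<lambda>v. (X0 v * X3 v) ^ n)" by (simp add: n power_mult_distrib mult_ac)
  then have 03: "nilpotent m d (\<lambda>v. X0 v * X3 v)" by (rule nilpotent_power[rotated]) (intro Vpoly_intros)
  obtain N r\<^sub>0 r\<^sub>1 r\<^sub>2 where r: "r\<^sub>0 \<in> Vpoly" "r\<^sub>1 \<in> Vpoly" "r\<^sub>2 \<in> Vpoly"
    "(\<lambda>v. X3 v ^ N + X0 v * r\<^sub>0 v + X1 v * r\<^sub>1 v + X2 v * r\<^sub>2 v) \<in> fiber_ideal m d"
    by (rule power_X3_mod_fiber_ideal[OF md]) (rule that)
  \<comment> \<open>Multiplying the relation by \<open>X3\<close> turns its \<open>X0\<close> term
    into a multiple of the nilpotent \<open>X0 X3\<close>; the other two terms contain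
    \<open>X1\<close> or \<open>X2\<close>.\<close>
  have "nilpotent m d (\<lambda>v. X3 v * (X3 v ^ N + X0 v * r\<^sub>0 v + X1 v * r\<^sub>1 v + X2 v * r\<^sub>2 v) +
    ((- 1 * r\<^sub>0 v) * (X0 v * X3 v) + ((- 1 * X3 v * r\<^sub>1 v) * X1 v + (- 1 * X3 v * r\<^sub>2 v) * X2 v)))"
    by (intro nilpotent_add[OF nilpotent_mult[OF _ nilpotent_fiber_ideal[OF r(4)]] nilpotent_add[OF nilpotent_mult[OF _ 03] nilpotent_add[OF nilpotent_mult[OF _ 1] nilpotent_mult[OF _ 2]]]]
        Vpoly_intros r)
  then have "nilpotent m d (\<lambda>v. X3 v ^ Suc N)" by (simp add: algebra_simps)
  then show "nilpotent m d X3" by (rule nilpotent_power[OF Vpoly_coord(4)])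
qed

section \<open>All but one monomial of high degree\<close>

lemma fiber_ideal_mon_reduce:
  assumes "(\<lambda>v. p v + q v) \<in> fiber_ideal m d" "r \<in> Vpoly" "(\<lambda>v. r v * q v) \<in> fiber_ideal m d"
  shows "(\<lambda>v. r v * p v) \<in> fiber_ideal m d"
proof -
  have "(\<lambda>v. r v * (p v + q v) + (- 1) * (r v * q v)) \<in> fiber_ideal m d"
    by (intro fiber_ideal_add fiber_ideal_mult[OF assms(2,1)] fiber_ideal_mult[OF _ assms(3)] Vpoly_intros)
  then show ?thesis by (simp add: algebra_simps)
qed

lemma fiber_ideal_scale: "p \<in> fiber_ideal m d \<Longrightarrow> (\<lambda>v. c * p v) \<in> fiber_ideal m d"
  by (rule fiber_ideal_mult) (rule Vpoly_intros)

text \<open>This is where the solution \<open>e\<^sub>1\<close> is seen to be simple: by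
  \<open>t1\<close>, \<open>t2\<close>, \<open>t3\<close>, a factor \<open>X0^n Xi\<close> with
  \<open>i \<ge> 1\<close> can be traded for terms of degree at least \<open>n \<ge> 2\<close> in
  \<open>X1\<close>, \<open>X2\<close>, \<open>X3\<close>. Each trade raises the degree in these
  variables and costs at most \<open>n\<close> powers of \<open>X0\<close>; nilpotency ends the
  process.\<close>

lemma monomials_in_fiber_ideal:
  assumes md: "2 \<le> m" "m \<le> d" "3 \<le> d"
  obtains k where "k \<ge> 1" "\<And>\<beta>. \<beta> \<in> Exp k \<Longrightarrow> \<beta> \<noteq> (k, 0, 0, 0) \<Longrightarrow> mon \<beta> \<in> fiber_ideal m d"
proof -
  obtain n where n: "d = Suc n" using md by (cases d) auto
  obtain n' where n': "n = Suc n'" using md n by (cases n) auto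
  have n2: "n \<ge> 2" using md n by simp
  have d0: "of_nat d \<noteq> (0::complex)" using md by simp
  note nil = basic_nilpotents[OF md n n']
  obtain N\<^sub>1 N\<^sub>2 N\<^sub>3 where N: "(\<lambda>v. X1 v ^ N\<^sub>1) \<in> fiber_ideal m d" "(\<lambda>v. X2 v ^ N\<^sub>2) \<in> fiber_ideal m d" "(\<lambda>v. X3 v ^ N\<^sub>3) \<in> fiber_ideal m d"
    using nil by (auto simp: nilpotent_def)
  \<comment> \<open>A monomial of degree at least \<open>K\<close> in \<open>X1\<close>,
    \<open>X2\<close>, \<open>X3\<close> contains one of the three powers already in the
    ideal.\<close>
  define K where "K = N\<^sub>1 + N\<^sub>2 + N\<^sub>3 + 1"
  have big: "mon (a, b, c, e) \<in> fiber_ideal m d" if "b + c + e \<ge> K" for a b c e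
  proof -
    have "b \<ge> N\<^sub>1 \<or> c \<ge> N\<^sub>2 \<or> e \<ge> N\<^sub>3" using that unfolding K_def by linarith
    then consider "b \<ge> N\<^sub>1" | "c \<ge> N\<^sub>2" | "e \<ge> N\<^sub>3" by blast
    moreover have power_split: "x ^ j = x ^ (j - i) * x ^ i" if "i \<le> j" for x :: complex and i j
      using that by (simp add: power_add[symmetric])
    ultimately show ?thesis
    proof cases
      case 1
      from fiber_ideal_mult[OF mon_Vpoly N(1), of "(a, b - N\<^sub>1, c, e)"] show ?thesis
        using 1 by (simp add: mon_def mult_ac power_split[of N\<^sub>1 b])
    next
      case 2
      from fiber_ideal_mult[OF mon_Vpoly N(2), of "(a, b, c - N\<^sub>2, e)"] show ?thesis
        using 2 by (simp add: mon_def mult_ac power_split[of N\<^sub>2 c])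
    next
      case 3
      from fiber_ideal_mult[OF mon_Vpoly N(3), of "(a, b, c, e - N\<^sub>3)"] show ?thesis
        using 3 by (simp add: mon_def mult_ac power_split[of N\<^sub>3 e])
    qed
  qed
  have t1: "(\<lambda>v. of_nat d * (X0 v ^ n * X1 v) + of_nat n * (X1 v ^ n * X3 v)) \<in> fiber_ideal m d"
    using tangent_in_fiber_ideal[of "\<lambda>v. vec (X0 v) (X1 v) 0 0", OF _ _ _ _ _ md(1,2) n n']
    by (simp add: Vpoly_intros omega_coord algebra_simps n n')
  have t2: "(\<lambda>v. X0 v ^ n * X2 v + (of_nat n * (X1 v ^ n' * X2 v * X3 v) - X0 v * X1 v ^ n)) \<in> fiber_ideal m d"
  proof -
    have "(\<lambda>v. - X0 v) \<in> Vpoly" using Vpoly_intros(3)[OF Vpoly_intros(1)[of "-1"] Vpoly_coord(1)] by simp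
    then show ?thesis
    using tangent_in_fiber_ideal[of "\<lambda>v. vec 0 (X2 v) 0 (- X0 v)", OF _ _ _ _ _ md(1,2) n n']
    by (simp add: Vpoly_intros omega_coord algebra_simps)
  qed
  have t3: "(\<lambda>v. X0 v ^ n * X3 v + (of_nat n * (X1 v ^ n' * X3 v ^ 2) + of_nat d * (X0 v * X2 v ^ n))) \<in> fiber_ideal m d"
    using tangent_in_fiber_ideal[of "\<lambda>v. vec 0 (X3 v) (X0 v) 0", OF _ _ _ _ _ md(1,2) n n']
    by (simp add: Vpoly_intros omega_coord algebra_simps power2_eq_square)
  have small: "b + c + e \<ge> 1 \<Longrightarrow> a \<ge> n * (K - (b + c + e)) \<Longrightarrow> mon (a, b, c, e) \<in> fiber_ideal m d" for a b c e
  proof (induction "K - (b + c + e)" arbitrary: a b c e rule: less_induct)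
    case less
    show ?case
    proof (cases "b + c + e \<ge> K")
      case True then show ?thesis by (rule big)
    next
      case False
      define t where "t = b + c + e"
      have a: "a \<ge> n + n * (K - Suc t)"
      proof -
        have "K - t = Suc (K - Suc t)" using False by (simp add: t_def)
        then show ?thesis using less.prems(2) by (simp add: t_def)
      qed
      have IH: "mon (a', b', c', e') \<in> fiber_ideal m d" if "b' + c' + e' > t" "a' \<ge> a - n" for a' b' c' e'
      proof (rule less.hyps)
        show "K - (b' + c' + e') < K - (b + c + e)" using that False by (simp add: t_def)
        show "1 \<le> b' + c' + e'" using that by simp
        have "n * (K - (b' + c' + e')) \<le> n * (K - Suc t)" using that by (intro mult_le_mono) auto
        then show "n * (K - (b' + c' + e')) \<le> a'" using a that by linarith
      qed
      have an: "X0 v ^ a = X0 v ^ (a - n) * X0 v ^ n" for v using a by (simp add: power_add[symmetric])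
      consider b' where "b = Suc b'" | c' where "c = Suc c'" | e' where "e = Suc e'"
        using less.prems(1) by (metis One_nat_def add_is_0 not0_implies_Suc not_one_le_zero)
      then show ?thesis
      proof cases
        case 1
        have "(\<lambda>v. mon (a - n, b', c, e) v * (of_nat d * (X0 v ^ n * X1 v))) \<in> fiber_ideal m d"
        proof (rule fiber_ideal_mon_reduce[OF t1 mon_Vpoly])
          have "mon (a - n, b' + n, c, Suc e) \<in> fiber_ideal m d" by (rule IH) (use 1 n2 in \<open>auto simp: t_def\<close>)
          from fiber_ideal_scale[OF this, of "of_nat n"]
          show "(\<lambda>v. mon (a - n, b', c, e) v * (of_nat n * (X1 v ^ n * X3 v))) \<in> fiber_ideal m d"
            by (simp add: mon_def power_add mult_ac)
        qed
        from fiber_ideal_scale[OF this, of "1 / of_nat d"] show ?thesis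
          using d0 by (simp add: mon_def 1 an mult_ac)
      next
        case 2
        have "(\<lambda>v. mon (a - n, b, c', e) v * (X0 v ^ n * X2 v)) \<in> fiber_ideal m d"
        proof (rule fiber_ideal_mon_reduce[OF t2 mon_Vpoly])
          have "mon (a - n, b + n', Suc c', Suc e) \<in> fiber_ideal m d" by (rule IH) (use 2 n2 n' in \<open>auto simp: t_def\<close>)
          moreover have "mon (Suc (a - n), b + n, c', e) \<in> fiber_ideal m d" by (rule IH) (use 2 n2 n' in \<open>auto simp: t_def\<close>)
          ultimately have "(\<lambda>v. of_nat n * mon (a - n, b + n', Suc c', Suc e) v + (- 1) * mon (Suc (a - n), b + n, c', e) v) \<in> fiber_ideal m d"
            by (intro fiber_ideal_add fiber_ideal_scale)
          then show "(\<lambda>v. mon (a - n, b, c', e) v * (of_nat n * (X1 v ^ n' * X2 v * X3 v) - X0 v * X1 v ^ n)) \<in> fiber_ideal m d"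
            by (simp add: mon_def power_add algebra_simps)
        qed
        then show ?thesis by (simp add: mon_def 2 an mult_ac)
      next
        case 3
        have "(\<lambda>v. mon (a - n, b, c, e') v * (X0 v ^ n * X3 v)) \<in> fiber_ideal m d"
        proof (rule fiber_ideal_mon_reduce[OF t3 mon_Vpoly])
          have "mon (a - n, b + n', c, e' + 2) \<in> fiber_ideal m d" by (rule IH) (use 3 n2 n' in \<open>auto simp: t_def\<close>)
          moreover have "mon (Suc (a - n), b, c + n, e') \<in> fiber_ideal m d" by (rule IH) (use 3 n2 n' in \<open>auto simp: t_def\<close>)
          ultimately have "(\<lambda>v. of_nat n * mon (a - n, b + n', c, e' + 2) v + of_nat d * mon (Suc (a - n), b, c + n, e') v) \<in> fiber_ideal m d"
            by (intro fiber_ideal_add fiber_ideal_scale)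
          then show "(\<lambda>v. mon (a - n, b, c, e') v * (of_nat n * (X1 v ^ n' * X3 v ^ 2) + of_nat d * (X0 v * X2 v ^ n))) \<in> fiber_ideal m d"
            by (simp add: mon_def power_add power2_eq_square algebra_simps)
        qed
        then show ?thesis by (simp add: mon_def 3 an mult_ac)
      qed
    qed
  qed
  show ?thesis
  \<comment> \<open>In this degree a monomial with fewer than \<open>K\<close> factors other than
    \<open>X0\<close> has more than \<open>n * K\<close> factors \<open>X0\<close>, enough for all
    the trades.\<close>
  proof (rule that[of "n * K + K"])
    show "1 \<le> n * K + K" by (simp add: K_def)
    fix \<beta> assume \<beta>: "\<beta> \<in> Exp (n * K + K)" "\<beta> \<noteq> (n * K + K, 0, 0, 0)"
    obtain a b c e where abce: "\<beta> = (a, b, c, e)" by (cases \<beta>)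
    have sum: "a + (b + c + e) = n * K + K" using \<beta>(1) abce by (simp add: Exp_def mdeg_def)
    then have "b + c + e \<ge> 1" using \<beta>(2) abce by (cases "b + c + e = 0") auto
    moreover have "b + c + e \<ge> K \<or> a \<ge> n * (K - (b + c + e))"
    proof (cases "b + c + e \<ge> K")
      case False
      have "n * (K - (b + c + e)) \<le> n * K" by (intro mult_le_mono) auto
      then show ?thesis using sum False by linarith
    qed simp
    ultimately show "mon \<beta> \<in> fiber_ideal m d" using big small abce by blast
  qed
qed

text \<open>
  Cramer's rule for the monomials of degree \<open>k\<close> in the coordinates of the polar point: their
  system is invertible at \<open>F\<^sub>0\<close>, hence generically, and its solution is polynomial in \<open>F\<close>.
\<close>

lemma generic_polar_point:
  assumes md: "2 \<le> m" "m \<le> d" "3 \<le> d"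
  obtains D \<nu> where "D \<in> poly_funs fscale" "D (F\<^sub>0 d) \<noteq> 0"
    "(\<lambda>F. X0 (\<nu> F)) \<in> poly_funs fscale" "(\<lambda>F. X1 (\<nu> F)) \<in> poly_funs fscale"
    "(\<lambda>F. X2 (\<nu> F)) \<in> poly_funs fscale" "(\<lambda>F. X3 (\<nu> F)) \<in> poly_funs fscale"
    "\<And>v F. compat m d v F \<Longrightarrow> v \<noteq> 0 \<Longrightarrow> D F \<noteq> 0 \<Longrightarrow> \<exists>c. c \<noteq> 0 \<and> \<nu> F = smul c v"
proof -
  obtain k where k: "k \<ge> 1" "\<And>\<beta>. \<beta> \<in> Exp k \<Longrightarrow> \<beta> \<noteq> (k, 0, 0, 0) \<Longrightarrow> mon \<beta> \<in> fiber_ideal m d"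
    by (rule monomials_in_fiber_ideal[OF md]) (rule that)
  let ?top = "(k, 0, 0, 0) :: exps"
  have top: "?top \<in> Exp k" by (simp add: Exp_def mdeg_def)
  define P where "P = (\<lambda>\<beta> C. (\<forall>\<gamma>. C \<gamma> \<in> poly_funs fscale) \<and> (\<forall>\<gamma>\<in>Exp k. C \<gamma> (F\<^sub>0 d) = (if \<gamma> = \<beta> then 1 else 0)) \<and>
      (\<forall>v F. compat m d v F \<longrightarrow> (\<Sum>\<gamma>\<in>Exp k. C \<gamma> F * mon \<gamma> v) = 0))"
  have "\<exists>C. P \<beta> C"
    if \<beta>: "\<beta> \<in> Exp k" "\<beta> \<noteq> ?top" for \<beta>
  proof -
    obtain E where E: "E \<in> bip" "\<And>v F. compat m d v F \<Longrightarrow> E (v, F) = 0" "\<And>v. mon \<beta> v = E (v, F\<^sub>0 d)"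
      using k(2)[OF \<beta>] unfolding fiber_ideal_def compat_ideal_def by (auto dest: fun_cong)
    obtain A C where A: "finite A" and C: "\<And>\<gamma>. C \<gamma> \<in> poly_funs fscale" and CA: "\<And>\<gamma> F. \<gamma> \<notin> A \<Longrightarrow> C \<gamma> F = 0"
      and EC: "\<And>v F. E (v, F) = (\<Sum>\<gamma>\<in>A. C \<gamma> F * mon \<gamma> v)"
      by (rule bip_expand[OF E(1)]) (rule that)
    \<comment> \<open>At \<open>F\<^sub>0\<close> the equation is the monomial
      \<open>\<beta>\<close> itself, so by independence its coefficients form a row of the identity
      matrix.\<close>
    have "C \<gamma> (F\<^sub>0 d) = (if \<gamma> = \<beta> then 1 else 0)" for \<gamma>
    proof -
      let ?B = "insert \<gamma> (insert \<beta> A)"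
      have "(\<Sum>\<delta>\<in>?B. (C \<delta> (F\<^sub>0 d) - (if \<delta> = \<beta> then 1 else 0)) * mon \<delta> v) = 0" for v
      proof -
        have "(\<Sum>\<delta>\<in>?B. C \<delta> (F\<^sub>0 d) * mon \<delta> v) = (\<Sum>\<delta>\<in>A. C \<delta> (F\<^sub>0 d) * mon \<delta> v)"
          by (rule sum.mono_neutral_right) (use A CA in auto)
        moreover have "(\<Sum>\<delta>\<in>?B. (if \<delta> = \<beta> then 1 else 0) * mon \<delta> v) = (\<Sum>\<delta>\<in>{\<beta>}. mon \<delta> v)"
          by (rule sum.mono_neutral_cong_right) (use A in auto)
        ultimately show ?thesis using E(3)[of v] EC[of v "F\<^sub>0 d"] by (simp only: left_diff_distrib sum_subtractf) simp
      qed
      from mon_independent[OF _ this, of \<gamma>] A have "C \<gamma> (F\<^sub>0 d) - (if \<gamma> = \<beta> then 1 else 0) = 0" by simp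
      then show ?thesis by simp
    qed
    moreover have "(\<Sum>\<gamma>\<in>Exp k. C \<gamma> F * mon \<gamma> v) = 0" if vF: "compat m d v F" for v F
    proof -
      define M where "M = Max (insert k (mdeg ` A))"
      have M: "mdeg \<gamma> \<le> M" if "\<gamma> \<in> A" for \<gamma> using that A by (simp add: M_def)
      have kM: "k \<le> M" using A by (simp add: M_def)
      \<comment> \<open>\<open>E\<close> need not be homogeneous in \<open>v\<close>, but
        compatibility is unchanged under scaling \<open>v\<close>, so its part of degree
        \<open>k\<close> vanishes on its own.\<close>
      have "(\<Sum>j\<le>M. t ^ j * (\<Sum>\<gamma> | \<gamma> \<in> A \<and> mdeg \<gamma> = j. C \<gamma> F * mon \<gamma> v)) = 0" if t: "t \<noteq> 0" for t
      proof -
        have "(\<Sum>j\<le>M. t ^ j * (\<Sum>\<gamma> | \<gamma> \<in> A \<and> mdeg \<gamma> = j. C \<gamma> F * mon \<gamma> v)) =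
          (\<Sum>j\<le>M. \<Sum>\<gamma> | \<gamma> \<in> A \<and> mdeg \<gamma> = j. C \<gamma> F * mon \<gamma> (smul t v))"
          by (intro sum.cong) (auto simp: sum_distrib_left mon_smul mult_ac)
        also have "\<dots> = (\<Sum>\<gamma>\<in>A. C \<gamma> F * mon \<gamma> (smul t v))"
          by (rule sum.group) (use A M in auto)
        also have "\<dots> = 0" using E(2)[OF compat_smul[OF vF t]] EC by simp
        finally show ?thesis .
      qed
      from sum_powers_eq_0[OF this kM] have "(\<Sum>\<gamma> | \<gamma> \<in> A \<and> mdeg \<gamma> = k. C \<gamma> F * mon \<gamma> v) = 0" .
      moreover have "(\<Sum>\<gamma> | \<gamma> \<in> A \<and> mdeg \<gamma> = k. C \<gamma> F * mon \<gamma> v) = (\<Sum>\<gamma>\<in>Exp k. C \<gamma> F * mon \<gamma> v)"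
      proof (rule sum.mono_neutral_left)
        show "\<forall>\<gamma>\<in>Exp k - {\<gamma> \<in> A. mdeg \<gamma> = k}. C \<gamma> F * mon \<gamma> v = 0"
        proof
          fix \<gamma> assume "\<gamma> \<in> Exp k - {\<gamma> \<in> A. mdeg \<gamma> = k}"
          then have "\<gamma> \<notin> A" unfolding Exp_def by blast
          then show "C \<gamma> F * mon \<gamma> v = 0" using CA by simp
        qed
      qed (use finite_Exp in \<open>auto simp: Exp_def\<close>)
      ultimately show ?thesis by simp
    qed
    ultimately have "P \<beta> C" unfolding P_def using C by blast
    then show ?thesis by (intro exI[where x=C])
  qed
  then have "\<forall>\<beta>\<in>Exp k - {?top}. \<exists>C. P \<beta> C" by blast
  then obtain C where "\<forall>\<beta>\<in>Exp k - {?top}. P \<beta> (C \<beta>)" by (rule bchoice[THEN exE])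
  then have C: "\<And>\<beta> \<gamma>. \<beta> \<in> Exp k \<Longrightarrow> \<beta> \<noteq> ?top \<Longrightarrow> C \<beta> \<gamma> \<in> poly_funs fscale"
    "\<And>\<beta> \<gamma>. \<beta> \<in> Exp k \<Longrightarrow> \<beta> \<noteq> ?top \<Longrightarrow> \<gamma> \<in> Exp k \<Longrightarrow> C \<beta> \<gamma> (F\<^sub>0 d) = (if \<gamma> = \<beta> then 1 else 0)"
    "\<And>\<beta> v F. \<beta> \<in> Exp k \<Longrightarrow> \<beta> \<noteq> ?top \<Longrightarrow> compat m d v F \<Longrightarrow> (\<Sum>\<gamma>\<in>Exp k. C \<beta> \<gamma> F * mon \<gamma> v) = 0"
    unfolding P_def by blast+
  let ?B = "Exp k - {?top}"
  define n where "n = card ?B"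
  obtain h where h: "bij_betw h {..<n} ?B"
    using ex_bij_betw_nat_finite[of ?B] finite_Exp by (auto simp: n_def lessThan_atLeast0)
  have hB: "h i \<in> Exp k" "h i \<noteq> ?top" if "i < n" for i using bij_betwE[OF h] that by auto
  have hinj: "h i = h j \<longleftrightarrow> i = j" if "i < n" "j < n" for i j
    using h that by (auto simp: bij_betw_def inj_on_def)
  obtain D M where D: "D \<in> poly_funs fscale" "\<And>i j. i < n \<Longrightarrow> j < n \<Longrightarrow> (\<lambda>F. M F i j) \<in> poly_funs fscale" "D (F\<^sub>0 d) = 1"
    "\<And>F z b i. (\<And>i. i < n \<Longrightarrow> (\<Sum>j<n. C (h i) (h j) F * z j) = b i) \<Longrightarrow> i < n \<Longrightarrow> D F * z i = (\<Sum>j<n. M F i j * b j)"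
  proof (rule function_ring_cramer[OF function_ring_poly_funs[of "fscale :: complex \<Rightarrow> ('v \<Rightarrow> complex) \<Rightarrow> _"],
      where n=n and a="\<lambda>F i j. C (h i) (h j) F" and x\<^sub>0="F\<^sub>0 d"])
    show "(\<lambda>F. C (h i) (h j) F) \<in> poly_funs fscale" if "i < n" "j < n" for i j
      using C(1)[OF hB[OF that(1)]] by simp
    show "C (h i) (h j) (F\<^sub>0 d) = (if i = j then 1 else 0)" if "i < n" "j < n" for i j
      using C(2)[OF hB[OF that(1)] hB(1)[OF that(2)]] hinj[OF that] by auto
    fix D M
    assume "D \<in> poly_funs fscale" "\<And>i j. i < n \<Longrightarrow> j < n \<Longrightarrow> (\<lambda>F. M F i j) \<in> poly_funs fscale" "D (F\<^sub>0 d) = 1"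
      "\<And>F z b i. (\<And>i. i < n \<Longrightarrow> (\<Sum>j<n. C (h i) (h j) F * z j) = b i) \<Longrightarrow> i < n \<Longrightarrow> D F * z i = (\<Sum>j<n. M F i j * b j)"
    then show thesis by (rule that)
  qed
  define ix where "ix = (\<lambda>\<beta>. the_inv_into {..<n} h \<beta>)"
  have ix: "ix \<beta> < n" "h (ix \<beta>) = \<beta>" if "\<beta> \<in> ?B" for \<beta>
    using h that unfolding ix_def bij_betw_def by (metis the_inv_into_into lessThan_iff order_refl, metis f_the_inv_into_f)
  \<comment> \<open>The column of \<open>X0^k\<close> is moved to the right-hand side;
    \<open>N \<beta> / D\<close> is then the ratio of the monomial \<open>\<beta>\<close> to
    \<open>X0^k\<close>.\<close>
  define N where "N = (\<lambda>\<beta> F. \<Sum>j<n. M F (ix \<beta>) j * (- C (h j) ?top F))"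
  have N: "N \<beta> \<in> poly_funs fscale" if "\<beta> \<in> ?B" for \<beta>
  proof -
    have "(\<lambda>F. - C (h j) ?top F) \<in> poly_funs fscale" if "j < n" for j
      using poly_funs.mult[OF poly_funs.const[of "-1"] C(1)[OF hB[OF that]], of ?top] by simp
    then show ?thesis unfolding N_def
      by (intro poly_funs_sum poly_funs.mult D(2) ix(1)[OF that]) auto
  qed
  have cramer: "D F * mon \<beta> v = N \<beta> F * X0 v ^ k" if vF: "compat m d v F" and \<beta>: "\<beta> \<in> ?B" for v F \<beta>
  proof -
    have "(\<Sum>j<n. C (h i) (h j) F * mon (h j) v) = - C (h i) ?top F * X0 v ^ k" if i: "i < n" for i
    proof -
      have "(\<Sum>\<gamma>\<in>Exp k. C (h i) \<gamma> F * mon \<gamma> v) = C (h i) ?top F * mon ?top v + (\<Sum>\<gamma>\<in>?B. C (h i) \<gamma> F * mon \<gamma> v)"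
        by (rule sum.remove[OF finite_Exp top])
      also have "(\<Sum>\<gamma>\<in>?B. C (h i) \<gamma> F * mon \<gamma> v) = (\<Sum>j<n. C (h i) (h j) F * mon (h j) v)"
        by (rule sum.reindex_bij_betw[OF h, symmetric])
      finally show ?thesis using C(3)[OF hB[OF i] vF] by (simp add: mon_def add_eq_0_iff)
    qed
    from D(4)[OF this ix(1)[OF \<beta>]] have "D F * mon \<beta> v = (\<Sum>j<n. M F (ix \<beta>) j * (- C (h j) ?top F * X0 v ^ k))"
      using ix(2)[OF \<beta>] by simp
    then show ?thesis by (simp add: N_def sum_distrib_right mult.assoc)
  qed
  let ?b1 = "(k - 1, 1, 0, 0) :: exps" and ?b2 = "(k - 1, 0, 1, 0) :: exps" and ?b3 = "(k - 1, 0, 0, 1) :: exps"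
  have b: "?b1 \<in> ?B" "?b2 \<in> ?B" "?b3 \<in> ?B" using k(1) by (auto simp: Exp_def mdeg_def)
  have c: "(0, k, 0, 0) \<in> ?B" "(0, 0, k, 0) \<in> ?B" "(0, 0, 0, k) \<in> ?B" using k(1) by (auto simp: Exp_def mdeg_def)
  \<comment> \<open>The monomials \<open>X0^k\<close> and \<open>X0^(k-1) Xi\<close> are the
    coordinates of \<open>v\<close> times the common factor \<open>X0^(k-1)\<close>, so their ratios
    give the point without extracting roots.\<close>
  define \<nu> where "\<nu> = (\<lambda>F. vec (D F) (N ?b1 F) (N ?b2 F) (N ?b3 F))"
  show ?thesis
  proof (rule that[of D \<nu>])
    show "D \<in> poly_funs fscale" "D (F\<^sub>0 d) \<noteq> 0" using D by auto
    show "(\<lambda>F. X0 (\<nu> F)) \<in> poly_funs fscale" "(\<lambda>F. X1 (\<nu> F)) \<in> poly_funs fscale"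
      "(\<lambda>F. X2 (\<nu> F)) \<in> poly_funs fscale" "(\<lambda>F. X3 (\<nu> F)) \<in> poly_funs fscale"
      using D(1) N[OF b(1)] N[OF b(2)] N[OF b(3)] by (simp_all add: \<nu>_def)
    fix v F assume vF: "compat m d v F" "v \<noteq> 0" "D F \<noteq> 0"
    \<comment> \<open>If \<open>X0 v\<close> vanished, Cramer's rule for the pure powers of degree
      \<open>k\<close> would make the other coordinates vanish too.\<close>
    have x0: "X0 v \<noteq> 0"
    proof
      assume 0: "X0 v = 0"
      obtain k' where "k = Suc k'" using k(1) by (cases k) auto
      then have "X1 v = 0" "X2 v = 0" "X3 v = 0"
        using cramer[OF vF(1) c(1)] cramer[OF vF(1) c(2)] cramer[OF vF(1) c(3)] vF(3) 0 k(1) by (auto simp: mon_def)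
      then have "v = vec 0 0 0 0" using vec_coord[of v] 0 by simp
      then show False using vF(2) by (simp add: vec_def)
    qed
    have kk: "X0 v ^ k = X0 v ^ (k - 1) * X0 v" using k(1) by (cases k) auto
    have "D F * X1 v = N ?b1 F * X0 v" "D F * X2 v = N ?b2 F * X0 v" "D F * X3 v = N ?b3 F * X0 v"
      using cramer[OF vF(1) b(1)] cramer[OF vF(1) b(2)] cramer[OF vF(1) b(3)] x0 by (auto simp: mon_def kk)
    then have "\<nu> F = smul (D F / X0 v) v"
      using x0 by (intro coord_eqI) (simp_all add: \<nu>_def field_simps)
    then show "\<exists>c. c \<noteq> 0 \<and> \<nu> F = smul c v" using vF(3) x0 by (intro exI[of _ "D F / X0 v"]) simp
  qed
qed

end

section \<open>The inverse of the incidence projection\<close>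

lemma poly_funs_comp_scale:
  assumes "vector_space s" "p \<in> poly_funs s" shows "(\<lambda>x. p (s c x)) \<in> poly_funs s"
  using assms(2)
proof (induction rule: poly_funs.induct)
  case (const a) show ?case by (rule poly_funs.const)
next
  case (linear \<phi>)
  have "(\<lambda>x. c * \<phi> x) \<in> poly_funs s" by (intro poly_funs.mult poly_funs.const poly_funs.linear linear)
  then show ?case by (simp add: linear_functional_scale[OF linear])
next
  case (add p q) show ?case by (rule poly_funs.add[OF add.IH])
next
  case (mult p q) show ?case by (rule poly_funs.mult[OF mult.IH])
qed

lemma linear_tscaleI:
  assumes "Vector_Spaces.linear fscale (*) \<phi>"
    and "\<And>z w. i (z + w) = i z + i w" "\<And>c z. i (tscale c z) = fscale c (i z)"
  shows "Vector_Spaces.linear tscale (*) (\<lambda>z. \<phi> (i z))"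
  using assms(2,3) linear_functional_add[OF assms(1)] linear_functional_scale[OF assms(1)] vector_space_tscale
  by (auto simp: Vector_Spaces.linear_def module_hom_def module_hom_axioms_def vector_space_def Modules.module_def
      algebra_simps)

lemma poly_funs_form_component: "p \<in> poly_funs fscale \<Longrightarrow> (\<lambda>z. p (snd (snd z))) \<in> poly_funs tscale"
proof (induction rule: poly_funs.induct)
  case (const c) show ?case by (rule poly_funs.const)
next
  case (linear \<phi>)
  show ?case by (rule poly_funs.linear[OF linear_tscaleI[OF linear]]) (auto simp: tscale_def split: prod.splits)
next
  case (add p q) show ?case by (rule poly_funs.add[OF add.IH])
next
  case (mult p q) show ?case by (rule poly_funs.mult[OF mult.IH])
qed

lemma coefd_scale: "coefd n j (\<lambda>s. c * g s) = c * coefd n j g"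
  by (simp add: coefd_def sum_distrib_left mult.left_commute)

lemma incidence_of_fscale: "c \<noteq> 0 \<Longrightarrow> incidence_of (l, q, fscale c F) = incidence_of (l, q, F)"
  by (simp add: incidence_of_def span_singleton_scale[OF vector_space_fscale])

context symplectic_basis
begin

lemma linear_eval_component:
  fixes a :: 'v
  shows "Vector_Spaces.linear tscale (*) (\<lambda>z. fst z a)"
proof -
  have "Vector_Spaces.linear fscale (*) (\<lambda>l :: 'v \<Rightarrow> complex. l a)"
    using vector_space_fscale
    by (auto simp: Vector_Spaces.linear_def module_hom_def module_hom_axioms_def vector_space_def Modules.module_def
        fscale_def algebra_simps)
  then show ?thesis
    by (rule linear_tscaleI[where i=fst]) (auto simp: tscale_def split: prod.splits)
qed

lemma bip_dual_vec: "E \<in> bip \<Longrightarrow> (\<lambda>z. E (dual_vec (fst z), snd (snd z))) \<in> poly_funs tscale"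
proof (rule bip_compose[OF _ function_ring_poly_funs])
  have e: "(\<lambda>z. fst z a) \<in> poly_funs tscale" for a :: 'v by (rule poly_funs.linear[OF linear_eval_component])
  have ne: "(\<lambda>z. - fst z a) \<in> poly_funs tscale" for a :: 'v
    using poly_funs.mult[OF poly_funs.const[of "-1"] e[of a]] by simp
  show "(\<lambda>z. X0 (dual_vec (fst z))) \<in> poly_funs tscale" "(\<lambda>z. X1 (dual_vec (fst z))) \<in> poly_funs tscale"
    "(\<lambda>z. X2 (dual_vec (fst z))) \<in> poly_funs tscale" "(\<lambda>z. X3 (dual_vec (fst z))) \<in> poly_funs tscale"
    using e ne by (simp_all add: dual_vec_def)
  show "(\<lambda>z. p (snd (snd z))) \<in> poly_funs tscale" if "p \<in> poly_funs fscale" for p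
    by (rule poly_funs_form_component[OF that])
qed

lemma admissible_fscale: "admissible m d v q F \<Longrightarrow> c \<noteq> 0 \<Longrightarrow> admissible m d v q (fscale c F)"
proof -
  assume a: "admissible m d v q F" and c: "c \<noteq> 0"
  then obtain g where g: "g \<in> S (d - m)" "\<And>x. \<omega> v x = 0 \<Longrightarrow> F x = q x * g x" by (auto simp: admissible_def)
  have "fscale c F \<in> S d" using a sym_forms_scale unfolding admissible_def fscale_def by blast
  moreover have "fscale c F \<noteq> 0" using a c by (auto simp: admissible_def)
  moreover have "\<exists>g\<in>S (d - m). \<forall>x. \<omega> v x = 0 \<longrightarrow> fscale c F x = q x * g x"
    by (rule bexI[of _ "\<lambda>x. c * g x"]) (use g sym_forms_scale in \<open>auto simp: fscale_def\<close>)
  ultimately show ?thesis using a unfolding admissible_def by blast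
qed

section \<open>Recovering the cone from the form and its polar point\<close>

lemma cone_coefficient:
  assumes "admissible m d v q F" "m \<le> d"
  obtains \<kappa> where
    "\<And>c x. \<omega> v x = 0 \<Longrightarrow> coefd d (d - m) (\<lambda>s. F (x + smul s (smul c v))) = c ^ (d - m) * \<kappa> * q x"
proof -
  obtain g where g: "g \<in> S (d - m)" "\<And>x. \<omega> v x = 0 \<Longrightarrow> F x = q x * g x" using assms(1) by (auto simp: admissible_def)
  have inv: "\<And>x s. \<omega> v x = 0 \<Longrightarrow> q (x + smul s v) = q x" using assms(1) by (simp add: admissible_def)
  obtain G where "\<And>j. j \<le> d - m \<Longrightarrow> G j \<in> S (d - m - j)"
    and G: "\<And>x s. g (x + smul s v) = (\<Sum>j\<le>d - m. s ^ j * G j x)" "\<And>x. G (d - m) x = g v" and "G 0 = g"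
    by (rule taylor[OF g(1), of v]) (rule that)
  show ?thesis
  proof (rule that)
    fix c x assume x: "\<omega> v x = 0"
    let ?p = "poly_of_coeffs (d - m) (\<lambda>j. c ^ j * (q x * G j x))"
    have "F (x + smul s (smul c v)) = poly ?p s" for s
      using g(2)[of "x + smul (s * c) v"] inv[OF x, of "s * c"] x
      by (simp add: omega_simps G(1) poly_poly_of_coeffs sum_distrib_left power_mult_distrib mult_ac)
    then have "coefd d (d - m) (\<lambda>s. F (x + smul s (smul c v))) = coeff ?p (d - m)"
      by (intro coefd_eq order_trans[OF degree_poly_of_coeffs]) simp_all
    then show "coefd d (d - m) (\<lambda>s. F (x + smul s (smul c v))) = c ^ (d - m) * g v * q x"
      by (simp add: coeff_poly_of_coeffs G(2) mult_ac)
  qed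
qed

text \<open>A point of the hyperplane that is linear in \<open>v\<close>. The coefficient taken
  there is \<open>g v * q (test_vec v)\<close>, so its nonvanishing certifies
  \<open>g v \<noteq> 0\<close> by a polynomial in \<open>v\<close> and \<open>F\<close>
  alone.\<close>

definition test_vec :: "'v \<Rightarrow> 'v" where "test_vec v = vec 0 (X3 v) (X0 v) 0"

definition polar_coeff :: "nat \<Rightarrow> nat \<Rightarrow> 'v \<times> ('v \<Rightarrow> complex) \<Rightarrow> complex" where
  "polar_coeff m d z = coefd d (d - m) (\<lambda>s. formeval d (snd z) (test_vec (fst z) + smul s (fst z)))"

lemma test_vec_hyp: "\<omega> v (test_vec v) = 0"
  by (simp add: test_vec_def omega_coord)

lemma polar_coeff_bip: "polar_coeff m d \<in> bip"
  unfolding polar_coeff_def[abs_def]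
  by (intro coefd_bip formeval_compose_bip)
    (simp_all add: test_vec_def bip_coord function_ring_add[OF function_ring_bip] function_ring_mult[OF function_ring_bip]
      function_ring_const[OF function_ring_bip])

lemma polar_coeff_smul: "F \<in> S d \<Longrightarrow> polar_coeff m d (smul c v, F) = c ^ d * polar_coeff m d (v, F)"
proof -
  assume F: "F \<in> S d"
  have "F (test_vec (smul c v) + smul s (smul c v)) = c ^ d * F (test_vec v + smul s v)" for s
  proof -
    have "test_vec (smul c v) + smul s (smul c v) = smul c (test_vec v + smul s v)"
      by (rule coord_eqI) (simp_all add: test_vec_def algebra_simps)
    then show ?thesis using form_scale[OF F] by simp
  qed
  then show ?thesis by (simp add: polar_coeff_def formeval_eq[OF F] coefd_scale)
qed

definition cone_form :: "nat \<Rightarrow> nat \<Rightarrow> (('v \<Rightarrow> complex) \<Rightarrow> 'v) \<Rightarrow> ('v \<Rightarrow> complex) \<Rightarrow> 'v \<Rightarrow> complex" where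
  "cone_form m d \<nu> F x = coefd d (d - m) (\<lambda>s. formeval d F (x + smul s (\<nu> F)))"

text \<open>On the hyperplane the extracted coefficient is a constant times \<open>q\<close>, and
  its nonzero value at \<open>test_vec\<close> shows that the constant is nonzero; dividing
  \<open>g\<close> by it restores the factorisation.\<close>

lemma admissible_section:
  assumes a: "admissible m d v q F" and md: "m \<le> d" and \<nu>: "\<nu> F = smul c v" "c \<noteq> 0" and t: "polar_coeff m d (\<nu> F, F) \<noteq> 0"
  shows "admissible m d (\<nu> F) (cone_form m d \<nu> F) F"
    "incidence_of (\<omega> (\<nu> F), cone_form m d \<nu> F, F) = incidence_of (\<omega> v, q, F)"
proof -
  have F: "F \<in> S d" and v: "v \<noteq> 0" and inv: "\<And>x s. \<omega> v x = 0 \<Longrightarrow> q (x + smul s v) = q x"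
    and F0: "F \<noteq> 0" using a by (auto simp: admissible_def)
  obtain g where g: "g \<in> S (d - m)" "\<And>x. \<omega> v x = 0 \<Longrightarrow> F x = q x * g x" using a by (auto simp: admissible_def)
  obtain x\<^sub>0 where x\<^sub>0: "\<omega> v x\<^sub>0 = 0" "q x\<^sub>0 \<noteq> 0" using a by (auto simp: admissible_def)
  obtain \<kappa> where \<kappa>: "\<And>c x. \<omega> v x = 0 \<Longrightarrow> coefd d (d - m) (\<lambda>s. F (x + smul s (smul c v))) = c ^ (d - m) * \<kappa> * q x"
    by (rule cone_coefficient[OF a md]) (rule that)
  define k where "k = c ^ (d - m) * \<kappa>"
  have h: "\<omega> (\<nu> F) x = 0 \<longleftrightarrow> \<omega> v x = 0" for x using \<nu> by (simp add: omega_simps)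
  have cf: "cone_form m d \<nu> F x = k * q x" if "\<omega> v x = 0" for x
    using \<kappa>[OF that, of c] by (simp add: cone_form_def formeval_eq[OF F] \<nu>(1) k_def)
  have k: "k \<noteq> 0"
  proof
    assume "k = 0"
    then have "cone_form m d \<nu> F (test_vec (\<nu> F)) = 0" using cf[of "test_vec (\<nu> F)"] h test_vec_hyp[of "\<nu> F"] by simp
    then show False using t by (simp add: cone_form_def polar_coeff_def)
  qed
  obtain G where G: "\<And>j. j \<le> d \<Longrightarrow> G j \<in> S (d - j)" "\<And>x s. F (x + smul s (\<nu> F)) = (\<Sum>j\<le>d. s ^ j * G j x)"
    using taylor[OF F, of "\<nu> F"] by metis
  have "cone_form m d \<nu> F x = G (d - m) x" for x
    using coefd_eq[OF degree_poly_of_coeffs, of "\<lambda>s. F (x + smul s (\<nu> F))" d "\<lambda>j. G j x" "d - m"]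
    by (simp add: cone_form_def formeval_eq[OF F] G(2) poly_poly_of_coeffs coeff_poly_of_coeffs)
  then have "cone_form m d \<nu> F = G (d - m)" by auto
  then have cS: "cone_form m d \<nu> F \<in> S m" using G(1)[of "d - m"] md by simp
  show "admissible m d (\<nu> F) (cone_form m d \<nu> F) F"
    unfolding admissible_def h
  proof (intro conjI allI impI)
    show "\<nu> F \<noteq> 0" using \<nu> v by simp
    show "cone_form m d \<nu> F (x + smul s (\<nu> F)) = cone_form m d \<nu> F x" if x: "\<omega> v x = 0" for x s
    proof -
      have "\<omega> v (x + smul s (\<nu> F)) = 0" using x \<nu>(1) by (simp add: omega_simps)
      from cf[OF this] cf[OF x] inv[OF x, of "s * c"] show ?thesis by (simp add: \<nu>(1))
    qed
    show "\<exists>x. \<omega> v x = 0 \<and> cone_form m d \<nu> F x \<noteq> 0" using x\<^sub>0 cf k by (intro exI[of _ x\<^sub>0]) simp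
    show "\<exists>g\<in>S (d - m). \<forall>x. \<omega> v x = 0 \<longrightarrow> F x = cone_form m d \<nu> F x * g x"
      by (rule bexI[OF _ sym_forms_scale[OF g(1), of "1 / k"]]) (use cf k g(2) in auto)
  qed fact+
  show "incidence_of (\<omega> (\<nu> F), cone_form m d \<nu> F, F) = incidence_of (\<omega> v, q, F)"
    by (rule incidence_of_eqI[OF \<nu>(1,2) k, of 1]) (use cf in auto)
qed

text \<open>Only the arguments of \<open>\<nu>\<close> and \<open>cone_form\<close> are rescaled,
  while the last component stays \<open>F\<close>; the scalar moves the evaluation to a
  representative where the polynomials do not vanish.\<close>

lemma poly_funs_section:
  assumes \<nu>: "(\<lambda>F. X0 (\<nu> F)) \<in> poly_funs fscale" "(\<lambda>F. X1 (\<nu> F)) \<in> poly_funs fscale"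
    "(\<lambda>F. X2 (\<nu> F)) \<in> poly_funs fscale" "(\<lambda>F. X3 (\<nu> F)) \<in> poly_funs fscale"
    and p: "p \<in> poly_funs tscale"
  shows "(\<lambda>F. p (\<omega> (\<nu> (fscale c F)), cone_form m d \<nu> (fscale c F), F)) \<in> poly_funs fscale"
  using p
proof (induction rule: poly_funs.induct)
  case (const a) show ?case by (rule poly_funs.const)
next
  case (linear \<phi>)
  obtain \<phi>1 \<phi>2 \<phi>3 where \<phi>: "Vector_Spaces.linear fscale (*) \<phi>1" "Vector_Spaces.linear fscale (*) \<phi>2"
    "Vector_Spaces.linear fscale (*) \<phi>3" "\<And>l q F. \<phi> (l, q, F) = \<phi>1 l + \<phi>2 q + \<phi>3 F"
    by (rule linear_tscale_decompose[OF linear]) (rule that)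
  have "\<phi>1 (\<omega> u) = X0 u * \<phi>1 (\<omega> e\<^sub>1) + X1 u * \<phi>1 (\<omega> f\<^sub>1) + X2 u * \<phi>1 (\<omega> e\<^sub>2) + X3 u * \<phi>1 (\<omega> f\<^sub>2)" for u
  proof -
    have "\<omega> (vec (X0 u) (X1 u) (X2 u) (X3 u)) = fscale (X0 u) (\<omega> e\<^sub>1) + fscale (X1 u) (\<omega> f\<^sub>1)
        + fscale (X2 u) (\<omega> e\<^sub>2) + fscale (X3 u) (\<omega> f\<^sub>2)"
      by (auto simp: vec_def omega_simps fscale_def)
    then show ?thesis
      by (simp only: vec_coord linear_functional_add[OF \<phi>(1)] linear_functional_scale[OF \<phi>(1)])
  qed
  then have "(\<lambda>F. \<phi>1 (\<omega> (\<nu> F))) = (\<lambda>F. X0 (\<nu> F) * \<phi>1 (\<omega> e\<^sub>1) + X1 (\<nu> F) * \<phi>1 (\<omega> f\<^sub>1)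
      + X2 (\<nu> F) * \<phi>1 (\<omega> e\<^sub>2) + X3 (\<nu> F) * \<phi>1 (\<omega> f\<^sub>2))" by (rule ext)
  then have 1: "(\<lambda>F. \<phi>1 (\<omega> (\<nu> F))) \<in> poly_funs fscale"
    by (rule ssubst) (intro poly_funs.add poly_funs.mult poly_funs.const \<nu>)
  have "(\<lambda>z. cone_form m d \<nu> (snd z) (fst z)) \<in> bip"
    unfolding cone_form_def
    by (intro coefd_bip formeval_compose_bip)
      (simp_all add: bip_coord function_ring_add[OF function_ring_bip] function_ring_mult[OF function_ring_bip]
        function_ring_const[OF function_ring_bip] bip_form[OF \<nu>(1)] bip_form[OF \<nu>(2)] bip_form[OF \<nu>(3)] bip_form[OF \<nu>(4)])
  then obtain A C where C: "finite A" "\<And>\<beta>. C \<beta> \<in> poly_funs fscale"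
    "\<And>v F. cone_form m d \<nu> (snd (v, F)) (fst (v, F)) = (\<Sum>\<beta>\<in>A. C \<beta> F * mon \<beta> v)" by (rule bip_expand) (rule that)
  have "\<phi>2 (cone_form m d \<nu> F) = (\<Sum>\<beta>\<in>A. C \<beta> F * \<phi>2 (mon \<beta>))" for F
  proof -
    interpret l: Vector_Spaces.linear fscale "(*)" \<phi>2 by (rule \<phi>(2))
    have "cone_form m d \<nu> F = (\<Sum>\<beta>\<in>A. fscale (C \<beta> F) (mon \<beta>))"
      using C(3) by (auto simp: sum_fun_apply fscale_def)
    then show ?thesis by (simp add: l.sum l.scale)
  qed
  then have "(\<lambda>F. \<phi>2 (cone_form m d \<nu> F)) = (\<lambda>F. \<Sum>\<beta>\<in>A. C \<beta> F * \<phi>2 (mon \<beta>))" by (rule ext)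
  then have 2: "(\<lambda>F. \<phi>2 (cone_form m d \<nu> F)) \<in> poly_funs fscale"
    by (rule ssubst) (intro poly_funs_sum poly_funs.mult poly_funs.const C(1,2))
  show ?case unfolding \<phi>(4)
    by (intro poly_funs.add poly_funs.linear \<phi>(3)
        poly_funs_comp_scale[OF vector_space_fscale 1] poly_funs_comp_scale[OF vector_space_fscale 2])
next
  case (add p q) show ?case by (rule poly_funs.add[OF add.IH])
next
  case (mult p q) show ?case by (rule poly_funs.mult[OF mult.IH])
qed

lemma basis_coord: "X0 e\<^sub>1 = 1" "X1 e\<^sub>1 = 0" "X2 e\<^sub>1 = 0" "X3 e\<^sub>1 = 0"
    "X0 e\<^sub>2 = 0" "X1 e\<^sub>2 = 0" "X2 e\<^sub>2 = 1" "X3 e\<^sub>2 = 0"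
  by (simp_all add: X0_def X1_def X2_def X3_def basis_omega basis_omega' alternating)

lemma admissible_cone:
  assumes "m \<le> d" "F \<in> S d" "g \<in> S (d - m)" "\<And>x. X1 x = 0 \<Longrightarrow> F x = X2 x ^ m * g x" "F \<noteq> 0"
  shows "admissible m d e\<^sub>1 (\<lambda>x. X2 x ^ m) F"
  unfolding admissible_def X1_def[symmetric]
proof (intro conjI allI impI)
  show "e\<^sub>1 \<noteq> 0" using basis_omega(1) by (auto simp: omega_zero)
  show "(\<lambda>x. X2 x ^ m) \<in> S m" by (intro sym_forms_power coord_dual)
  show "X2 (x + smul s e\<^sub>1) ^ m = X2 x ^ m" for x s by (simp add: basis_coord)
  show "\<exists>x. X1 x = 0 \<and> X2 x ^ m \<noteq> 0" by (rule exI[of _ e\<^sub>2]) (simp add: basis_coord)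
  show "\<exists>g\<in>S (d - m). \<forall>x. X1 x = 0 \<longrightarrow> F x = X2 x ^ m * g x" using assms by blast
qed fact+

text \<open>One form does not serve both conditions: \<open>D\<close> is nonzero at
  \<open>F\<^sub>0\<close>, but for \<open>d > m\<close> the cofactor \<open>X2^(d-m)\<close> of its
  cone vanishes at \<open>e\<^sub>1\<close>. The form \<open>X0^(d-m) X2^m\<close> has the same cone
  and polar coefficient 1, and irreducibility supplies a point that meets both conditions.\<close>

lemma generic_point_exists:
  assumes md: "2 \<le> m" "m \<le> d" "3 \<le> d" and D: "D \<in> poly_funs fscale" "D (F\<^sub>0 d) \<noteq> 0"
  obtains v q F where "admissible m d v q F" "D F \<noteq> 0" "polar_coeff m d (v, F) \<noteq> 0"
proof -
  let ?q = "\<lambda>x. X2 x ^ m" and ?F1 = "\<lambda>x. X0 x ^ (d - m) * X2 x ^ m"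
  have F0S: "F\<^sub>0 d \<in> S d" using F\<^sub>0_form md by simp
  have "F\<^sub>0 d e\<^sub>2 = 1" using md by (simp add: F\<^sub>0_def basis_coord)
  then have F0nz: "F\<^sub>0 d \<noteq> 0" by (metis zero_fun_apply zero_neq_one)
  have a0: "admissible m d e\<^sub>1 ?q (F\<^sub>0 d)"
  proof (rule admissible_cone[OF md(2) F0S _ _ F0nz])
    show "(\<lambda>x. X2 x ^ (d - m)) \<in> S (d - m)" by (intro sym_forms_power coord_dual)
    show "F\<^sub>0 d x = X2 x ^ m * X2 x ^ (d - m)" if "X1 x = 0" for x
      using that md by (simp add: F\<^sub>0_def power_add[symmetric] power_0_left)
  qed
  have F1S: "?F1 \<in> S d"
    using sym_forms_mult[OF sym_forms_power sym_forms_power, of X0 "dual_space smul" X2 "d - m" m] md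
    by (simp add: coord_dual)
  have F1nz: "?F1 \<noteq> 0"
  proof
    assume "?F1 = 0"
    from fun_cong[OF this, of "vec 1 0 1 0"] show False by simp
  qed
  have a1: "admissible m d e\<^sub>1 ?q ?F1"
    by (rule admissible_cone[OF md(2) F1S sym_forms_power[OF coord_dual(1)] _ F1nz]) (simp add: mult.commute)
  have t1: "polar_coeff m d (e\<^sub>1, ?F1) = 1"
  proof -
    have "polar_coeff m d (e\<^sub>1, ?F1) = coefd d (d - m) (\<lambda>s. s ^ (d - m))"
      unfolding polar_coeff_def snd_conv fst_conv formeval_eq[OF F1S] by (simp add: test_vec_def basis_coord)
    also have "\<dots> = coeff (monom 1 (d - m)) (d - m)"
      by (rule coefd_eq) (auto simp: poly_monom intro: order_trans[OF degree_monom_le])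
    finally show ?thesis by simp
  qed
  have "\<exists>v q F. admissible m d v q F \<and> D F \<noteq> 0 \<and> polar_coeff m d (v, F) \<noteq> 0"
  proof (rule admissible_irreducible[OF md(2) _ a0 a1])
    show "m > 0" using md by simp
    show "\<exists>p\<in>poly_funs tscale. p (\<omega> v, q, F\<^sub>0 d) \<noteq> 0 \<and>
        (\<forall>v q F. admissible m d v q F \<longrightarrow> p (\<omega> v, q, F) \<noteq> 0 \<longrightarrow> D F \<noteq> 0)" for v q
      by (rule bexI[OF _ poly_funs_form_component[OF D(1)]]) (simp add: D(2))
    fix v q assume a: "admissible m d v q ?F1" "incidence_of (\<omega> v, q, ?F1) = incidence_of (\<omega> e\<^sub>1, ?q, ?F1)"
    have "v \<noteq> 0" "e\<^sub>1 \<noteq> 0" using a(1) a1 unfolding admissible_def by blast+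
    then obtain c where c: "c \<noteq> 0" "v = smul c e\<^sub>1" using incidence_of_eqD[OF a(2) _ _ F1nz] by blast
    have "polar_coeff m d (v, ?F1) \<noteq> 0" unfolding c(2) polar_coeff_smul[OF F1S] t1 using c(1) by simp
    then show "\<exists>p\<in>poly_funs tscale. p (\<omega> v, q, ?F1) \<noteq> 0 \<and>
        (\<forall>v q F. admissible m d v q F \<longrightarrow> p (\<omega> v, q, F) \<noteq> 0 \<longrightarrow> polar_coeff m d (v, F) \<noteq> 0)"
      by (intro bexI[OF _ bip_dual_vec[OF polar_coeff_bip[of m d]]]) (simp add: dual_vec_omega)
  qed
  then show ?thesis using that by blast
qed

section \<open>Dense open sets and the inverse morphism\<close>

lemma incidence_point_cases:
  assumes "x \<in> incidence_points smul \<omega> m d"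
  obtains v q F where "x = incidence_of (\<omega> v, q, F)" "admissible m d v q F" "incidence_map x = fs.span {F}"
proof -
  have "x \<in> points (incidence_variety smul \<omega> m d)" using assms by (simp add: points_incidence_variety)
  then obtain z where z: "z \<in> incidence_coords smul \<omega> m d" "x = incidence_of z"
    unfolding incidence_variety_def points_quotient points_affine by blast
  then obtain v q F where "z = (\<omega> v, q, F)" "admissible m d v q F" unfolding incidence_coords_iff by blast
  then show ?thesis using that z by (simp add: incidence_map_def incidence_of_def)
qed

lemma admissible_incidence_point:
  assumes "admissible m d v q F"
  shows "incidence_of (\<omega> v, q, F) \<in> incidence_points smul \<omega> m d"
    "incidence_map (incidence_of (\<omega> v, q, F)) = fs.span {F}" "(\<omega> v, q, F) \<in> incidence_coords smul \<omega> m d"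
proof -
  show 1: "(\<omega> v, q, F) \<in> incidence_coords smul \<omega> m d" using assms unfolding incidence_coords_iff by blast
  then show "incidence_of (\<omega> v, q, F) \<in> incidence_points smul \<omega> m d" by (auto simp: incidence_coords_def)
  show "incidence_map (incidence_of (\<omega> v, q, F)) = fs.span {F}" by (simp add: incidence_map_def incidence_of_def)
qed

lemma incidence_map_birational:
  assumes md: "2 \<le> m" "m \<le> d" "3 \<le> d"
  shows "birational_morphism (incidence_variety smul \<omega> m d) (involutive_cone_locus smul \<omega> m d) incidence_map"
proof -
  let ?X = "incidence_variety smul \<omega> m d" and ?Y = "involutive_cone_locus smul \<omega> m d"
  let ?P = "projective_funspace fscale (S d)" and ?A = "incidence_map ` incidence_points smul \<omega> m d"
  have Y: "?Y = sub_funspace ?P ?A" by (rule involutive_cone_locus_def)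
  have shX: "sheafy ?X" unfolding incidence_variety_def by (intro sheafy_quotient sheafy_affine)
  have shP: "sheafy ?P" unfolding projective_funspace_def by (intro sheafy_quotient sheafy_affine)
  have ptX: "points ?X = incidence_points smul \<omega> m d" by (rule points_incidence_variety)
  have ptY: "points ?Y = ?A" by (rule points_involutive_cone_locus)
  have "morphism ?X ?P incidence_map"
    unfolding incidence_variety_def projective_funspace_def
  proof (rule morphism_quotient_lift[where h="\<lambda>z. snd (snd z)"])
    fix z assume "z \<in> incidence_coords smul \<omega> m d"
    then show "snd (snd z) \<in> S d - {0} \<and> fs.span {snd (snd z)} = incidence_map (incidence_of z)"
      unfolding incidence_coords_iff by (auto simp: admissible_def incidence_map_def incidence_of_def)
  next
    fix p :: "('v \<Rightarrow> complex) \<Rightarrow> complex" assume "p \<in> poly_funs fscale"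
    from poly_funs_form_component[OF this] show "p \<circ> (\<lambda>z. snd (snd z)) \<in> poly_funs tscale" by (simp add: o_def)
  qed
  then have mor: "morphism ?X ?Y incidence_map" unfolding Y by (rule morphism_sub_codom[OF _ shX]) (simp add: ptX)
  obtain D \<nu> where D: "D \<in> poly_funs fscale" "D (F\<^sub>0 d) \<noteq> 0"
    and \<nu>p: "(\<lambda>F. X0 (\<nu> F)) \<in> poly_funs fscale" "(\<lambda>F. X1 (\<nu> F)) \<in> poly_funs fscale"
    "(\<lambda>F. X2 (\<nu> F)) \<in> poly_funs fscale" "(\<lambda>F. X3 (\<nu> F)) \<in> poly_funs fscale"
    and \<nu>: "\<And>v F. compat m d v F \<Longrightarrow> v \<noteq> 0 \<Longrightarrow> D F \<noteq> 0 \<Longrightarrow> \<exists>c. c \<noteq> 0 \<and> \<nu> F = smul c v"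
    by (rule generic_polar_point[OF md]) (rule that)
  \<comment> \<open>The first factor makes \<open>\<nu> F\<close> the polar point, the second makes
    the extracted coefficient a nonzero multiple of the cone equation.\<close>
  define R where "R = (\<lambda>F. D F * polar_coeff m d (\<nu> F, F))"
  have R: "R \<in> poly_funs fscale" unfolding R_def
    by (intro poly_funs.mult D bip_compose[OF polar_coeff_bip function_ring_poly_funs \<nu>p])
  have Rc: "(\<lambda>F. R (fscale c F)) \<in> poly_funs fscale" for c by (rule poly_funs_comp_scale[OF vector_space_fscale R])
  define h where "h = (\<lambda>c F. (\<omega> (\<nu> (fscale c F)), cone_form m d \<nu> (fscale c F), F))"
  have h: "h c F \<in> incidence_coords smul \<omega> m d \<and> incidence_of (h c F) = x"
    if x: "x \<in> incidence_points smul \<omega> m d" "incidence_map x = fs.span {F}" and F: "F \<noteq> 0"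
      and c: "c \<noteq> 0" "R (fscale c F) \<noteq> 0" for x F c
  proof -
    obtain v q F' where x': "x = incidence_of (\<omega> v, q, F')" "admissible m d v q F'" "incidence_map x = fs.span {F'}"
      by (rule incidence_point_cases[OF x(1)])
    obtain k where k: "k \<noteq> 0" "F = fscale k F'" using span_singleton_eqD[OF vector_space_fscale, of F F'] x'(3) x(2) F by auto
    have a: "admissible m d v q (fscale c F)" using admissible_fscale[OF admissible_fscale[OF x'(2) k(1)] c(1)] k(2) by simp
    then have "v \<noteq> 0" by (simp add: admissible_def)
    then obtain b where b: "b \<noteq> 0" "\<nu> (fscale c F) = smul b v" using \<nu>[OF admissible_compat[OF a]] c(2) by (auto simp: R_def)
    have t: "polar_coeff m d (\<nu> (fscale c F), fscale c F) \<noteq> 0" using c(2) by (simp add: R_def)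
    note s = admissible_section[where \<nu>=\<nu> and F="fscale c F", OF a md(2) b(2,1) t]
    have "admissible m d (\<nu> (fscale c F)) (cone_form m d \<nu> (fscale c F)) (fscale (1 / c) (fscale c F))"
      by (rule admissible_fscale[OF s(1)]) (use c in simp)
    then have "admissible m d (\<nu> (fscale c F)) (cone_form m d \<nu> (fscale c F)) F" using c(1) by simp
    then have "h c F \<in> incidence_coords smul \<omega> m d" unfolding h_def by (rule admissible_incidence_point)
    moreover have "incidence_of (h c F) = x"
      using s(2) c(1) unfolding h_def x'(1) k(2) by (simp only: incidence_of_fscale k(1) not_False_eq_True)
    ultimately show ?thesis ..
  qed
  \<comment> \<open>\<open>R\<close> need not be homogeneous and may vanish at one representative of
    a line but not at another; allowing a scalar \<open>c\<close> gives an open condition on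
    lines.\<close>
  define W where "W = {L \<in> ?A. \<exists>F c. F \<in> S d - {0} \<and> L = fs.span {F} \<and> c \<noteq> 0 \<and> R (fscale c F) \<noteq> 0}"
  have Wrep: "\<exists>c. c \<noteq> 0 \<and> R (fscale c F) \<noteq> 0" if L: "fs.span {F} \<in> W" for F
  proof -
    obtain F' c where F': "F' \<noteq> 0" "fs.span {F} = fs.span {F'}" "c \<noteq> 0" "R (fscale c F') \<noteq> 0"
      using L unfolding W_def by blast
    then obtain k where k: "k \<noteq> 0" "F' = fscale k F" using span_singleton_eqD[OF vector_space_fscale, of F' F] by auto
    then show ?thesis using F' by (intro exI[of _ "c * k"]) simp
  qed
  have WA: "W \<subseteq> ?A" by (auto simp: W_def)
  have Wlines: "W \<subseteq> lines fscale (S d)" by (auto simp: W_def lines_def)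
  have Wopen: "openin (topo ?Y) W"
  proof -
    let ?O = "{fs.span {F} | F. F \<in> S d - {0} \<and> (\<exists>c. c \<noteq> 0 \<and> R (fscale c F) \<noteq> 0)}"
    have "{F \<in> S d - {0}. fs.span {F} \<in> ?O} = {F \<in> S d - {0}. \<exists>c. c \<noteq> 0 \<and> R (fscale c F) \<noteq> 0}"
    proof (rule equalityI; rule subsetI)
      fix F assume "F \<in> {F \<in> S d - {0}. fs.span {F} \<in> ?O}"
      then obtain F' c where F: "F \<in> S d - {0}" "fs.span {F} = fs.span {F'}" "F' \<noteq> 0" "c \<noteq> 0" "R (fscale c F') \<noteq> 0" by auto
      then obtain k where k: "k \<noteq> 0" "F' = fscale k F" using span_singleton_eqD[OF vector_space_fscale, of F' F] by auto
      then have "c * k \<noteq> 0 \<and> R (fscale (c * k) F) \<noteq> 0" using F by simp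
      then show "F \<in> {F \<in> S d - {0}. \<exists>c. c \<noteq> 0 \<and> R (fscale c F) \<noteq> 0}" using F(1) by blast
    qed auto
    moreover have "openin (topo (affine_funspace fscale (S d - {0}))) {F \<in> S d - {0}. \<exists>c. c \<noteq> 0 \<and> R (fscale c F) \<noteq> 0}"
      unfolding openin_affine
    proof (intro conjI ballI)
      fix F assume "F \<in> {F \<in> S d - {0}. \<exists>c. c \<noteq> 0 \<and> R (fscale c F) \<noteq> 0}"
      then obtain c where "c \<noteq> 0" "R (fscale c F) \<noteq> 0" by blast
      then show "\<exists>p\<in>poly_funs fscale. p F \<noteq> 0 \<and>
          (\<forall>y\<in>S d - {0}. p y \<noteq> 0 \<longrightarrow> y \<in> {F \<in> S d - {0}. \<exists>c. c \<noteq> 0 \<and> R (fscale c F) \<noteq> 0})"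
        by (intro bexI[OF _ Rc[of c]]) auto
    qed auto
    ultimately have "openin (topo ?P) ?O"
      unfolding projective_funspace_def openin_quotient points_affine by auto
    moreover have "W = ?O \<inter> ?A" by (auto simp: W_def)
    ultimately show ?thesis unfolding Y topo_sub by (auto simp: openin_subtopology)
  qed
  define U where "U = {x \<in> points ?X. incidence_map x \<in> W}"
  have cont: "continuous_map (topo ?X) (topo ?Y) incidence_map" using mor by (simp add: morphism_def)
  have Uopen: "openin (topo ?X) U" unfolding U_def by (rule openin_continuous_map_preimage[OF cont Wopen])
  have Unonempty: "U \<noteq> {}"
  proof -
    obtain v q F where a: "admissible m d v q F" and "D F \<noteq> 0" "polar_coeff m d (v, F) \<noteq> 0"
      by (rule generic_point_exists[OF md D])
    have vF: "v \<noteq> 0" "F \<in> S d" "F \<noteq> 0" using a by (auto simp: admissible_def)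
    obtain c where "c \<noteq> 0" "\<nu> F = smul c v" using \<nu>[OF admissible_compat[OF a] vF(1) \<open>D F \<noteq> 0\<close>] by blast
    then have "R F \<noteq> 0" using \<open>D F \<noteq> 0\<close> \<open>polar_coeff m d (v, F) \<noteq> 0\<close> polar_coeff_smul[OF vF(2)] by (simp add: R_def)
    then have "R (fscale 1 F) \<noteq> 0" by simp
    moreover have "fs.span {F} \<in> ?A" using admissible_incidence_point[OF a] by (metis imageI)
    ultimately have "fs.span {F} \<in> W" unfolding W_def using vF(2,3) by (auto intro!: exI[of _ F] exI[of _ "1::complex"])
    then have "incidence_of (\<omega> v, q, F) \<in> U" using admissible_incidence_point[OF a] by (simp add: U_def ptX)
    then show ?thesis by blast
  qed
  have m0: "m > 0" using md by simp
  have Umeets: "U \<inter> T \<noteq> {}" if "openin (topo ?X) T" "T \<noteq> {}" for T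
    by (rule incidence_variety_irreducible[OF md(2) m0 Uopen that(1) Unonempty that(2)])
  have Udense: "dense_open ?X U"
    unfolding dense_open_def using Uopen Umeets by (auto simp: dense_intersects_open)
  \<comment> \<open>Density passes down because the projection is onto the locus: a nonempty open
    set has a nonempty open preimage, which meets \<open>U\<close>.\<close>
  have Wdense: "dense_open ?Y W"
    unfolding dense_open_def dense_intersects_open
  proof (intro conjI allI impI Wopen)
    fix T assume T: "openin (topo ?Y) T \<and> T \<noteq> {}"
    then obtain L where L: "L \<in> T" by blast
    then have "L \<in> ?A" using T openin_subset[of "topo ?Y" T] ptY by blast
    then have "{x \<in> points ?X. incidence_map x \<in> T} \<noteq> {}" using L ptX by blast
    moreover have "openin (topo ?X) {x \<in> points ?X. incidence_map x \<in> T}"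
      using T by (intro openin_continuous_map_preimage[OF cont]) simp
    ultimately have "U \<inter> {x \<in> points ?X. incidence_map x \<in> T} \<noteq> {}" by (intro Umeets)
    then show "W \<inter> T \<noteq> {}" by (auto simp: U_def)
  qed
  have ptU: "points (sub_funspace ?X U) = U" by (auto simp: topo_sub U_def)
  have ptW: "points (sub_funspace ?Y W) = W" using WA ptY by (auto simp: topo_sub)
  have fwd: "morphism (sub_funspace ?X U) (sub_funspace ?Y W) incidence_map"
    by (rule morphism_sub_codom[OF morphism_sub_dom[OF mor] sheafy_sub[OF shX]]) (unfold ptU, auto simp: U_def)
  \<comment> \<open>An arbitrary preimage: over \<open>W\<close> it equals the point computed by
    \<open>h\<close>, so it is unique and has polynomial local lifts.\<close>
  define G where "G = (\<lambda>L. SOME x. x \<in> incidence_points smul \<omega> m d \<and> incidence_map x = L)"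
  have G: "G L \<in> incidence_points smul \<omega> m d" "incidence_map (G L) = L" if "L \<in> W" for L
  proof -
    have "\<exists>x. x \<in> incidence_points smul \<omega> m d \<and> incidence_map x = L" using that WA by blast
    from someI_ex[OF this] show "G L \<in> incidence_points smul \<omega> m d" "incidence_map (G L) = L" by (auto simp: G_def)
  qed
  have "morphism (sub_funspace ?P W) ?X G"
    unfolding incidence_variety_def
  proof (rule morphism_from_projective_sub[OF vector_space_fscale _ Wlines])
    show "fs.subspace (S d)" unfolding sym_forms_def by (rule fs.subspace_span)
    fix F assume F: "F \<in> S d - {0}" "fs.span {F} \<in> W"
    then obtain c where c: "c \<noteq> 0" "R (fscale c F) \<noteq> 0" using Wrep by blast
    show "\<exists>h r. r \<in> poly_funs fscale \<and> r F \<noteq> 0 \<and> (\<forall>p\<in>poly_funs tscale. p \<circ> h \<in> poly_funs fscale) \<and>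
        (\<forall>y\<in>S d - {0}. fs.span {y} \<in> W \<and> r y \<noteq> 0 \<longrightarrow> h y \<in> incidence_coords smul \<omega> m d \<and> incidence_of (h y) = G (fs.span {y}))"
    proof (rule exI[of _ "h c"], rule exI[of _ "\<lambda>F. R (fscale c F)"], intro conjI ballI impI)
      show "p \<circ> h c \<in> poly_funs fscale" if "p \<in> poly_funs tscale" for p
        using poly_funs_section[OF \<nu>p that, of c m d] by (simp add: h_def o_def)
      fix y assume y: "y \<in> S d - {0}" "fs.span {y} \<in> W \<and> R (fscale c y) \<noteq> 0"
      have "h c y \<in> incidence_coords smul \<omega> m d \<and> incidence_of (h c y) = G (fs.span {y})"
        by (rule h) (use G y c in auto)
      then show "h c y \<in> incidence_coords smul \<omega> m d" "incidence_of (h c y) = G (fs.span {y})" by auto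
    qed (use Rc c in auto)
  qed
  moreover have "?A \<inter> W = W" using WA by blast
  ultimately have "morphism (sub_funspace ?Y W) ?X G" unfolding Y by (intro morphism_sub_sub_dom) simp
  then have bwd: "morphism (sub_funspace ?Y W) (sub_funspace ?X U) G"
  proof (rule morphism_sub_codom)
    show "sheafy (sub_funspace ?Y W)" unfolding Y by (intro sheafy_sub shP)
    show "G ` points (sub_funspace ?Y W) \<subseteq> U" unfolding ptW using G by (auto simp: U_def ptX)
  qed
  have "isomorphism (sub_funspace ?X U) (sub_funspace ?Y W) incidence_map"
    unfolding isomorphism_def
  proof (intro conjI exI[of _ G] ballI fwd bwd)
    fix x assume "x \<in> points (sub_funspace ?X U)"
    then have x: "x \<in> incidence_points smul \<omega> m d" "incidence_map x \<in> W" unfolding ptU by (auto simp: U_def ptX)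
    obtain v q F where F: "admissible m d v q F" "incidence_map x = fs.span {F}" by (rule incidence_point_cases[OF x(1)])
    then have F0: "F \<noteq> 0" by (simp add: admissible_def)
    obtain c where c: "c \<noteq> 0" "R (fscale c F) \<noteq> 0" using Wrep x(2) F(2) by auto
    have "incidence_of (h c F) = x" using h[OF x(1) F(2) F0 c] by blast
    moreover have "incidence_of (h c F) = G (incidence_map x)" using h[OF G(1)[OF x(2)] _ F0 c] G(2)[OF x(2)] F(2) by simp
    ultimately show "G (incidence_map x) = x" by simp
  next
    fix L assume "L \<in> points (sub_funspace ?Y W)"
    then show "incidence_map (G L) = L" unfolding ptW by (rule G)
  qed
  then show ?thesis unfolding birational_morphism_def using mor Udense Wdense by blast
qed

end

theorem theorem7p2:
  fixes smul :: "complex \<Rightarrow> 'v \<Rightarrow> 'v::ab_group_add"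
    and \<omega> :: "'v \<Rightarrow> 'v \<Rightarrow> complex"
    and n m d :: nat
  assumes "symplectic_space smul \<omega>"
    and "vector_space.dim smul (UNIV :: 'v set) = 2 * n"
    and "n = 2"
    and "m \<ge> 2"
    and "d \<ge> m"
    and "(m, d) \<noteq> (2, 2)"
  shows "birational_morphism (incidence_variety smul \<omega> m d)
           (involutive_cone_locus smul \<omega> m d) incidence_map"
proof -
  interpret symplectic_space smul \<omega> by fact
  obtain e1 f1 e2 f2 where "symplectic_basis smul \<omega> e1 f1 e2 f2"
    using symplectic_basis_exists assms(2,3) by auto
  then interpret symplectic_basis smul \<omega> e1 f1 e2 f2 .
  \<comment> \<open>For \<open>2 \<le> m \<le> d\<close>, excluding the pair \<open>(2, 2)\<close>
    is the same as \<open>d \<ge> 3\<close>.\<close>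
  show ?thesis by (rule incidence_map_birational) (use assms(4-6) in auto)
qed

end
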